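(* Let $\mu_1\in\mathcal G$ be a Hölder Gibbs probability with Hölder Jacobian $J_1$, and let $\xi$ be a tangent vector to $\mathcal G$ at $\mu_1$. For $\theta\in\mathbb R$ let $\mu^\theta$ be the equilibrium probability for the potential $\log J_1+\theta\,\xi$. Then, as $\theta\to0$, $$D_{KL}(\mu_1,\mu^\theta)=\frac{\theta^2}{2}\int\xi^2\,d\mu_1+o(\theta^2),$$ where $\int\xi^2\,d\mu_1$ is the Fisher information $\mathfrak F_{\mu_1,\xi}$ of $\xi$ and $\mu_1$.
   Context: Let $d\ge 2$, $\Omega=\{1,\dots,d\}^{\mathbb N}$ with metric $d(x,y)=2^{-N}$, where $N$ is the smallest $j$ with $x_j\ne y_j$ (and $d(x,x)=0$), and let $\sigma$ be the shift. For $a\in\{1,\dots,d\}$ write $ax=(a,x_1,x_2,\dots)$. A Hölder Jacobian is a positive Hölder function $J:\Omega\to(0,1)$ with $\sum_{a=1}^d J(ax)=1$ for all $x$. Ruelle operator: $\mathcal L_{\log J}(\varphi)(x)=\sum_{a=1}^d J(ax)\varphi(ax)$; its dual is given by $\int\varphi\,d\mathcal L^*_{\log J}(\rho)=\int\mathcal L_{\log J}(\varphi)\,d\rho$ for continuous $\varphi$. $\mathcal G$ denotes the set of Hölder Gibbs probabilities: the $\sigma$-invariant probabilities $\mu$ with $\mathcal L_{\log J}^*(\mu)=\mu$ for some Hölder Jacobian $J$. The map $\mu\leftrightarrow J$ is a bijection between $\mathcal G$ and Hölder Jacobians, and $J$ is called the Jacobian of $\mu$. For a Hölder potential $A$, the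 equilibrium probability is the unique $\sigma$-invariant probability maximizing $\int A\,d\mu+h(\mu)$ over $\sigma$-invariant probabilities ($h$ is the Kolmogorov-Shannon entropy); it belongs to $\mathcal G$. A tangent vector to $\mathcal G$ at $\mu$ (with Jacobian $J$) is a Hölder function $\xi:\Omega\to\mathbb R$ with $\mathcal L_{\log J}(\xi)=0$. KL divergence: for $\nu_1,\nu_2\in\mathcal G$ with Jacobians $J_{\nu_1},J_{\nu_2}$, $D_{KL}(\nu_1,\nu_2)=-\int\log J_{\nu_2}\,d\nu_1+\int\log J_{\nu_1}\,d\nu_1$. Fisher information: with $\mu_\theta$ the equilibrium probability of $\log J+\theta\xi$, set $V_n^\xi(x)=\frac{d}{d\theta}\big|_{\theta=0}\log\mu_\theta(\overline{x_1,\dots,x_{n-1}})$, where $\overline{x_1,\dots,x_{n-1}}$ is the cylinder of points whose first $n-1$ coordinates are $x_1,\dots,x_{n-1}$, and $\mathfrak F_{\mu,\xi}=\lim_{n\to\infty}\frac1n\int V_n^\xi(x)^2\,d\mu(x)$. *)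

theory Defs
  imports "HOL-Probability.Probability" "HOL-Library.Landau_Symbols"
begin

text \<open>
  The space $\{1,\dots,d\}^{\mathbb N}$ is \<^typ>\<open>'a stream\<close> for a finite type \<^typ>\<open>'a\<close>
  of cardinality $d$; the shift is \<^const>\<open>stl\<close> and $ax$ is \<open>a ## x\<close>. Stream positions
  start at 0, hence the \<^const>\<open>Suc\<close> in the exponent of the metric.
\<close>

lemma stream_neq_position: "x \<noteq> y \<longleftrightarrow> (\<exists>j. x !! j \<noteq> y !! j)"
  using smap_alt[of id x y] by (simp add: stream.map_id)

instantiation stream :: (type) metric_space
begin

definition dist_stream :: "'a stream \<Rightarrow> 'a stream \<Rightarrow> real" where
  "dist x (y :: 'a stream) = (if x = y then 0 else (1/2) ^ Suc (LEAST j. x !! j \<noteq> y !! j))"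

definition uniformity_stream :: "('a stream \<times> 'a stream) filter" where
  "uniformity = (INF e\<in>{0<..}. principal {(x, y :: 'a stream). dist x y < e})"

definition open_stream :: "'a stream set \<Rightarrow> bool" where
  "open (U :: 'a stream set) \<longleftrightarrow> (\<forall>x\<in>U. \<forall>\<^sub>F (x', y) in uniformity. x' = x \<longrightarrow> y \<in> U)"

instance
proof
  fix x y z :: "'a stream"
  show "dist x y = 0 \<longleftrightarrow> x = y"
    by (simp add: dist_stream_def)
  show "dist x y \<le> dist x z + dist y z"
  proof (cases "x = y \<or> x = z \<or> y = z")
    case True
    moreover have "(LEAST j. y !! j \<noteq> x !! j) = (LEAST j. x !! j \<noteq> y !! j)"
      by (rule arg_cong[where f = Least]) auto
    ultimately show ?thesis unfolding dist_stream_def by auto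
  next
    case False
    let ?N = "\<lambda>u v. LEAST j. u !! j \<noteq> (v :: 'a stream) !! j"
    have "x !! ?N x y \<noteq> y !! ?N x y"
      using False LeastI_ex[of "\<lambda>j. x !! j \<noteq> y !! j"] stream_neq_position by blast
    then have "x !! ?N x y \<noteq> z !! ?N x y \<or> y !! ?N x y \<noteq> z !! ?N x y" by auto
    then have "?N x z \<le> ?N x y \<or> ?N y z \<le> ?N x y"
      by (auto intro: Least_le)
    then have "dist x y \<le> dist x z \<or> dist x y \<le> dist y z"
      using False by (auto simp: dist_stream_def intro!: power_decreasing)
    moreover have "0 \<le> dist x z" "0 \<le> dist y z"
      by (simp_all add: dist_stream_def)
    ultimately show ?thesis by linarith
  qed
qed (simp_all add: uniformity_stream_def open_stream_def)

end

definition holder :: "('a stream \<Rightarrow> real) \<Rightarrow> bool" where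
  "holder f \<longleftrightarrow> (\<exists>C \<alpha>. 0 < \<alpha> \<and> \<alpha> \<le> 1 \<and> (\<forall>x y. \<bar>f x - f y\<bar> \<le> C * dist x y powr \<alpha>))"

definition holder_jacobian :: "('a::finite stream \<Rightarrow> real) \<Rightarrow> bool" where
  "holder_jacobian J \<longleftrightarrow>
     holder J \<and> (\<forall>x. 0 < J x \<and> J x < 1) \<and> (\<forall>x. (\<Sum>a\<in>UNIV. J (a ## x)) = 1)"

text \<open>\<open>ruelle J\<close> is the Ruelle operator of the potential $\log J$.\<close>

definition ruelle :: "('a::finite stream \<Rightarrow> real) \<Rightarrow> ('a stream \<Rightarrow> real) \<Rightarrow> 'a stream \<Rightarrow> real" where
  "ruelle J \<phi> x = (\<Sum>a\<in>UNIV. J (a ## x) * \<phi> (a ## x))"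

definition shift_invariant_prob :: "'a stream measure \<Rightarrow> bool" where
  "shift_invariant_prob \<mu> \<longleftrightarrow> prob_space \<mu> \<and> sets \<mu> = sets borel \<and> distr \<mu> borel stl = \<mu>"

text \<open>\<open>is_ruelle_dual J \<rho> \<rho>'\<close> says that the Borel measure \<open>\<rho>'\<close> is the image of
  \<open>\<rho>\<close> under the dual of \<open>ruelle J\<close>.\<close>

definition is_ruelle_dual ::
    "('a::finite stream \<Rightarrow> real) \<Rightarrow> 'a stream measure \<Rightarrow> 'a stream measure \<Rightarrow> bool" where
  "is_ruelle_dual J \<rho> \<rho>' \<longleftrightarrow> finite_measure \<rho>' \<and> sets \<rho>' = sets borel \<and>
     (\<forall>\<phi>. continuous_on UNIV \<phi> \<longrightarrow> (\<integral>x. \<phi> x \<partial>\<rho>') = (\<integral>x. ruelle J \<phi> x \<partial>\<rho>))"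

definition is_jacobian_of :: "('a::finite stream \<Rightarrow> real) \<Rightarrow> 'a stream measure \<Rightarrow> bool" where
  "is_jacobian_of J \<mu> \<longleftrightarrow>
     holder_jacobian J \<and> shift_invariant_prob \<mu> \<and> is_ruelle_dual J \<mu> \<mu>"

definition holder_gibbs :: "'a::finite stream measure set" where
  "holder_gibbs = {\<mu>. \<exists>J. is_jacobian_of J \<mu>}"

definition gibbs_jacobian :: "'a::finite stream measure \<Rightarrow> 'a stream \<Rightarrow> real" where
  "gibbs_jacobian \<mu> = (THE J. is_jacobian_of J \<mu>)"

definition tangent_vector :: "'a::finite stream measure \<Rightarrow> ('a stream \<Rightarrow> real) \<Rightarrow> bool" where
  "tangent_vector \<mu> \<xi> \<longleftrightarrow> holder \<xi> \<and> (\<forall>x. ruelle (gibbs_jacobian \<mu>) \<xi> x = 0)"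

text \<open>Kolmogorov--Sinai entropy of the shift, with natural logarithms. The refined
  partition may contain the empty set, which contributes 0 to the entropy.\<close>

definition finite_partition :: "'a stream set set \<Rightarrow> bool" where
  "finite_partition P \<longleftrightarrow> finite P \<and> partition_on UNIV P \<and> P \<subseteq> sets borel"

definition refined_partition :: "'a stream set set \<Rightarrow> nat \<Rightarrow> 'a stream set set" where
  "refined_partition P n = {(\<Inter>i<n. (stl ^^ i) -` A i) | A. \<forall>i<n. A i \<in> P}"

definition partition_entropy :: "'a stream measure \<Rightarrow> 'a stream set set \<Rightarrow> real" where
  "partition_entropy \<mu> P = - (\<Sum>B\<in>P. measure \<mu> B * ln (measure \<mu> B))"

definition ks_entropy :: "'a stream measure \<Rightarrow> ereal" where
  "ks_entropy \<mu> = (SUP P\<in>Collect finite_partition.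
     lim (\<lambda>n. ereal (partition_entropy \<mu> (refined_partition P n) / real n)))"

definition equilibrium_prob :: "('a stream \<Rightarrow> real) \<Rightarrow> 'a stream measure" where
  "equilibrium_prob A =
     (THE \<mu>. is_arg_max (\<lambda>\<nu>. ereal (\<integral>x. A x \<partial>\<nu>) + ks_entropy \<nu>) shift_invariant_prob \<mu>)"

definition KL_div :: "'a::finite stream measure \<Rightarrow> 'a stream measure \<Rightarrow> real" where
  "KL_div \<nu>\<^sub>1 \<nu>\<^sub>2 =
     - (\<integral>x. ln (gibbs_jacobian \<nu>\<^sub>2 x) \<partial>\<nu>\<^sub>1) + (\<integral>x. ln (gibbs_jacobian \<nu>\<^sub>1 x) \<partial>\<nu>\<^sub>1)"

definition cylinder :: "nat \<Rightarrow> 'a stream \<Rightarrow> 'a stream set" where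
  "cylinder k x = {y. stake k y = stake k x}"

definition log_cylinder_prob ::
    "'a::finite stream measure \<Rightarrow> ('a stream \<Rightarrow> real) \<Rightarrow> nat \<Rightarrow> 'a stream \<Rightarrow> real \<Rightarrow> real" where
  "log_cylinder_prob \<mu> \<xi> n x \<theta> =
     ln (measure (equilibrium_prob (\<lambda>y. ln (gibbs_jacobian \<mu> y) + \<theta> * \<xi> y)) (cylinder (n - 1) x))"

definition fisher_score ::
    "'a::finite stream measure \<Rightarrow> ('a stream \<Rightarrow> real) \<Rightarrow> nat \<Rightarrow> 'a stream \<Rightarrow> real" where
  "fisher_score \<mu> \<xi> n x = deriv (log_cylinder_prob \<mu> \<xi> n x) 0"

text \<open>The derivatives defining the scores and their limit exist, and \<open>F\<close> is the Fisher
  information.\<close>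

definition has_fisher_information ::
    "'a::finite stream measure \<Rightarrow> ('a stream \<Rightarrow> real) \<Rightarrow> real \<Rightarrow> bool" where
  "has_fisher_information \<mu> \<xi> F \<longleftrightarrow>
     (\<forall>n\<ge>1. \<forall>x. log_cylinder_prob \<mu> \<xi> n x differentiable at 0) \<and>
     (\<lambda>n. 1 / real n * (\<integral>x. (fisher_score \<mu> \<xi> n x)\<^sup>2 \<partial>\<mu>)) \<longlonglongrightarrow> F"

end

theory Submission
  imports Defs
begin

text \<open>
  Write $L$ for the Ruelle operator of the Jacobian $J_1$ of $\mu_1$, so that $L\xi = 0$.

  For small $\theta$ the operator $\varphi \mapsto L(e^{\theta\xi}\varphi)$ has an eigenfunction
  $h_\theta$ near 1 with eigenvalue $\lambda_\theta$ (\<open>perturbed_eigenfunction\<close>), and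
  $J_\theta = J_1 e^{\theta\xi} h_\theta / (\lambda_\theta\, h_\theta\circ\sigma)$ is a Jacobian
  whose logarithm differs from $\log J_1 + \theta\xi$ by a coboundary and the constant
  $\log\lambda_\theta$. The variational principle (\<open>equilibrium_prob_eq\<close>) identifies
  $\mu^\theta$ with the Gibbs probability of $J_\theta$. Coboundaries and $\xi$ have
  $\mu_1$-integral 0, hence $D_{KL}(\mu_1,\mu^\theta) = \log\lambda_\theta$. Tangency makes the first
  order vanish: $L(e^{\theta\xi}) = 1 + \theta L\xi + O(\theta^2) = 1 + O(\theta^2)$, so
  $h_\theta = 1 + O(\theta^2)$, and integrating the eigenvalue equation gives
  $\lambda_\theta = \int e^{\theta\xi} h_\theta\,d\mu_1 / \int h_\theta\,d\mu_1
  = 1 + \frac{\theta^2}{2}\int\xi^2\,d\mu_1 + O(\theta^3)$.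

  For the Fisher information, let $u - Lu = \varphi - \int\varphi\,d\mu_1$. Since $\mu^\theta$ is fixed by the
  dual operator of $J_\theta$ and $\log J_\theta = \log J_1 + \theta\xi + O(\theta^2)$, the derivative of
  $\int\varphi\,d\mu^\theta$ at 0 is $\int\xi u\,d\mu_1$ (\<open>linear_response\<close>). For the indicator of a
  cylinder of length $m$ this makes the score the conditional mean of
  $\sum_{k\ge 0}\xi\circ\sigma^k$ on the cylinder, which differs from the Birkhoff sum $S_m\xi$ by a
  bounded amount (\<open>cylinder_poisson_solution\<close>). Tangency makes the functions $\xi\circ\sigma^k$
  orthogonal, so $\int (S_m\xi)^2\,d\mu_1 = m\int\xi^2\,d\mu_1$.

  Two facts carry the rest. The operator of a Jacobian contracts a seminorm equivalent to
  a Hoelder seminorm in a single step (\<open>ruelle_contraction\<close>, a coupling argument); this gives existence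
  and uniqueness of Gibbs probabilities, the solutions of $u - Lu = \varphi - \int\varphi$ and the
  eigenfunction. And $h(\nu) \le -\int\log J\,d\nu$ for every invariant $\nu$ and every Jacobian $J$
  (\<open>ks_entropy_le\<close>), with equality only for the Gibbs probability of $J$: this is seen by varying
  $J$ in the inequality (\<open>entropy_eq_imp_ruelle_dual\<close>).
\<close>

section \<open>Cylinders and the topology of the shift space\<close>

definition cyl :: "'a list \<Rightarrow> 'a stream set" where
  "cyl w = {x. stake (length w) x = w}"

lemma cylinder_eq_cyl: "cylinder k x = cyl (stake k x)"
  by (simp add: cylinder_def cyl_def)

lemma stake_eq_mono: "stake n x = stake n y \<Longrightarrow> m \<le> n \<Longrightarrow> stake m x = stake m y"
  by (metis min.absorb1 take_stake)

lemma stake_eq_iff: "stake n x = stake n y \<longleftrightarrow> (\<forall>i<n. x !! i = y !! i)"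
  by (auto simp: list_eq_iff_nth_eq)

lemma dist_stream_le:
  assumes "stake n x = stake n (y :: 'a stream)" shows "dist x y \<le> (1/2) ^ Suc n"
proof (cases "x = y")
  case False
  then have "x !! (LEAST j. x !! j \<noteq> y !! j) \<noteq> y !! (LEAST j. x !! j \<noteq> y !! j)"
    using LeastI_ex[of "\<lambda>j. x !! j \<noteq> y !! j"] stream_neq_position by blast
  then have "n \<le> (LEAST j. x !! j \<noteq> y !! j)"
    using assms unfolding stake_eq_iff by (meson not_le)
  then show ?thesis using False by (auto simp: dist_stream_def intro!: power_decreasing)
qed auto

lemma dist_stream_eq:
  assumes "x \<noteq> (y :: 'a stream)"
  obtains n where "dist x y = (1/2) ^ Suc n" "stake n x = stake n y"
proof
  show "dist x y = (1/2) ^ Suc (LEAST j. x !! j \<noteq> y !! j)" using assms by (simp add: dist_stream_def)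
  show "stake (LEAST j. x !! j \<noteq> y !! j) x = stake (LEAST j. x !! j \<noteq> y !! j) y"
    unfolding stake_eq_iff using not_less_Least by blast
qed

lemma stake_eq_if_dist_less:
  assumes "dist x y < (1/2) ^ n" shows "stake n x = stake n (y :: 'a stream)"
proof (cases "x = y")
  case False
  then obtain m where m: "dist x y = (1/2) ^ Suc m" "stake m x = stake m y" by (rule dist_stream_eq)
  then have "(1/2::real) ^ Suc m < (1/2) ^ n" using assms by simp
  then have "n \<le> m" by (metis less_Suc_eq_le power_strict_decreasing_iff half_gt_zero_iff zero_less_one
        field_sum_of_halves less_add_same_cancel1)
  then show ?thesis using m stake_eq_mono by blast
qed simp

lemma open_stream_iff_cyl:
  "open (U :: 'a stream set) \<longleftrightarrow> (\<forall>x\<in>U. \<exists>n. cyl (stake n x) \<subseteq> U)"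
proof
  assume U: "open U"
  show "\<forall>x\<in>U. \<exists>n. cyl (stake n x) \<subseteq> U"
  proof
    fix x assume "x \<in> U"
    then obtain e where e: "0 < e" "\<And>y. dist y x < e \<Longrightarrow> y \<in> U"
      using U unfolding open_dist by blast
    obtain n where n: "(1/2::real) ^ n < e" using real_arch_pow_inv[OF e(1), of "1/2"] by auto
    have "cyl (stake n x) \<subseteq> U"
    proof
      fix y assume "y \<in> cyl (stake n x)"
      then have "dist y x \<le> (1/2) ^ Suc n" by (intro dist_stream_le) (simp add: cyl_def)
      also have "\<dots> \<le> (1/2) ^ n" by (intro power_decreasing) auto
      finally show "y \<in> U" using n by (intro e(2)) linarith
    qed
    then show "\<exists>n. cyl (stake n x) \<subseteq> U" ..
  qed
next
  assume U: "\<forall>x\<in>U. \<exists>n. cyl (stake n x) \<subseteq> U"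
  show "open U" unfolding open_dist
  proof
    fix x assume "x \<in> U"
    then obtain n where "cyl (stake n x) \<subseteq> U" using U by blast
    then have "\<forall>y. dist y x < (1/2) ^ n \<longrightarrow> y \<in> U"
      using stake_eq_if_dist_less by (fastforce simp: cyl_def)
    then show "\<exists>e>0. \<forall>y. dist y x < e \<longrightarrow> y \<in> U" by (intro exI[of _ "(1/2)^n"]) auto
  qed
qed

lemma open_cyl: "open (cyl w)"
  unfolding open_stream_iff_cyl by (auto simp: cyl_def intro!: exI[of _ "length w"])

lemma cyl_Nil [simp]: "cyl [] = UNIV"
  by (simp add: cyl_def)

lemma finite_words: "finite {w :: 'a::finite list. length w = n}"
  using finite_lists_length_eq[of "UNIV :: 'a set" n] by simp

text \<open>
  Koenig's lemma: a property of words that can always be continued by one letter holds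
  along some infinite path.
\<close>

lemma stream_infinite_path:
  assumes "Q []" and step: "\<And>w. Q w \<Longrightarrow> \<exists>a. Q (w @ [a])"
  shows "\<exists>z :: 'a stream. \<forall>n. Q (stake n z)"
proof -
  obtain ext where ext: "\<And>w. Q w \<Longrightarrow> Q (w @ [ext w])" using step by metis
  define f where "f n = ((\<lambda>w. w @ [ext w]) ^^ n) []" for n
  have fS: "f (Suc n) = f n @ [ext (f n)]" for n by (simp add: f_def)
  have Q: "Q (f n)" for n by (induction n) (auto simp: fS ext assms(1) f_def[of 0])
  define z where "z = smap (\<lambda>n. ext (f n)) nats"
  have "stake n z = f n" for n
  proof (induction n)
    case 0 show ?case by (simp add: f_def)
  next
    case (Suc n) then show ?case unfolding fS stake_Suc by (simp add: z_def)
  qed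
  then show ?thesis using Q by metis
qed

text \<open>
  If an open cover had no finite subcover, the cylinders without a finite subcover would contain
  arbitrarily small neighbourhoods of some point, contradicting that one member of the cover
  contains that point.
\<close>

lemma compact_UNIV_stream: "compact (UNIV :: 'a::finite stream set)"
proof (rule Topological_Spaces.compactI)
  fix C :: "'a stream set set" assume C: "\<forall>t\<in>C. open t" "UNIV \<subseteq> \<Union>C"
  let ?Q = "\<lambda>w. \<not> (\<exists>C'\<subseteq>C. finite C' \<and> cyl w \<subseteq> \<Union>C')"
  show "\<exists>C'\<subseteq>C. finite C' \<and> UNIV \<subseteq> \<Union>C'"
  proof (rule ccontr)
    assume "\<not> ?thesis"
    then have "?Q []" by simp
    moreover have "\<exists>a. ?Q (w @ [a])" if "?Q w" for w
    proof (rule ccontr)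
      assume "\<nexists>a. ?Q (w @ [a])"
      then obtain D where D: "\<And>a. D a \<subseteq> C \<and> finite (D a) \<and> cyl (w @ [a]) \<subseteq> \<Union>(D a)" by metis
      have "cyl w \<subseteq> \<Union>(\<Union>a. D a)"
      proof
        fix x assume "x \<in> cyl w"
        then have w: "stake (length w) x = w" by (simp only: cyl_def mem_Collect_eq)
        have "stake (Suc (length w)) x = w @ [x !! length w]"
          unfolding stake_Suc by (simp only: w)
        then have "x \<in> cyl (w @ [x !! length w])"
          by (simp only: cyl_def mem_Collect_eq length_append_singleton)
        moreover have "cyl (w @ [x !! length w]) \<subseteq> \<Union>(D (x !! length w))" using D by simp
        ultimately have "x \<in> \<Union>(D (x !! length w))" by (rule rev_subsetD)
        then show "x \<in> \<Union>(\<Union>a. D a)" by auto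
      qed
      moreover have "(\<Union>a. D a) \<subseteq> C" "finite (\<Union>a. D a)" using D by auto
      ultimately show False using that by blast
    qed
    ultimately obtain z where z: "\<And>n. ?Q (stake n z)"
      using stream_infinite_path[of ?Q] by blast
    obtain U where U: "U \<in> C" "z \<in> U" using C(2) by blast
    then obtain n where "cyl (stake n z) \<subseteq> U" using C(1) open_stream_iff_cyl by metis
    then have "\<exists>C'\<subseteq>C. finite C' \<and> cyl (stake n z) \<subseteq> \<Union>C'"
      using U(1) by (intro exI[of _ "{U}"]) auto
    then show False using z by blast
  qed
qed

lemma continuous_bounded_stream:
  fixes f :: "'a::finite stream \<Rightarrow> real"
  assumes "continuous_on UNIV f" obtains B where "0 < B" "\<And>x. \<bar>f x\<bar> \<le> B"
proof -
  have "compact (f ` UNIV)" using assms compact_UNIV_stream by (rule compact_continuous_image)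
  then have "bounded (range f)" by (rule compact_imp_bounded)
  then show ?thesis using that unfolding bounded_pos by auto
qed

lemma continuous_on_stream_iff:
  fixes f :: "'a stream \<Rightarrow> real"
  shows "continuous_on UNIV f \<longleftrightarrow> (\<forall>x. \<forall>e>0. \<exists>n. \<forall>y. stake n y = stake n x \<longrightarrow> \<bar>f y - f x\<bar> < e)"
proof
  assume f: "continuous_on UNIV f"
  show "\<forall>x. \<forall>e>0. \<exists>n. \<forall>y. stake n y = stake n x \<longrightarrow> \<bar>f y - f x\<bar> < e"
  proof (intro allI impI)
    fix x and e :: real assume "e > 0"
    have "open (f -` ball (f x) e)" using f open_vimage by blast
    moreover have "x \<in> f -` ball (f x) e" using \<open>e > 0\<close> by simp
    ultimately obtain n where "cyl (stake n x) \<subseteq> f -` ball (f x) e"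
      unfolding open_stream_iff_cyl by blast
    then show "\<exists>n. \<forall>y. stake n y = stake n x \<longrightarrow> \<bar>f y - f x\<bar> < e"
      by (intro exI[of _ n]) (auto simp: cyl_def subset_iff dist_real_def abs_minus_commute)
  qed
next
  assume f: "\<forall>x. \<forall>e>0. \<exists>n. \<forall>y. stake n y = stake n x \<longrightarrow> \<bar>f y - f x\<bar> < e"
  show "continuous_on UNIV f" unfolding continuous_on_iff
  proof (intro ballI allI impI)
    fix x and e :: real assume "e > 0"
    then obtain n where n: "\<forall>y. stake n y = stake n x \<longrightarrow> \<bar>f y - f x\<bar> < e" using f by blast
    show "\<exists>d>0. \<forall>x'\<in>UNIV. dist x' x < d \<longrightarrow> dist (f x') (f x) < e"
      using n stake_eq_if_dist_less by (intro exI[of _ "(1/2)^n"]) (fastforce simp: dist_real_def)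
  qed
qed

lemma continuous_on_stl [continuous_intros]:
  "continuous_on UNIV f \<Longrightarrow> continuous_on UNIV (\<lambda>x :: 'a stream. f (stl x) :: real)"
  unfolding continuous_on_stream_iff
proof (intro allI impI)
  fix x :: "'a stream" and e :: real 
  assume f: "\<forall>x. \<forall>e>0. \<exists>n. \<forall>y. stake n y = stake n x \<longrightarrow> \<bar>f y - f x\<bar> < e" and "e > 0"
  then obtain n where n: "\<And>y. stake n y = stake n (stl x) \<Longrightarrow> \<bar>f y - f (stl x)\<bar> < e" by blast
  show "\<exists>n. \<forall>y. stake n y = stake n x \<longrightarrow> \<bar>f (stl y) - f (stl x)\<bar> < e"
    by (intro exI[of _ "Suc n"] allI impI n) simp
qed

lemma continuous_on_SCons [continuous_intros]:
  assumes "continuous_on UNIV f"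
  shows "continuous_on UNIV (\<lambda>x :: 'a stream. f (a ## x) :: real)"
  unfolding continuous_on_stream_iff
proof (intro allI impI)
  fix x and e :: real assume "e > 0"
  then obtain n where n: "\<And>y. stake n y = stake n (a ## x) \<Longrightarrow> \<bar>f y - f (a ## x)\<bar> < e"
    using assms unfolding continuous_on_stream_iff by blast
  have "\<bar>f (a ## y) - f (a ## x)\<bar> < e" if "stake n y = stake n x" for y
    using that by (intro n stake_eq_mono[of "Suc n" _ _ n]) auto
  then show "\<exists>n. \<forall>y. stake n y = stake n x \<longrightarrow> \<bar>f (a ## y) - f (a ## x)\<bar> < e" by blast
qed

lemma sets_borel_stream: "sets (borel :: 'a::finite stream measure) = sigma_sets UNIV (range cyl)"
proof -
  have "sigma_sets UNIV (Collect open) = sigma_sets UNIV (range (cyl :: 'a list \<Rightarrow> _))"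
  proof (rule sigma_sets_eqI)
    fix U :: "'a stream set" assume "U \<in> Collect open"
    then have "U = (\<Union>w \<in> {w. cyl w \<subseteq> U}. cyl w)"
      unfolding mem_Collect_eq open_stream_iff_cyl by (fastforce simp: cyl_def)
    also have "\<dots> \<in> sigma_sets UNIV (range cyl)"
      by (rule sigma_sets_UNION) (auto intro: countable_subset[OF _ countableI_type])
    finally show "U \<in> sigma_sets UNIV (range cyl)" .
  qed (auto intro: open_cyl)
  then show ?thesis by (simp add: borel_def)
qed

lemma Int_stable_cyl: "Int_stable (insert {} (range (cyl :: 'a list \<Rightarrow> _)))"
proof -
  have "cyl v \<inter> cyl w \<in> insert {} (range cyl)" if "length v \<le> length w" for v w :: "'a list"
  proof (cases "take (length v) w = v")
    case True
    then have "cyl v \<inter> cyl w = cyl w"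
      using that by (auto simp: cyl_def) (metis min.absorb1 take_stake)
    then show ?thesis by blast
  next
    case False
    then have "cyl v \<inter> cyl w = {}"
      using that by (auto simp: cyl_def) (metis min.absorb1 take_stake)
    then show ?thesis by blast
  qed
  then show ?thesis unfolding Int_stable_def
    by (metis (no_types, lifting) Int_commute Int_empty_left Int_empty_right insert_iff linear rangeE)
qed

lemma cyl_sets [measurable, simp]: "cyl w \<in> sets borel"
  by (simp add: open_cyl)

lemma measure_eq_if_cyl_eq:
  fixes \<mu> \<nu> :: "'a::finite stream measure"
  assumes "finite_measure \<mu>" "finite_measure \<nu>" "sets \<mu> = sets borel" "sets \<nu> = sets borel"
    and eq: "\<And>w. measure \<mu> (cyl w) = measure \<nu> (cyl w)"
  shows "\<mu> = \<nu>"
proof -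
  interpret \<mu>: finite_measure \<mu> by fact
  interpret \<nu>: finite_measure \<nu> by fact
  have sg: "sigma_sets UNIV (range cyl) = sigma_sets UNIV (insert {} (range (cyl :: 'a list \<Rightarrow> _)))"
    by (rule sigma_sets_eqI) (auto intro: sigma_sets.Empty)
  show ?thesis
  proof (rule measure_eqI_generator_eq[OF Int_stable_cyl, where \<Omega> = UNIV and A = "\<lambda>_. UNIV"])
    show "sets \<mu> = sigma_sets UNIV (insert {} (range cyl))"
      "sets \<nu> = sigma_sets UNIV (insert {} (range cyl))"
      using assms sg sets_borel_stream by auto
    show "range (\<lambda>_. UNIV) \<subseteq> insert {} (range (cyl :: 'a list \<Rightarrow> _))"
      using cyl_Nil by blast
  qed (auto simp: \<mu>.emeasure_eq_measure \<nu>.emeasure_eq_measure eq)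
qed

lemma measurable_stl [measurable]: "stl \<in> borel_measurable (borel :: 'a::finite stream measure)"
proof (rule borel_measurableI)
  fix U :: "'a stream set" assume U: "open U"
  have "open (stl -` U)" unfolding open_stream_iff_cyl
  proof
    fix x :: "'a stream" assume "x \<in> stl -` U"
    then have "stl x \<in> U" by simp
    then obtain n where n: "cyl (stake n (stl x)) \<subseteq> U" using U unfolding open_stream_iff_cyl by blast
    have "cyl (stake (Suc n) x) \<subseteq> stl -` U"
      using n by (auto simp: cyl_def subset_iff)
    then show "\<exists>n. cyl (stake n x) \<subseteq> stl -` U" ..
  qed
  then show "stl -` U \<inter> space borel \<in> sets borel" by simp
qed

section \<open>Modulus of variation\<close>

text \<open>
  The $n$-th variation of \<open>f\<close>, its oscillation over cylinders of length $n$, is at most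
  \<open>M * w n\<close>. Hoelder continuity is the case of a geometric \<open>w\<close>; the contraction
  argument needs another sequence, of the same order.
\<close>

definition var_bound :: "(nat \<Rightarrow> real) \<Rightarrow> real \<Rightarrow> ('a stream \<Rightarrow> real) \<Rightarrow> bool" where
  "var_bound w M f \<longleftrightarrow> (\<forall>n x y. stake n x = stake n y \<longrightarrow> \<bar>f x - f y\<bar> \<le> M * w n)"

lemma var_boundD: "var_bound w M f \<Longrightarrow> stake n x = stake n y \<Longrightarrow> \<bar>f x - f y\<bar> \<le> M * w n"
  by (auto simp: var_bound_def)

lemma var_boundI: "(\<And>n x y. stake n x = stake n y \<Longrightarrow> \<bar>f x - f y\<bar> \<le> M * w n) \<Longrightarrow> var_bound w M f"
  by (auto simp: var_bound_def)

lemma var_bound_mono: 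
  assumes "var_bound w M f" "\<And>n. M * w n \<le> M' * w' n" shows "var_bound w' M' f"
  using assms by (meson order_trans var_bound_def)

lemma var_bound_const [simp]: "0 \<le> M \<Longrightarrow> (\<And>n. 0 \<le> w n) \<Longrightarrow> var_bound w M (\<lambda>_. c)"
  by (auto simp: var_bound_def)

lemma var_bound_add: 
  assumes "var_bound w M f" "var_bound w K g" shows "var_bound w (M + K) (\<lambda>x. f x + g x)"
proof (rule var_boundI)
  fix n and x y :: "'a stream" assume "stake n x = stake n y"
  note * = var_boundD[OF assms(1) this] var_boundD[OF assms(2) this]
  show "\<bar>f x + g x - (f y + g y)\<bar> \<le> (M + K) * w n" using * by (simp add: distrib_right)
qed

lemma var_bound_cmult: 
  assumes "var_bound w M f" shows "var_bound w (\<bar>c\<bar> * M) (\<lambda>x. c * f x)"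
proof (rule var_boundI)
  fix n and x y :: "'a stream" assume "stake n x = stake n y"
  note * = var_boundD[OF assms(1) this]
  have "\<bar>c * f x - c * f y\<bar> = \<bar>c\<bar> * \<bar>f x - f y\<bar>" by (simp flip: abs_mult right_diff_distrib)
  then show "\<bar>c * f x - c * f y\<bar> \<le> \<bar>c\<bar> * M * w n" using * by (simp add: mult_left_mono mult.assoc)
qed

lemma var_bound_diff: 
  assumes "var_bound w M f" "var_bound w K g" shows "var_bound w (M + K) (\<lambda>x. f x - g x)"
  using var_bound_add[OF assms(1) var_bound_cmult[OF assms(2), of "-1"]] by simp

lemma var_bound_mult: 
  assumes "var_bound w M f" "var_bound w K g" "\<And>x. \<bar>f x\<bar> \<le> A" "\<And>x. \<bar>g x\<bar> \<le> B"
  shows "var_bound w (M * B + A * K) (\<lambda>x. f x * g x)"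
proof (rule var_boundI)
  fix n and x y :: "'a stream" assume s: "stake n x = stake n y"
  note * = var_boundD[OF assms(1) s] var_boundD[OF assms(2) s]
  have "\<bar>f x * g x - f y * g y\<bar> = \<bar>(f x - f y) * g x + f y * (g x - g y)\<bar>" by (simp add: algebra_simps)
  also have "\<dots> \<le> \<bar>f x - f y\<bar> * \<bar>g x\<bar> + \<bar>f y\<bar> * \<bar>g x - g y\<bar>"
    by (metis abs_triangle_ineq abs_mult)
  also have "\<dots> \<le> (M * w n) * B + A * (K * w n)"
    using * assms(3)[of y] assms(4)[of x] abs_ge_zero order_trans by (intro add_mono mult_mono) (auto intro: order_trans)
  finally show "\<bar>f x * g x - f y * g y\<bar> \<le> (M * B + A * K) * w n" by (simp add: algebra_simps)
qed

lemma var_bound_comp: 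
  assumes "var_bound w M f" "\<And>x y. \<bar>F (f x) - F (f y)\<bar> \<le> K * \<bar>f x - f y\<bar>" "0 \<le> K"
  shows "var_bound w (K * M) (\<lambda>x. F (f x))"
proof (rule var_boundI)
  fix n and x y :: "'a stream" assume s: "stake n x = stake n y"
  show "\<bar>F (f x) - F (f y)\<bar> \<le> K * M * w n"
    using order_trans[OF assms(2) mult_left_mono[OF var_boundD[OF assms(1) s] assms(3)]]
    by (simp add: mult.assoc)
qed

lemma var_bound_osc: "var_bound w M f \<Longrightarrow> \<bar>f x - f y\<bar> \<le> M * w 0"
  by (rule var_boundD[of w M f 0]) auto

lemma var_bound_continuous: 
  fixes f :: "'a stream \<Rightarrow> real"
  assumes "var_bound w M f" "w \<longlonglongrightarrow> 0" shows "continuous_on UNIV f"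
  unfolding continuous_on_stream_iff
proof (intro allI impI)
  fix x and e :: real assume "e > 0"
  have "(\<lambda>n. M * w n) \<longlonglongrightarrow> 0" using tendsto_mult_right_zero[OF assms(2)] by simp
  then have "\<forall>\<^sub>F n in sequentially. M * w n < e" using \<open>e > 0\<close> by (rule order_tendstoD)
  then obtain n where "M * w n < e" by (auto simp: eventually_sequentially)
  then show "\<exists>n. \<forall>y. stake n y = stake n x \<longrightarrow> \<bar>f y - f x\<bar> < e"
    using var_boundD[OF assms(1)] by (intro exI[of _ n]) fastforce
qed

lemma holder_imp_var_bound:
  assumes "holder f"
  obtains M \<rho> where "0 < \<rho>" "\<rho> < 1" "0 < M" "var_bound (\<lambda>n. \<rho> ^ n) M f"
proof -
  from assms obtain C \<alpha> where C: "0 < \<alpha>" "\<alpha> \<le> 1" "\<And>x y. \<bar>f x - f y\<bar> \<le> C * dist x y powr \<alpha>"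
    unfolding holder_def by blast
  define \<rho> where "\<rho> = (1/2::real) powr \<alpha>"
  have \<rho>: "0 < \<rho>" "\<rho> < 1" using C powr_less_mono'[of "1/2::real" 0 \<alpha>] by (auto simp: \<rho>_def)
  have "var_bound (\<lambda>n. \<rho> ^ n) (\<bar>C\<bar> + 1) f"
  proof (rule var_boundI)
    fix n and x y :: "'a stream" assume s: "stake n x = stake n y"
    have "(1/2::real) ^ Suc n \<le> (1/2) ^ n" by (rule power_decreasing) simp_all
    then have "dist x y \<le> (1/2) ^ n" using dist_stream_le[OF s] by (rule order_trans[rotated])
    then have "dist x y powr \<alpha> \<le> ((1/2) ^ n) powr \<alpha>"
      using C(1) by (intro powr_mono2) simp_all
    also have "\<dots> = \<rho> ^ n" by (simp add: \<rho>_def powr_powr mult.commute flip: powr_realpow)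
    finally have d: "dist x y powr \<alpha> \<le> \<rho> ^ n" .
    have "\<bar>f x - f y\<bar> \<le> (\<bar>C\<bar> + 1) * dist x y powr \<alpha>"
      by (rule order_trans[OF C(3)]) (intro mult_right_mono, auto)
    also have "\<dots> \<le> (\<bar>C\<bar> + 1) * \<rho> ^ n" using d by (intro mult_left_mono) auto
    finally show "\<bar>f x - f y\<bar> \<le> (\<bar>C\<bar> + 1) * \<rho> ^ n" .
  qed
  then show thesis using that \<rho> by (metis abs_ge_zero add_nonneg_pos zero_less_one)
qed

text \<open>
  The exponent is the $\alpha$ with $2^{-\alpha} = \rho$, capped at 1.
\<close>

lemma var_bound_imp_holder:
  assumes "0 < \<rho>" "\<rho> < 1" "var_bound (\<lambda>n. \<rho> ^ n) M f"
  shows "holder f"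
proof -
  define \<alpha> where "\<alpha> = min 1 (log (1/2) \<rho>)"
  have \<alpha>: "0 < \<alpha>" "\<alpha> \<le> 1" using assms by (auto simp: \<alpha>_def log_def field_simps)
  have "(1/2::real) powr log (1/2) \<rho> \<le> (1/2) powr \<alpha>" by (intro powr_mono') (auto simp: \<alpha>_def)
  then have \<rho>: "\<rho> \<le> (1/2) powr \<alpha>" using assms by simp
  have "\<bar>f x - f y\<bar> \<le> (\<bar>M\<bar> / \<rho>) * dist x y powr \<alpha>" for x y
  proof (cases "x = y")
    case False
    then obtain n where n: "dist x y = (1/2) ^ Suc n" "stake n x = stake n y" by (rule dist_stream_eq)
    have "\<bar>f x - f y\<bar> \<le> M * \<rho> ^ n" using n assms(3) by (intro var_boundD)
    also have "\<dots> \<le> (\<bar>M\<bar> / \<rho>) * \<rho> ^ Suc n" using assms by (auto intro!: mult_right_mono)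
    also have "\<dots> \<le> (\<bar>M\<bar> / \<rho>) * ((1/2) powr \<alpha>) ^ Suc n"
      using \<rho> assms by (intro mult_left_mono power_mono) auto
    also have "((1/2) powr \<alpha>) ^ Suc n = dist x y powr \<alpha>"
    proof -
      have "((1/2::real) powr \<alpha>) ^ Suc n = (1/2) powr (\<alpha> * real (Suc n))"
        unfolding powr_powr[symmetric] by (rule powr_realpow[symmetric]) simp
      moreover have "((1/2::real) ^ Suc n) powr \<alpha> = (1/2) powr (real (Suc n) * \<alpha>)"
        unfolding powr_powr[symmetric] by (rule arg_cong[where f = "\<lambda>t. t powr \<alpha>"], rule powr_realpow[symmetric]) simp
      ultimately show ?thesis unfolding n by (simp only: mult.commute)
    qed
    finally show ?thesis .
  qed simp
  then show ?thesis unfolding holder_def using \<alpha> by blast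
qed

lemma holder_common_rate:
  assumes "holder f" "holder g"
  obtains M K \<rho> where "0 < \<rho>" "\<rho> < 1" "0 < M" "0 < K"
    "var_bound (\<lambda>n. \<rho> ^ n) M f" "var_bound (\<lambda>n. \<rho> ^ n) K g"
proof -
  obtain M \<rho>1 where M: "0 < \<rho>1" "\<rho>1 < 1" "0 < M" "var_bound (\<lambda>n. \<rho>1 ^ n) M f"
    using assms holder_imp_var_bound by blast
  obtain K \<rho>2 where K: "0 < \<rho>2" "\<rho>2 < 1" "0 < K" "var_bound (\<lambda>n. \<rho>2 ^ n) K g"
    using assms holder_imp_var_bound by blast
  have "var_bound (\<lambda>n. (max \<rho>1 \<rho>2) ^ n) M f" "var_bound (\<lambda>n. (max \<rho>1 \<rho>2) ^ n) K g"
    using M K by (auto intro!: var_bound_mono[OF M(4)] var_bound_mono[OF K(4)] power_mono)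
  then show thesis using that[of "max \<rho>1 \<rho>2" M K] M K by auto
qed

lemma holder_continuous:
  fixes f :: "'a stream \<Rightarrow> real" assumes "holder f" shows "continuous_on UNIV f"
proof -
  obtain M \<rho> where "0 < \<rho>" "\<rho> < 1" "0 < M" "var_bound (\<lambda>n. \<rho> ^ n) M f"
    using assms holder_imp_var_bound by blast
  then show ?thesis by (auto intro!: var_bound_continuous LIMSEQ_power_zero)
qed

section \<open>The Ruelle operator of a normalised potential\<close>

lemma sum_words_Suc:
  "(\<Sum>v | length v = Suc n. g v) = (\<Sum>v | length v = n. \<Sum>a\<in>UNIV. g (a # v :: 'a::finite list) :: real)"
proof -
  have eq: "{v :: 'a list. length v = Suc n} = (\<lambda>(v, a). a # v) ` ({v. length v = n} \<times> UNIV)"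
    by (auto simp: length_Suc_conv image_iff)
  show ?thesis unfolding eq
    by (subst sum.reindex) (auto simp: inj_on_def sum.cartesian_product split_def)
qed

text \<open>
  The weight of the word \<open>v\<close> in front of \<open>y\<close>: the kernel of the iterated Ruelle operator.
\<close>

primrec jac_prod :: "('a stream \<Rightarrow> real) \<Rightarrow> 'a list \<Rightarrow> 'a stream \<Rightarrow> real" where
  "jac_prod J [] y = 1"
| "jac_prod J (a # v) y = J (a ## (v @- y)) * jac_prod J v y"

lemma ruelle_funpow:
  "(ruelle J ^^ n) \<phi> y = (\<Sum>v | length v = n. jac_prod J v y * \<phi> (v @- y))"
proof (induction n arbitrary: \<phi>)
  case 0
  have "{v :: 'a list. length v = 0} = {[]}" by auto
  then show ?case by simp
next
  case (Suc n)
  have "(ruelle J ^^ Suc n) \<phi> y = (ruelle J ^^ n) (ruelle J \<phi>) y"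
    by (simp only: funpow_Suc_right comp_def)
  also have "\<dots> = (\<Sum>v | length v = n. jac_prod J v y * ruelle J \<phi> (v @- y))" by (rule Suc.IH)
  also have "\<dots> = (\<Sum>v | length v = Suc n. jac_prod J v y * \<phi> (v @- y))"
    unfolding sum_words_Suc ruelle_def by (simp add: sum_distrib_left mult_ac)
  finally show ?case .
qed

lemma ruelle_add: "ruelle J (\<lambda>x. f x + g x) = (\<lambda>x. ruelle J f x + ruelle J g x)"
  by (rule ext) (simp add: ruelle_def sum.distrib distrib_left)

lemma ruelle_diff: "ruelle J (\<lambda>x. f x - g x) = (\<lambda>x. ruelle J f x - ruelle J g x)"
  by (rule ext) (simp add: ruelle_def sum_subtractf right_diff_distrib)

lemma ruelle_cmult: "ruelle J (\<lambda>x. c * f x) = (\<lambda>x. c * ruelle J f x)"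
  by (rule ext) (simp add: ruelle_def sum_distrib_left mult_ac)

lemma ruelle_mult_stl: "ruelle J (\<lambda>x. f (stl x) * g x) = (\<lambda>x. f x * ruelle J g x)"
  by (rule ext) (simp add: ruelle_def sum_distrib_left mult_ac)

text \<open>
  The Ruelle operator is a left inverse of composition with the shift, and a module homomorphism over it.
\<close>

lemma ruelle_pow_mult_sdrop:
  "(ruelle J ^^ n) (\<lambda>x. f (sdrop n x) * g x) = (\<lambda>x. f x * (ruelle J ^^ n) g x)"
proof (induction n arbitrary: f)
  case (Suc n)
  have "(ruelle J ^^ Suc n) (\<lambda>x. f (sdrop (Suc n) x) * g x) = ruelle J ((ruelle J ^^ n) (\<lambda>x. f (stl (sdrop n x)) * g x))"
    by simp
  also have "\<dots> = ruelle J (\<lambda>x. f (stl x) * (ruelle J ^^ n) g x)"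
    by (simp only: Suc.IH[of "\<lambda>z. f (stl z)"])
  also have "\<dots> = (\<lambda>x. f x * (ruelle J ^^ Suc n) g x)" by (simp add: ruelle_mult_stl)
  finally show ?case .
qed simp

lemma continuous_on_ruelle:
  assumes "continuous_on UNIV J" "continuous_on UNIV \<phi>"
  shows "continuous_on UNIV (ruelle J \<phi>)"
  unfolding ruelle_def by (intro continuous_intros assms)

locale borel_prob = prob_space \<mu> for \<mu> :: "'a::finite stream measure" +
  assumes sets_eq [measurable_cong, simp]: "sets \<mu> = sets borel"
begin

lemma space_eq [simp]: "space \<mu> = UNIV"
  using sets_eq_imp_space_eq[OF sets_eq] by simp

lemma prob_UNIV [simp]: "prob UNIV = 1"
  using prob_space by simp

lemma integrable_continuous:
  fixes f :: "'a stream \<Rightarrow> real" assumes "continuous_on UNIV f" shows "integrable \<mu> f"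
proof -
  obtain B where "0 < B" and B: "\<And>x. \<bar>f x\<bar> \<le> B" using continuous_bounded_stream[OF assms] by blast
  have "f \<in> borel_measurable \<mu>"
    using borel_measurable_continuous_onI[OF assms] by (simp add: measurable_def)
  then show ?thesis using B by (intro integrable_const_bound[of _ B]) auto
qed

lemma integral_bound:
  fixes f :: "'a stream \<Rightarrow> real" 
  assumes "continuous_on UNIV f" "\<And>x. \<bar>f x\<bar> \<le> e" shows "\<bar>\<integral>x. f x \<partial>\<mu>\<bar> \<le> e"
proof -
  have "(\<integral>x. f x \<partial>\<mu>) \<le> (\<integral>x. e \<partial>\<mu>)" "(\<integral>x. - e \<partial>\<mu>) \<le> (\<integral>x. f x \<partial>\<mu>)"
    using assms(2) by (intro integral_mono integrable_continuous assms; force simp: abs_le_iff minus_le_iff)+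
  then show ?thesis by (simp add: abs_le_iff)
qed

lemma integral_close:
  fixes f :: "'a stream \<Rightarrow> real" 
  assumes "continuous_on UNIV f" "continuous_on UNIV g" "\<And>x. \<bar>f x - g x\<bar> \<le> e"
  shows "\<bar>(\<integral>x. f x \<partial>\<mu>) - (\<integral>x. g x \<partial>\<mu>)\<bar> \<le> e"
  using integral_bound[of "\<lambda>x. f x - g x" e] assms
  by (simp add: integrable_continuous continuous_on_diff)

end

text \<open>
  Concavity of $1 - e^{-s}$, which vanishes at 0.
\<close>

lemma exp_minus_concave:
  assumes "0 \<le> t" "t \<le> (1::real)" shows "t * (1 - exp (- s)) \<le> 1 - exp (- (t * s))"
proof -
  have "exp ((1 - t) *\<^sub>R 0 + t *\<^sub>R (- s)) \<le> (1 - t) * exp 0 + t * exp (- s)"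
    by (rule convex_onD[OF exp_convex]) (use assms in auto)
  then show ?thesis by (simp add: algebra_simps)
qed

lemma exp_diff_le: "exp s - exp t \<le> exp s * (s - t :: real)"
proof -
  have "exp s * (1 + (t - s)) \<le> exp s * exp (t - s)" by (intro mult_left_mono exp_ge_add_one_self) simp
  also have "\<dots> = exp t" by (simp flip: exp_add)
  finally show ?thesis by (simp add: algebra_simps)
qed

lemma ln_lipschitz:
  assumes "0 < c" "c \<le> a" "c \<le> (b :: real)" shows "\<bar>ln a - ln b\<bar> \<le> 1 / c * \<bar>a - b\<bar>"
proof -
  have *: "ln s - ln t \<le> 1 / c * \<bar>s - t\<bar>" if "c \<le> s" "c \<le> t" for s t
  proof -
    have "ln s - ln t = ln (s / t)" using that assms(1) by (simp add: ln_div)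
    also have "\<dots> \<le> s / t - 1" using that assms(1) by (intro ln_le_minus_one) auto
    also have "\<dots> = (s - t) / t" using that assms(1) by (simp add: field_simps)
    also have "\<dots> \<le> \<bar>s - t\<bar> / c" using that assms(1) by (intro frac_le) auto
    finally show ?thesis by simp
  qed
  show ?thesis using *[OF assms(2,3)] *[OF assms(3,2)] by (simp add: abs_le_iff abs_minus_commute)
qed

text \<open>
  Regularity is imposed on \<open>ln J\<close>, since it is ratios of weights that have to be compared. The
  rate \<open>\<rho>\<close> and the constant \<open>C\<close> are parameters because the seminorm below depends on them.
\<close>

locale log_holder_jacobian =
  fixes J :: "'a::finite stream \<Rightarrow> real" and C \<rho> :: real
  assumes J_pos: "\<And>x. 0 < J x" and J_sum: "\<And>x. (\<Sum>a\<in>UNIV. J (a ## x)) = 1"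
    and rho_pos: "0 < \<rho>" and rho_less: "\<rho> < 1" and C_pos: "0 < C"
    and ln_J: "var_bound (\<lambda>n. \<rho> ^ n) C (\<lambda>x. ln (J x))"
begin

text \<open>
  Two random backward orbits that append the same letter as often as possible agree, from
  agreement \<open>n\<close> on, in each further step with probability at least
  $\prod_{j\ge n} e^{-C\rho^j} = e^{-Q\rho^n}$. So \<open>w n\<close> bounds the probability that they ever
  separate, and the seminorm with weights \<open>w\<close> is the Lipschitz seminorm of the ultrametric in which
  points that agree in exactly \<open>n\<close> letters have distance \<open>w n\<close>.
\<close>

definition Q :: real where "Q = C / (1 - \<rho>)"

definition w :: "nat \<Rightarrow> real" where "w n = 1 - exp (- (Q * \<rho> ^ n))"

definition r :: real where "r = 1 - (1 - \<rho>) * exp (- (Q))"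

lemma Q_pos: "0 < Q" using C_pos rho_less by (simp add: Q_def)

lemma Q_C: "(1 - \<rho>) * Q = C" using rho_less by (simp add: Q_def)

lemma w_pos: "0 < w n" using Q_pos rho_pos by (simp add: w_def)

lemma w_less_1: "w n < 1" by (simp add: w_def)

lemma w_antimono: "m \<le> n \<Longrightarrow> w n \<le> w m"
  using Q_pos rho_pos rho_less by (auto simp: w_def intro!: mult_left_mono power_decreasing)

lemma w_le: "w n \<le> Q * \<rho> ^ n"
  using exp_ge_add_one_self[of "- (Q * \<rho> ^ n)"] by (simp add: w_def)

lemma w_ge: "w 0 * \<rho> ^ n \<le> w n"
  using exp_minus_concave[of "\<rho> ^ n" "Q"] rho_pos rho_less
  by (simp add: w_def power_le_one mult.commute)

lemma w_tendsto_0: "w \<longlonglongrightarrow> 0"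
proof (rule tendsto_sandwich[of "\<lambda>_. 0" _ _ "\<lambda>n. Q * \<rho> ^ n"])
  show "(\<lambda>n. Q * \<rho> ^ n) \<longlonglongrightarrow> 0"
    using rho_pos rho_less by (intro tendsto_mult_right_zero LIMSEQ_power_zero) auto
qed (auto intro!: always_eventually w_le less_imp_le[OF w_pos])

lemma r_pos: "0 < r" and r_less_1: "r < 1"
proof -
  have "exp (- (Q)) \<le> 1" using Q_pos by simp
  then have "(1 - \<rho>) * exp (- (Q)) \<le> (1 - \<rho>) * 1" using rho_less by (intro mult_left_mono) auto
  then show "0 < r" using rho_pos by (simp add: r_def)
  show "r < 1" using rho_less by (simp add: r_def)
qed

text \<open>
  One step of the coupling: the agreement grows by one with probability \<open>P\<close> and may drop to 0
  otherwise. The bound improves with \<open>P\<close>. For $P = e^{-C\rho^n}$ the sequence $1 - w$ is exactly multiplicative, and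
  \<open>w 0 < 1\<close> leaves the gain $(1-P)(1-w_0)$, which is at least $(1-\rho)(1-w_0)\,w_n$ by
  concavity.
\<close>

lemma w_coupling:
  assumes "exp (- (C * \<rho> ^ n)) \<le> P" "P \<le> 1"
  shows "P * w (Suc n) + (1 - P) * w 0 \<le> r * w n"
proof -
  define s where "s = Q * \<rho> ^ n"
  have s: "0 < s" using Q_pos rho_pos by (simp add: s_def)
  define p where "p = exp (- ((1 - \<rho>) * s))"
  have "(1 - \<rho>) * s = C * \<rho> ^ n" by (simp only: s_def mult.assoc[symmetric] Q_C)
  then have p: "p = exp (- (C * \<rho> ^ n))" by (simp only: p_def)
  have wn: "w n = 1 - exp (- s)" and wSn: "w (Suc n) = 1 - exp (- (\<rho> * s))"
    by (simp_all add: w_def s_def mult_ac)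
  have pe: "p * exp (- (\<rho> * s)) = exp (- s)" by (simp add: p_def algebra_simps flip: exp_add)
  have "P * w (Suc n) + (1 - P) * w 0 = w 0 - P * (w 0 - w (Suc n))" by (simp add: algebra_simps)
  also have "\<dots> \<le> w 0 - p * (w 0 - w (Suc n))"
    using assms p w_antimono[of 0 "Suc n"] by (intro diff_left_mono mult_right_mono) auto
  also have "\<dots> = w n - (1 - p) * (1 - w 0)"
    using pe by (simp add: wn wSn algebra_simps)
  also have "\<dots> \<le> w n - ((1 - \<rho>) * w n) * (1 - w 0)"
    using exp_minus_concave[of "1 - \<rho>" s] rho_pos rho_less w_less_1[of 0]
    by (intro diff_left_mono mult_right_mono) (auto simp: p_def wn)
  also have "\<dots> = r * w n" by (simp add: r_def w_def[of 0] algebra_simps)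
  finally show ?thesis .
qed

lemma ruelle_const [simp]: "ruelle J (\<lambda>_. c) = (\<lambda>_. c)"
  using J_sum by (auto simp: ruelle_def simp flip: sum_distrib_right)

lemma ruelle_mono:
  assumes "\<And>a. f (a ## x) \<le> g (a ## x)" shows "ruelle J f x \<le> ruelle J g x"
  unfolding ruelle_def using assms J_pos by (intro sum_mono mult_left_mono) (auto intro: less_imp_le)

lemma ruelle_close:
  assumes "\<And>x. \<bar>f x - c\<bar> \<le> B" shows "\<bar>ruelle J f x - c\<bar> \<le> B"
proof -
  have "f x \<le> c + B" "c - B \<le> f x" for x using assms[of x] by (auto simp: abs_le_iff)
  then show ?thesis
    using ruelle_mono[of f x "\<lambda>_. c + B"] ruelle_mono[of "\<lambda>_. c - B" x f] by (simp add: abs_le_iff)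
qed

lemma ruelle_bound: "(\<And>x. \<bar>f x\<bar> \<le> B) \<Longrightarrow> \<bar>ruelle J f x\<bar> \<le> B"
  using ruelle_close[of f 0 B x] by simp

lemma var_bound_nonneg: "var_bound w M \<phi> \<Longrightarrow> 0 \<le> M"
  using var_bound_osc[of w M \<phi> undefined undefined] w_pos[of 0] by (simp add: zero_le_mult_iff)

text \<open>
  The common part \<open>m\<close> of the weights above \<open>x\<close> and \<open>y\<close> compares \<open>\<phi>\<close> at points with one more common
  letter; the remaining mass, at most $1-e^{-C\rho^n}$, is estimated by the total oscillation.
\<close>

lemma ruelle_contraction:
  assumes \<phi>: "var_bound w M \<phi>" shows "var_bound w (r * M) (ruelle J \<phi>)"
proof -
  have M: "0 \<le> M" using \<phi> by (rule var_bound_nonneg)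
  have one_sided: "ruelle J \<phi> x - ruelle J \<phi> y \<le> r * M * w n" if s: "stake n x = stake n y" for n x y
  proof -
    define m where "m a = min (J (a ## x)) (J (a ## y))" for a
    define P where "P = (\<Sum>a\<in>UNIV. m a)"
    \<comment> \<open>Subtracting the least value keeps the estimate of the uncoupled mass at one oscillation;
      a bound of absolute values would double it.\<close>
    define G where "G = Min (range (\<lambda>a. \<phi> (a ## y)))"
    have "P \<le> (\<Sum>a\<in>UNIV. J (a ## x))" unfolding P_def m_def by (intro sum_mono) auto
    then have P1: "P \<le> 1" by (simp add: J_sum)
    have "exp (- (C * \<rho> ^ n)) * J (a ## x) \<le> m a" for a
    proof -
      have "\<bar>ln (J (a ## x)) - ln (J (a ## y))\<bar> \<le> C * \<rho> ^ Suc n"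
        using s by (intro var_boundD[OF ln_J]) simp
      also have "\<dots> \<le> C * \<rho> ^ n"
        using C_pos rho_pos rho_less by (intro mult_left_mono power_decreasing) auto
      finally have "- (C * \<rho> ^ n) + ln (J (a ## x)) \<le> ln (J (a ## y))" by (simp add: abs_le_iff)
      then have "exp (- (C * \<rho> ^ n) + ln (J (a ## x))) \<le> J (a ## y)"
        using J_pos by (simp add: ln_ge_iff)
      then have "exp (- (C * \<rho> ^ n)) * J (a ## x) \<le> J (a ## y)" by (simp only: exp_add exp_ln J_pos)
      moreover have "exp (- (C * \<rho> ^ n)) * J (a ## x) \<le> J (a ## x)"
        using J_pos[of "a ## x"] C_pos rho_pos by (intro mult_left_le_one_le) auto
      ultimately show ?thesis by (simp add: m_def)
    qed
    then have "(\<Sum>a\<in>UNIV. exp (- (C * \<rho> ^ n)) * J (a ## x)) \<le> P" unfolding P_def by (intro sum_mono)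
    then have P0: "exp (- (C * \<rho> ^ n)) \<le> P" by (simp add: J_sum flip: sum_distrib_left)
    have "J (a ## x) * \<phi> (a ## x) - J (a ## y) * \<phi> (a ## y)
        \<le> m a * (M * w (Suc n)) + (J (a ## x) - m a) * (G + M * w 0) - (J (a ## y) - m a) * G" for a
    proof -
      have 1: "\<phi> (a ## x) - \<phi> (a ## y) \<le> M * w (Suc n)"
        using var_boundD[OF \<phi>, of "Suc n" "a ## x" "a ## y"] s by simp
      have "G \<in> range (\<lambda>a. \<phi> (a ## y))" unfolding G_def by (intro Min_in) auto
      then obtain b where "G = \<phi> (b ## y)" by blast
      then have 2: "\<phi> (a ## x) \<le> G + M * w 0" using var_bound_osc[OF \<phi>, of "a ## x" "b ## y"] by simp
      have 3: "G \<le> \<phi> (a ## y)" unfolding G_def by (intro Min_le) auto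
      have "m a * (\<phi> (a ## x) - \<phi> (a ## y)) \<le> m a * (M * w (Suc n))"
        using 1 J_pos by (intro mult_left_mono) (auto simp: m_def min_def less_imp_le)
      moreover have "(J (a ## x) - m a) * \<phi> (a ## x) \<le> (J (a ## x) - m a) * (G + M * w 0)"
        using 2 by (intro mult_left_mono) (auto simp: m_def)
      moreover have "(J (a ## y) - m a) * G \<le> (J (a ## y) - m a) * \<phi> (a ## y)"
        using 3 by (intro mult_left_mono) (auto simp: m_def)
      ultimately show ?thesis by (simp add: algebra_simps)
    qed
    then have "(\<Sum>a\<in>UNIV. J (a ## x) * \<phi> (a ## x) - J (a ## y) * \<phi> (a ## y))
        \<le> (\<Sum>a\<in>UNIV. m a * (M * w (Suc n)) + (J (a ## x) - m a) * (G + M * w 0) - (J (a ## y) - m a) * G)"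
      by (intro sum_mono)
    also have "\<dots> = P * (M * w (Suc n)) + (1 - P) * (G + M * w 0) - (1 - P) * G"
      by (simp add: P_def J_sum sum.distrib sum_subtractf flip: sum_distrib_right)
    also have "\<dots> = M * (P * w (Suc n) + (1 - P) * w 0)" by (simp add: algebra_simps)
    also have "\<dots> \<le> M * (r * w n)" using w_coupling[OF P0 P1] M by (intro mult_left_mono)
    finally show ?thesis by (simp add: ruelle_def sum_subtractf mult_ac)
  qed
  show ?thesis
  proof (rule var_boundI)
    fix n and x y :: "'a stream" assume "stake n x = stake n y"
    then show "\<bar>ruelle J \<phi> x - ruelle J \<phi> y\<bar> \<le> r * M * w n"
      using one_sided[of n x y] one_sided[of n y x] by (simp add: abs_le_iff)
  qed
qed

text \<open>
  The functions of finite seminorm. They form an algebra invariant under the operator and contain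
  the locally constant functions.
\<close>

definition lip :: "('a stream \<Rightarrow> real) \<Rightarrow> bool" where "lip \<phi> \<longleftrightarrow> (\<exists>M. var_bound w M \<phi>)"

lemma lipI: "var_bound w M \<phi> \<Longrightarrow> lip \<phi>" by (auto simp: lip_def)

lemma lipE: assumes "lip \<phi>" obtains M where "0 \<le> M" "var_bound w M \<phi>"
  using assms var_bound_nonneg by (auto simp: lip_def)

lemma lip_continuous: "lip \<phi> \<Longrightarrow> continuous_on UNIV \<phi>"
  unfolding lip_def using var_bound_continuous w_tendsto_0 by blast

lemma lip_const [simp]: "lip (\<lambda>_. c)"
  by (rule lipI[of 0]) (simp add: less_imp_le[OF w_pos])

lemma lip_add: "lip f \<Longrightarrow> lip g \<Longrightarrow> lip (\<lambda>x. f x + g x)"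
  unfolding lip_def using var_bound_add by blast

lemma lip_cmult: "lip f \<Longrightarrow> lip (\<lambda>x. c * f x)"
  unfolding lip_def using var_bound_cmult by blast

lemma lip_diff: "lip f \<Longrightarrow> lip g \<Longrightarrow> lip (\<lambda>x. f x - g x)"
  unfolding lip_def using var_bound_diff by blast

lemma lip_sum: "finite A \<Longrightarrow> (\<And>i. i \<in> A \<Longrightarrow> lip (f i)) \<Longrightarrow> lip (\<lambda>x. \<Sum>i\<in>A. f i x)"
  by (induction A rule: finite_induct) (auto intro: lip_add)

lemma lip_mult: assumes "lip f" "lip g" shows "lip (\<lambda>x. f x * g x)"
proof -
  obtain A B where "\<And>x. \<bar>f x\<bar> \<le> A" "\<And>x. \<bar>g x\<bar> \<le> B"
    using assms lip_continuous continuous_bounded_stream by metis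
  then show ?thesis using assms var_bound_mult unfolding lip_def by blast
qed

lemma lip_ruelle: "lip \<phi> \<Longrightarrow> lip (ruelle J \<phi>)"
  unfolding lip_def using ruelle_contraction by blast

lemma lip_ruelle_pow: "lip \<phi> \<Longrightarrow> lip ((ruelle J ^^ n) \<phi>)"
  by (induction n) (auto intro: lip_ruelle)

lemma var_bound_rho_imp: "var_bound (\<lambda>n. \<rho> ^ n) M \<phi> \<Longrightarrow> 0 \<le> M \<Longrightarrow> var_bound w (M / w 0) \<phi>"
  using w_ge w_pos[of 0] by (elim var_bound_mono) (simp add: field_simps mult_left_mono)

lemma var_bound_imp_rho: "var_bound w M \<phi> \<Longrightarrow> var_bound (\<lambda>n. \<rho> ^ n) (M * (Q)) \<phi>"
  using w_le by (frule_tac var_bound_nonneg, elim var_bound_mono) (simp add: mult.assoc mult_left_mono)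

lemma lip_holder: "lip \<phi> \<Longrightarrow> holder \<phi>"
  unfolding lip_def using var_bound_imp_rho var_bound_imp_holder rho_pos rho_less by blast

text \<open>
  The variations vanish from length \<open>n\<close> on and are bounded before, where \<open>w\<close> is at least \<open>w n\<close>.
\<close>

lemma lip_locally_constant:
  assumes "\<And>x y. stake n x = stake n y \<Longrightarrow> f x = f y" shows "lip f"
proof -
  have "finite (f ` UNIV)"
  proof (rule finite_subset)
    show "f ` UNIV \<subseteq> (\<lambda>v. f (v @- undefined)) ` {v. length v = n}"
    proof
      fix t assume "t \<in> f ` UNIV"
      then obtain x where x: "t = f x" by blast
      have "f x = f (stake n x @- undefined)" by (rule assms) (simp add: stake_shift)
      then show "t \<in> (\<lambda>v. f (v @- undefined)) ` {v. length v = n}" by (simp add: x)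
    qed
  qed (intro finite_imageI finite_words)
  then obtain B where B: "\<And>x. \<bar>f x\<bar> \<le> B"
    by (metis finite_imp_bounded bounded_iff rangeI real_norm_def)
  then have B0: "0 \<le> B" using abs_ge_zero order_trans by blast
  have "var_bound w (2 * B / w n) f"
  proof (rule var_boundI)
    fix k and x y :: "'a stream" assume s: "stake k x = stake k y"
    show "\<bar>f x - f y\<bar> \<le> 2 * B / w n * w k"
    proof (cases "n \<le> k")
      case True
      then show ?thesis using assms[of x y] stake_eq_mono[OF s] B0 w_pos[of n] w_pos[of k] by simp
    next
      case False
      then have "1 \<le> w k / w n" using w_antimono[of k n] w_pos[of n] by simp
      then have "2 * B * 1 \<le> 2 * B * (w k / w n)" using B0 by (intro mult_left_mono) auto
      then show ?thesis using B[of x] B[of y] by simp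
    qed
  qed
  then show ?thesis by (rule lipI)
qed

lemma lip_indicator_cyl: "lip (indicator (cyl v))"
  by (rule lip_locally_constant[of "length v"]) (auto simp: cyl_def indicator_def)

lemma J_continuous: "continuous_on UNIV J"
proof -
  have "continuous_on UNIV (\<lambda>x. exp (ln (J x)))"
    using rho_pos rho_less
    by (intro continuous_on_exp var_bound_continuous[OF ln_J] LIMSEQ_power_zero) auto
  then show ?thesis using J_pos by simp
qed

lemma ruelle_pow_contraction: "var_bound w M \<phi> \<Longrightarrow> var_bound w (r ^ n * M) ((ruelle J ^^ n) \<phi>)"
  by (induction n) (auto dest: ruelle_contraction simp: mult.assoc)

lemma ruelle_pow_close:
  assumes "\<And>x. \<bar>f x - c\<bar> \<le> B" shows "\<bar>(ruelle J ^^ n) f x - c\<bar> \<le> B"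
  using assms by (induction n arbitrary: x) (auto intro: ruelle_close)

lemma ruelle_pow_cauchy:
  assumes "var_bound w M \<phi>" "n \<le> m"
  shows "\<bar>(ruelle J ^^ m) \<phi> x - (ruelle J ^^ n) \<phi> y\<bar> \<le> r ^ n * M"
proof -
  have "\<bar>(ruelle J ^^ n) \<phi> z - (ruelle J ^^ n) \<phi> y\<bar> \<le> r ^ n * M" for z
  proof -
    have "\<bar>(ruelle J ^^ n) \<phi> z - (ruelle J ^^ n) \<phi> y\<bar> \<le> r ^ n * M * w 0"
      by (rule var_bound_osc[OF ruelle_pow_contraction[OF assms(1)]])
    also have "\<dots> \<le> r ^ n * M * 1"
      using w_less_1[of 0] r_pos var_bound_nonneg[OF assms(1)] by (intro mult_left_mono) auto
    finally show ?thesis by simp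
  qed
  then have "\<bar>(ruelle J ^^ (m - n)) ((ruelle J ^^ n) \<phi>) x - (ruelle J ^^ n) \<phi> y\<bar> \<le> r ^ n * M"
    by (rule ruelle_pow_close)
  moreover have "(ruelle J ^^ (m - n)) ((ruelle J ^^ n) \<phi>) = (ruelle J ^^ m) \<phi>"
    using funpow_add[of "m - n" n "ruelle J"] assms(2) by (simp add: fun_eq_iff)
  ultimately show ?thesis by simp
qed

lemma jac_prod_pos: "0 < jac_prod J v y"
  by (induction v) (auto simp: J_pos)

lemma sum_jac_prod: "(\<Sum>v | length v = n. jac_prod J v y) = 1"
proof -
  have "(ruelle J ^^ n) (\<lambda>_. 1) = (\<lambda>_. 1)" by (induction n) auto
  then show ?thesis using ruelle_funpow[of n J "\<lambda>_. 1" y] by simp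
qed

text \<open>
  Bounded distortion: the contributions of the letters of \<open>v\<close> form a geometric series, because the
  points that they precede agree longer and longer. The factor \<open>1 - \<rho> ^ length v\<close> carries the induction.
\<close>

lemma jac_prod_distortion:
  assumes "stake n y = stake n z"
  shows "\<bar>ln (jac_prod J v y) - ln (jac_prod J v z)\<bar> \<le> Q * \<rho> ^ n"
proof -
  have "\<bar>ln (jac_prod J v y) - ln (jac_prod J v z)\<bar> \<le> Q * \<rho> ^ n * (1 - \<rho> ^ length v)"
  proof (induction v)
    case (Cons a v)
    have "stake (n + Suc (length v)) (a ## v @- y) = stake (n + Suc (length v)) (a ## v @- z)"
      using assms by (simp add: stake_shift)
    then have "\<bar>ln (J (a ## v @- y)) - ln (J (a ## v @- z))\<bar> \<le> C * \<rho> ^ (n + Suc (length v))"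
      by (rule var_boundD[OF ln_J])
    also have "\<dots> \<le> C * \<rho> ^ (n + length v)"
      using C_pos rho_pos rho_less by (intro mult_left_mono power_decreasing) auto
    also have "\<dots> = ((1 - \<rho>) * Q) * \<rho> ^ (n + length v)" by (simp only: Q_C)
    also have "\<dots> = Q * \<rho> ^ n * (\<rho> ^ length v - \<rho> ^ Suc (length v))"
      by (simp add: algebra_simps power_add)
    finally have step: "\<bar>ln (J (a ## v @- y)) - ln (J (a ## v @- z))\<bar>
        \<le> Q * \<rho> ^ n * (\<rho> ^ length v - \<rho> ^ Suc (length v))" .
    have ln_eq: "ln (jac_prod J (a # v) x) = ln (J (a ## v @- x)) + ln (jac_prod J v x)" for x
      by (simp add: ln_mult_pos J_pos jac_prod_pos)
    have "\<bar>ln (jac_prod J (a # v) y) - ln (jac_prod J (a # v) z)\<bar>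
        \<le> Q * \<rho> ^ n * (\<rho> ^ length v - \<rho> ^ Suc (length v)) + Q * \<rho> ^ n * (1 - \<rho> ^ length v)"
      unfolding ln_eq using step Cons.IH by linarith
    then show ?case by (simp add: algebra_simps)
  qed simp
  also have "\<dots> \<le> Q * \<rho> ^ n * 1"
    using Q_pos rho_pos by (intro mult_left_mono) auto
  finally show ?thesis by simp
qed

end

section \<open>Existence and uniqueness of the Gibbs measure\<close>

lemma continuous_stream_uniform:
  fixes f :: "'a::finite stream \<Rightarrow> real"
  assumes "continuous_on UNIV f" "e > 0"
  obtains n where "\<And>x y. stake n x = stake n y \<Longrightarrow> \<bar>f x - f y\<bar> < e"
proof -
  have "uniformly_continuous_on UNIV f"
    using assms(1) compact_UNIV_stream by (rule compact_uniformly_continuous)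
  then have "\<exists>d>0. \<forall>x. \<forall>y. dist y x < d \<longrightarrow> dist (f y) (f x) < e"
    unfolding uniformly_continuous_on_def using assms(2) by simp
  then obtain d where d: "0 < d" "\<And>x y. dist y x < d \<Longrightarrow> dist (f y) (f x) < e" by blast
  obtain n where n: "(1/2::real) ^ n < d" using real_arch_pow_inv[OF d(1), of "1/2"] by auto
  have "\<bar>f x - f y\<bar> < e" if "stake n x = stake n y" for x y
  proof -
    have "dist x y \<le> (1/2) ^ Suc n" using that by (rule dist_stream_le)
    also have "\<dots> \<le> (1/2) ^ n" by (rule power_decreasing) simp_all
    finally show ?thesis using d(2)[of x y] n by (simp add: dist_real_def)
  qed
  then show thesis by (rule that)
qed

definition clopens :: "'a::finite stream set set" where
  "clopens = {B. \<exists>n. \<forall>x y. stake n x = stake n y \<longrightarrow> (x \<in> B \<longleftrightarrow> y \<in> B)}"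

lemma clopensD:
  assumes "B \<in> clopens"
  shows "\<exists>n. \<forall>m\<ge>n. \<forall>x y. stake m x = stake m y \<longrightarrow> (x \<in> B \<longleftrightarrow> y \<in> B)"
proof -
  obtain n where n: "\<forall>x y. stake n x = stake n y \<longrightarrow> (x \<in> B \<longleftrightarrow> y \<in> B)"
    using assms unfolding clopens_def mem_Collect_eq ..
  have "x \<in> B \<longleftrightarrow> y \<in> B" if "n \<le> m" "stake m x = stake m y" for m x y
    using n[rule_format, OF stake_eq_mono[OF that(2,1)]] .
  then show ?thesis by blast
qed

lemma clopensI: "(\<And>x y. stake n x = stake n y \<Longrightarrow> x \<in> B \<longleftrightarrow> y \<in> B) \<Longrightarrow> B \<in> clopens"
  unfolding clopens_def by blast

lemma cyl_clopen: "cyl v \<in> clopens"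
  by (rule clopensI[of "length v"]) (auto simp: cyl_def)

lemma algebra_clopens: "algebra UNIV clopens"
proof (rule algebra_iff_Un[THEN iffD2], intro conjI ballI)
  show "{} \<in> clopens" by (auto simp: clopens_def)
  fix A :: "'a::finite stream set" assume A: "A \<in> clopens"
  then show "UNIV - A \<in> clopens" by (auto simp: clopens_def)
  fix B :: "'a stream set" assume "B \<in> clopens"
  then obtain n where n: "\<forall>k\<ge>n. \<forall>x y. stake k x = stake k y \<longrightarrow> (x \<in> B \<longleftrightarrow> y \<in> B)"
    using clopensD by blast
  obtain m where m: "\<forall>k\<ge>m. \<forall>x y. stake k x = stake k y \<longrightarrow> (x \<in> A \<longleftrightarrow> y \<in> A)"
    using clopensD[OF A] ..
  show "A \<union> B \<in> clopens"
  proof (rule clopensI[of "max m n"])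
    fix x y :: "'a stream" assume s: "stake (max m n) x = stake (max m n) y"
    show "x \<in> A \<union> B \<longleftrightarrow> y \<in> A \<union> B"
      using n[rule_format, OF max.cobounded2 s] m[rule_format, OF max.cobounded1 s] by simp
  qed
qed simp

lemma open_clopens: assumes "B \<in> clopens" shows "open B"
proof -
  obtain n where n: "\<forall>x y. stake n x = stake n y \<longrightarrow> (x \<in> B \<longleftrightarrow> y \<in> B)"
    using assms unfolding clopens_def mem_Collect_eq ..
  have "cyl (stake n x) \<subseteq> B" if "x \<in> B" for x
  proof
    fix y assume "y \<in> cyl (stake n x)"
    then have "stake n y = stake n x" by (simp add: cyl_def)
    then show "y \<in> B" using n[rule_format, of y x] that by simp
  qed
  then show ?thesis unfolding open_stream_iff_cyl by blast
qed

lemma sigma_sets_clopens: "sigma_sets UNIV clopens = sets borel"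
  unfolding sets_borel_stream
proof (rule sigma_sets_eqI)
  fix B assume "B \<in> clopens"
  then show "B \<in> sigma_sets UNIV (range cyl)"
    using open_clopens borel_open sets_borel_stream by metis
qed (auto intro: cyl_clopen)

context log_holder_jacobian
begin

lemma continuous_approx_lip:
  assumes "continuous_on UNIV \<phi>" "e > 0"
  obtains \<psi> where "lip \<psi>" "\<And>x. \<bar>\<phi> x - \<psi> x\<bar> \<le> e"
proof -
  obtain n where n: "\<And>x y. stake n x = stake n y \<Longrightarrow> \<bar>\<phi> x - \<phi> y\<bar> < e"
    using continuous_stream_uniform[OF assms] by blast
  have "lip (\<lambda>x. \<phi> (stake n x @- undefined))" by (rule lip_locally_constant[of n]) simp
  moreover have "\<bar>\<phi> x - \<phi> (stake n x @- undefined)\<bar> \<le> e" for x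
    by (rule less_imp_le, rule n) (simp add: stake_shift)
  ultimately show thesis by (rule that)
qed

text \<open>
  Functions of finite seminorm are uniformly dense and both sides are contractions in the uniform norm.
\<close>

lemma invariant_imp_ruelle_dual:
  assumes "borel_prob \<mu>" and lip: "\<And>\<phi>. lip \<phi> \<Longrightarrow> (\<integral>x. \<phi> x \<partial>\<mu>) = (\<integral>x. ruelle J \<phi> x \<partial>\<mu>)"
  shows "is_ruelle_dual J \<mu> \<mu>"
proof -
  interpret borel_prob \<mu> by fact
  have "(\<integral>x. \<phi> x \<partial>\<mu>) = (\<integral>x. ruelle J \<phi> x \<partial>\<mu>)" if \<phi>: "continuous_on UNIV \<phi>" for \<phi>
  proof -
    have "\<bar>(\<integral>x. \<phi> x \<partial>\<mu>) - (\<integral>x. ruelle J \<phi> x \<partial>\<mu>)\<bar> \<le> 0 + e" if e: "e > 0" for e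
    proof -
      obtain \<psi> where \<psi>: "lip \<psi>" "\<And>x. \<bar>\<phi> x - \<psi> x\<bar> \<le> e / 2"
        using continuous_approx_lip[OF \<phi>, of "e / 2"] e by auto
      have "\<bar>ruelle J \<phi> x - ruelle J \<psi> x\<bar> \<le> e / 2" for x
        using ruelle_bound[of "\<lambda>x. \<phi> x - \<psi> x" "e / 2" x] \<psi>(2) by (simp add: ruelle_diff)
      then have "\<bar>(\<integral>x. ruelle J \<phi> x \<partial>\<mu>) - (\<integral>x. ruelle J \<psi> x \<partial>\<mu>)\<bar> \<le> e / 2"
        by (intro integral_close continuous_on_ruelle J_continuous \<phi> lip_continuous \<psi>(1))
      moreover have "\<bar>(\<integral>x. \<phi> x \<partial>\<mu>) - (\<integral>x. \<psi> x \<partial>\<mu>)\<bar> \<le> e / 2"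
        by (intro integral_close \<phi> lip_continuous \<psi>)
      ultimately show ?thesis using lip[OF \<psi>(1)] by linarith
    qed
    then have "\<bar>(\<integral>x. \<phi> x \<partial>\<mu>) - (\<integral>x. ruelle J \<phi> x \<partial>\<mu>)\<bar> \<le> 0" by (rule field_le_epsilon)
    then show ?thesis by simp
  qed
  then show ?thesis unfolding is_ruelle_dual_def using finite_measure_axioms sets_eq by blast
qed

text \<open>
  The iterates of a function converge uniformly to a constant; this constant will be its Gibbs integral.
\<close>

definition gibbs_mean :: "('a stream \<Rightarrow> real) \<Rightarrow> real" where
  "gibbs_mean \<phi> = lim (\<lambda>n. (ruelle J ^^ n) \<phi> undefined)"

lemma gibbs_mean_limit:
  assumes "lip \<phi>" shows "(\<lambda>n. (ruelle J ^^ n) \<phi> undefined) \<longlonglongrightarrow> gibbs_mean \<phi>"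
proof -
  obtain M where M: "0 \<le> M" "var_bound w M \<phi>" using assms by (rule lipE)
  have lim: "(\<lambda>n. r ^ n * M) \<longlonglongrightarrow> 0"
    using r_pos r_less_1 by (intro tendsto_mult_left_zero LIMSEQ_power_zero) auto
  have "Cauchy (\<lambda>n. (ruelle J ^^ n) \<phi> undefined)"
  proof (rule CauchyI')
    fix e :: real assume "e > 0"
    then have "\<forall>\<^sub>F n in sequentially. r ^ n * M < e" using lim by (simp add: order_tendstoD)
    then obtain N where N: "r ^ N * M < e" by (auto simp: eventually_sequentially)
    have "dist ((ruelle J ^^ m) \<phi> undefined) ((ruelle J ^^ n) \<phi> undefined) < e" if "m \<ge> N" "n > m" for m n
    proof -
      have "\<bar>(ruelle J ^^ n) \<phi> undefined - (ruelle J ^^ m) \<phi> undefined\<bar> \<le> r ^ m * M"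
        using that by (intro ruelle_pow_cauchy[OF M(2)]) simp
      also have "\<dots> \<le> r ^ N * M"
        using that r_pos r_less_1 M by (intro mult_right_mono power_decreasing) auto
      finally show ?thesis using N by (simp add: dist_real_def abs_minus_commute)
    qed
    then show "\<exists>N. \<forall>m\<ge>N. \<forall>n>m. dist ((ruelle J ^^ m) \<phi> undefined) ((ruelle J ^^ n) \<phi> undefined) < e" by blast
  qed
  then show ?thesis unfolding gibbs_mean_def using Cauchy_convergent convergent_LIMSEQ_iff by blast
qed

lemma ruelle_pow_add: "(ruelle J ^^ n) (\<lambda>x. f x + g x) = (\<lambda>x. (ruelle J ^^ n) f x + (ruelle J ^^ n) g x)"
  by (induction n) (simp_all add: ruelle_add)

lemma ruelle_pow_cmult: "(ruelle J ^^ n) (\<lambda>x. c * f x) = (\<lambda>x. c * (ruelle J ^^ n) f x)"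
  by (induction n) (simp_all add: ruelle_cmult)

lemma ruelle_pow_const [simp]: "(ruelle J ^^ n) (\<lambda>_. c) = (\<lambda>_. c)"
  by (induction n) simp_all

lemma gibbs_mean_add: 
  assumes "lip f" "lip g" shows "gibbs_mean (\<lambda>x. f x + g x) = gibbs_mean f + gibbs_mean g"
  using gibbs_mean_limit[OF lip_add[OF assms]]
    tendsto_add[OF gibbs_mean_limit[OF assms(1)] gibbs_mean_limit[OF assms(2)]]
  unfolding ruelle_pow_add by (rule LIMSEQ_unique)

lemma gibbs_mean_cmult: 
  assumes "lip f" shows "gibbs_mean (\<lambda>x. c * f x) = c * gibbs_mean f"
  using gibbs_mean_limit[OF lip_cmult[OF assms]] tendsto_mult_left[OF gibbs_mean_limit[OF assms(1)], of c]
  unfolding ruelle_pow_cmult by (rule LIMSEQ_unique)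

lemma gibbs_mean_const [simp]: "gibbs_mean (\<lambda>_. c) = c"
  by (simp add: gibbs_mean_def)

lemma gibbs_mean_sum: 
  assumes "finite A" "\<And>i. i \<in> A \<Longrightarrow> lip (f i)"
  shows "gibbs_mean (\<lambda>x. \<Sum>i\<in>A. f i x) = (\<Sum>i\<in>A. gibbs_mean (f i))"
  using assms by (induction A rule: finite_induct) (simp_all add: gibbs_mean_add lip_sum)

lemma gibbs_mean_ruelle:
  assumes "lip \<phi>" shows "gibbs_mean (ruelle J \<phi>) = gibbs_mean \<phi>"
proof -
  have "(\<lambda>n. (ruelle J ^^ n) (ruelle J \<phi>) undefined) \<longlonglongrightarrow> gibbs_mean \<phi>"
    using LIMSEQ_Suc[OF gibbs_mean_limit[OF assms]] by (simp only: funpow_Suc_right comp_def)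
  then show ?thesis using gibbs_mean_limit[OF lip_ruelle[OF assms]] LIMSEQ_unique by blast
qed

lemma gibbs_mean_close:
  assumes "lip \<phi>" "\<And>x. \<bar>\<phi> x - c\<bar> \<le> B" shows "\<bar>gibbs_mean \<phi> - c\<bar> \<le> B"
proof (rule LIMSEQ_le_const2)
  show "(\<lambda>n. \<bar>(ruelle J ^^ n) \<phi> undefined - c\<bar>) \<longlonglongrightarrow> \<bar>gibbs_mean \<phi> - c\<bar>"
    by (intro tendsto_intros gibbs_mean_limit assms)
qed (use ruelle_pow_close[OF assms(2)] in auto)

lemma lip_indicator_clopen: assumes "B \<in> clopens" shows "lip (indicator B)"
proof -
  obtain n where n: "\<forall>x y. stake n x = stake n y \<longrightarrow> (x \<in> B \<longleftrightarrow> y \<in> B)"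
    using assms unfolding clopens_def mem_Collect_eq ..
  show ?thesis
  proof (rule lip_locally_constant[of n])
    fix x y :: "'a stream" assume s: "stake n x = stake n y"
    have "x \<in> B \<longleftrightarrow> y \<in> B" by (rule n[rule_format, OF s])
    then show "indicator B x = (indicator B y :: real)" by (simp add: indicator_def)
  qed
qed

lemma gibbs_mean_nonneg:
  assumes "lip f" "\<And>x. 0 \<le> f x" shows "0 \<le> gibbs_mean f"
proof (rule LIMSEQ_le_const[OF gibbs_mean_limit[OF assms(1)]], intro exI allI impI)
  fix n show "0 \<le> (ruelle J ^^ n) f undefined"
    unfolding ruelle_funpow using assms jac_prod_pos by (intro sum_nonneg mult_nonneg_nonneg) (auto intro: less_imp_le)
qed

text \<open>
  Caratheodory extension of the finitely additive content on clopen sets. Continuity at the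
  empty set is automatic: by compactness a decreasing sequence of clopen sets with empty
  intersection is eventually empty.
\<close>

lemma measure_of_gibbs_mean:
  obtains \<mu> where "borel_prob \<mu>" "\<And>B. B \<in> clopens \<Longrightarrow> measure \<mu> B = gibbs_mean (indicator B)"
proof -
  interpret algebra UNIV clopens by (rule algebra_clopens)
  let ?f = "\<lambda>B. ennreal (gibbs_mean (indicator B))"
  have ind_empty: "indicator {} = (\<lambda>_ :: 'a stream. 0 :: real)" by (simp add: fun_eq_iff)
  have "\<exists>m. (\<forall>s\<in>clopens. m s = ?f s) \<and> measure_space UNIV (sigma_sets UNIV clopens) m"
  proof (rule caratheodory_empty_continuous)
    show "positive clopens ?f" by (simp add: positive_def ind_empty)
    show "additive clopens ?f" unfolding additive_def
    proof (intro ballI impI)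
      fix A B :: "'a stream set" assume AB: "A \<in> clopens" "B \<in> clopens" "A \<inter> B = {}"
      then have "indicator (A \<union> B) = (\<lambda>x. indicator A x + indicator B x :: real)"
        by (auto simp: fun_eq_iff indicator_def)
      then show "?f (A \<union> B) = ?f A + ?f B"
        using AB by (simp add: gibbs_mean_add lip_indicator_clopen gibbs_mean_nonneg flip: ennreal_plus)
    qed
  next
    fix A :: "nat \<Rightarrow> 'a stream set" assume A: "range A \<subseteq> clopens" "decseq A" "(\<Inter>i. A i) = {}"
    have "\<exists>N. A N = {}"
    proof -
      have cover: "UNIV \<subseteq> (\<Union>i\<in>UNIV. - A i)" using A(3) by blast
      have op: "open (- A i)" for i
        using A(1) open_clopens[of "- A i"] compl_sets[of "A i"] by (auto simp: Compl_eq_Diff_UNIV)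
      obtain I where I: "finite I" "UNIV \<subseteq> (\<Union>i\<in>I. - A i)"
        by (rule compactE_image[OF compact_UNIV_stream op cover])
      have "x \<notin> A (Max (insert 0 I))" for x
      proof -
        obtain i where i: "i \<in> I" "x \<notin> A i" using I(2) by blast
        have "A (Max (insert 0 I)) \<subseteq> A i"
          using A(2) by (rule decseqD) (use I(1) i(1) in \<open>simp add: Max_ge\<close>)
        then show ?thesis using i(2) by blast
      qed
      then show ?thesis by blast
    qed
    then obtain N where "A N = {}" ..
    then have "A n = {}" if "n \<ge> N" for n using decseqD[OF A(2) that] by simp
    then have "\<forall>\<^sub>F n in sequentially. ?f (A n) = 0"
      by (auto simp: eventually_sequentially ind_empty intro!: exI[of _ N])
    then show "(\<lambda>i. ?f (A i)) \<longlonglongrightarrow> 0" by (rule tendsto_eventually)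
  qed simp
  then obtain m where m: "\<And>s. s \<in> clopens \<Longrightarrow> m s = ?f s" "measure_space UNIV (sigma_sets UNIV clopens) m"
    by blast
  define \<mu> where "\<mu> = measure_of UNIV clopens m"
  have sets: "sets \<mu> = sets borel" by (simp add: \<mu>_def sigma_sets_clopens)
  have em: "emeasure \<mu> B = ?f B" if "B \<in> clopens" for B
    using that m by (subst emeasure_measure_of[OF \<mu>_def]) (auto simp: measure_space_def \<mu>_def)
  show thesis
  proof
    have "UNIV \<in> clopens" using cyl_clopen[of "[]"] by simp
    then have "emeasure \<mu> (space \<mu>) = 1" using em[of UNIV] by (simp add: \<mu>_def)
    then show "borel_prob \<mu>" using sets by (intro borel_prob.intro prob_spaceI borel_prob_axioms.intro)
    fix B :: "'a stream set" assume "B \<in> clopens"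
    then show "measure \<mu> B = gibbs_mean (indicator B)"
      by (simp add: measure_def em gibbs_mean_nonneg lip_indicator_clopen)
  qed
qed

text \<open>
  Both sides agree on step functions and are contractions in the uniform norm.
\<close>

lemma integral_eq_gibbs_mean:
  assumes "borel_prob \<mu>" "\<And>B. B \<in> clopens \<Longrightarrow> measure \<mu> B = gibbs_mean (indicator B)" "lip \<psi>"
  shows "(\<integral>x. \<psi> x \<partial>\<mu>) = gibbs_mean \<psi>"
proof -
  interpret borel_prob \<mu> by fact
  obtain M where M: "0 \<le> M" "var_bound w M \<psi>" using assms(3) by (rule lipE)
  have close: "\<bar>(\<integral>x. \<psi> x \<partial>\<mu>) - gibbs_mean \<psi>\<bar> \<le> 2 * M * w n" for n
  proof -
    define V where "V = {v :: 'a list. length v = n}"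
    have V: "finite V" unfolding V_def by (rule finite_words)
    define \<psi>' where "\<psi>' x = (\<Sum>v\<in>V. \<psi> (v @- undefined) * indicator (cyl v) x)" for x
    have \<psi>'_eq: "\<psi>' x = \<psi> (stake n x @- undefined)" for x
    proof -
      have "\<psi>' x = (\<Sum>v\<in>V. if v = stake n x then \<psi> (v @- undefined) else 0)"
        unfolding \<psi>'_def by (intro sum.cong) (auto simp: V_def cyl_def indicator_def)
      then show ?thesis using V by (simp add: V_def)
    qed
    have lip': "lip \<psi>'"
      unfolding \<psi>'_def by (intro lip_sum V lip_cmult lip_indicator_cyl)
    have c: "\<bar>\<psi> x - \<psi>' x\<bar> \<le> M * w n" for x
      unfolding \<psi>'_eq by (intro var_boundD[OF M(2)]) (simp add: stake_shift)
    have "(\<integral>x. \<psi>' x \<partial>\<mu>) = (\<Sum>v\<in>V. \<psi> (v @- undefined) * measure \<mu> (cyl v))"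
      unfolding \<psi>'_def
      by (subst Bochner_Integration.integral_sum) (auto intro!: integrable_continuous lip_continuous lip_cmult lip_indicator_cyl)
    also have "\<dots> = gibbs_mean \<psi>'"
      unfolding \<psi>'_def using assms(2)[OF cyl_clopen] V
      by (subst gibbs_mean_sum) (auto simp: gibbs_mean_cmult lip_indicator_cyl intro!: lip_cmult lip_indicator_cyl)
    finally have "(\<integral>x. \<psi>' x \<partial>\<mu>) = gibbs_mean \<psi>'" .
    moreover have "\<bar>(\<integral>x. \<psi> x \<partial>\<mu>) - (\<integral>x. \<psi>' x \<partial>\<mu>)\<bar> \<le> M * w n"
      by (intro integral_close lip_continuous assms lip' c)
    moreover have "\<bar>gibbs_mean \<psi> - gibbs_mean \<psi>'\<bar> \<le> M * w n"
    proof -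
      have "gibbs_mean (\<lambda>x. \<psi> x + (-1) * \<psi>' x) = gibbs_mean \<psi> - gibbs_mean \<psi>'"
        by (simp only: gibbs_mean_add gibbs_mean_cmult assms(3) lip' lip_cmult)
      then show ?thesis
        using gibbs_mean_close[of "\<lambda>x. \<psi> x + (-1) * \<psi>' x" 0 "M * w n"] c assms(3) lip'
          lip_add[OF assms(3) lip_cmult[OF lip', of "-1"]] by simp
    qed
    ultimately show ?thesis by linarith
  qed
  have "(\<lambda>n. 2 * M * w n) \<longlonglongrightarrow> 0" using w_tendsto_0 by (rule tendsto_mult_right_zero)
  then have "\<bar>(\<integral>x. \<psi> x \<partial>\<mu>) - gibbs_mean \<psi>\<bar> \<le> 0"
    by (rule LIMSEQ_le_const) (use close in blast)
  then show ?thesis by simp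
qed

theorem gibbs_measure_exists: "\<exists>\<mu>. borel_prob \<mu> \<and> is_ruelle_dual J \<mu> \<mu>"
proof -
  obtain \<mu> where \<mu>: "borel_prob \<mu>" "\<And>B. B \<in> clopens \<Longrightarrow> measure \<mu> B = gibbs_mean (indicator B)"
    using measure_of_gibbs_mean by blast
  have "is_ruelle_dual J \<mu> \<mu>"
    using \<mu> by (intro invariant_imp_ruelle_dual) (auto simp: integral_eq_gibbs_mean lip_ruelle gibbs_mean_ruelle)
  then show ?thesis using \<mu>(1) by blast
qed

end

locale gibbs_measure = log_holder_jacobian J C \<rho> + borel_prob \<mu>
  for J :: "'a::finite stream \<Rightarrow> real" and C \<rho> :: real and \<mu> :: "'a stream measure" +
  assumes dual: "is_ruelle_dual J \<mu> \<mu>"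
begin

lemma integral_ruelle: "continuous_on UNIV \<phi> \<Longrightarrow> (\<integral>x. ruelle J \<phi> x \<partial>\<mu>) = (\<integral>x. \<phi> x \<partial>\<mu>)"
  using dual by (simp add: is_ruelle_dual_def)

lemma integral_ruelle_pow:
  "continuous_on UNIV \<phi> \<Longrightarrow> (\<integral>x. (ruelle J ^^ n) \<phi> x \<partial>\<mu>) = (\<integral>x. \<phi> x \<partial>\<mu>)"
proof (induction n arbitrary: \<phi>)
  case (Suc n)
  have "(\<integral>x. (ruelle J ^^ Suc n) \<phi> x \<partial>\<mu>) = (\<integral>x. (ruelle J ^^ n) (ruelle J \<phi>) x \<partial>\<mu>)"
    by (simp only: funpow_Suc_right comp_def)
  also have "\<dots> = (\<integral>x. \<phi> x \<partial>\<mu>)"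
    using Suc by (simp add: continuous_on_ruelle J_continuous integral_ruelle)
  finally show ?case .
qed simp

text \<open>
  The mean of the iterate over \<open>\<mu>\<close> is that of \<open>\<phi>\<close>, and the iterate is nearly constant.
\<close>

lemma ruelle_pow_mean:
  assumes "var_bound w M \<phi>" shows "\<bar>(ruelle J ^^ n) \<phi> x - (\<integral>x. \<phi> x \<partial>\<mu>)\<bar> \<le> r ^ n * M"
proof -
  have "continuous_on UNIV ((ruelle J ^^ n) \<phi>)"
    using assms by (intro lip_continuous lip_ruelle_pow lipI)
  then have "\<bar>(\<integral>y. (ruelle J ^^ n) \<phi> y \<partial>\<mu>) - (\<integral>y. (ruelle J ^^ n) \<phi> x \<partial>\<mu>)\<bar> \<le> r ^ n * M"
    by (intro integral_close ruelle_pow_cauchy assms) auto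
  then show ?thesis
    using assms by (simp add: abs_minus_commute integral_ruelle_pow lip_continuous lipI)
qed

lemma mean_close: assumes "var_bound w M \<phi>" shows "\<bar>\<phi> x - (\<integral>x. \<phi> x \<partial>\<mu>)\<bar> \<le> M"
  using ruelle_pow_mean[OF assms, of 0] by simp

text \<open>
  The integral of each cylinder indicator is the limit of its iterates.
\<close>

lemma gibbs_measure_unique:
  assumes "gibbs_measure J C \<rho> \<nu>" shows "\<nu> = \<mu>"
proof -
  interpret \<nu>: gibbs_measure J C \<rho> \<nu> by fact
  show ?thesis
  proof (rule measure_eq_if_cyl_eq)
    fix v :: "'a list"
    obtain M where M: "0 \<le> M" "var_bound w M (indicator (cyl v))" using lip_indicator_cyl by (rule lipE)
    have "\<bar>measure \<nu> (cyl v) - measure \<mu> (cyl v)\<bar> \<le> 2 * (r ^ n * M)" for n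
      using ruelle_pow_mean[OF M(2), of n undefined] \<nu>.ruelle_pow_mean[OF M(2), of n undefined] by simp
    moreover have "(\<lambda>n. 2 * (r ^ n * M)) \<longlonglongrightarrow> 0"
      using r_pos r_less_1 by (intro tendsto_mult_right_zero tendsto_mult_left_zero LIMSEQ_power_zero) auto
    ultimately have "\<bar>measure \<nu> (cyl v) - measure \<mu> (cyl v)\<bar> \<le> 0"
      by (intro LIMSEQ_le_const[where X = "\<lambda>n. 2 * (r ^ n * M)"]) blast+
    then show "measure \<nu> (cyl v) = measure \<mu> (cyl v)" by simp
  qed (auto intro: finite_measure_axioms \<nu>.finite_measure_axioms)
qed

text \<open>
  Integrating $L(\varphi\circ\sigma) = \varphi$.
\<close>

lemma shift_invariant: "distr \<mu> borel stl = \<mu>"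
proof (rule measure_eq_if_cyl_eq)
  have st [measurable]: "stl \<in> measurable \<mu> borel" using measurable_stl by (simp add: measurable_def)
  show "finite_measure (distr \<mu> borel stl)" by (rule finite_measure_distr[OF st])
  fix v :: "'a list"
  have c: "continuous_on UNIV (\<lambda>x :: 'a stream. indicator (cyl v) x :: real)"
    by (intro lip_continuous lip_indicator_cyl)
  have "measure (distr \<mu> borel stl) (cyl v) = (\<integral>x. indicator (cyl v) x \<partial>distr \<mu> borel stl)"
    by simp
  also have "\<dots> = (\<integral>x. indicator (cyl v) (stl x) \<partial>\<mu>)"
    by (intro integral_distr st) simp
  also have "\<dots> = (\<integral>x. ruelle J (\<lambda>x. indicator (cyl v) (stl x) * 1) x \<partial>\<mu>)"
    by (subst integral_ruelle) (auto intro!: continuous_intros c)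
  also have "\<dots> = (\<integral>x. indicator (cyl v) x * ruelle J (\<lambda>x. 1) x \<partial>\<mu>)"
    by (subst ruelle_mult_stl) simp
  also have "\<dots> = measure \<mu> (cyl v)" by simp
  finally show "measure (distr \<mu> borel stl) (cyl v) = measure \<mu> (cyl v)" .
qed (auto intro: finite_measure_axioms)

lemma shift_invariant_prob: "shift_invariant_prob \<mu>"
  by (simp add: shift_invariant_prob_def prob_space_axioms shift_invariant)

lemma ruelle_pow_indicator_cyl: "(ruelle J ^^ length v) (indicator (cyl v)) y = jac_prod J v y"
proof -
  have "(ruelle J ^^ length v) (indicator (cyl v)) y
      = (\<Sum>u | length u = length v. if u = v then jac_prod J u y else 0)"
    unfolding ruelle_funpow by (intro sum.cong) (auto simp: cyl_def stake_shift indicator_def)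
  then show ?thesis by (simp add: finite_words)
qed

lemma measure_cyl: "measure \<mu> (cyl v) = (\<integral>y. jac_prod J v y \<partial>\<mu>)"
  using integral_ruelle_pow[OF lip_continuous[OF lip_indicator_cyl], of "length v" v]
  by (simp add: ruelle_pow_indicator_cyl)

lemma jac_prod_continuous: "continuous_on UNIV (jac_prod J v)"
proof -
  have "continuous_on UNIV ((ruelle J ^^ length v) (indicator (cyl v)))"
    by (intro lip_continuous lip_ruelle_pow lip_indicator_cyl)
  then show ?thesis by (simp add: ruelle_pow_indicator_cyl[abs_def])
qed

text \<open>
  The measure of a cylinder is the mean of its weights, which vary by at most the factor $e^Q$.
\<close>

lemma jac_prod_le_measure: "jac_prod J v y \<le> exp Q * measure \<mu> (cyl v)"
  and measure_le_jac_prod: "measure \<mu> (cyl v) \<le> exp Q * jac_prod J v y"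
proof -
  have le: "jac_prod J v y \<le> exp Q * jac_prod J v z" for y z
  proof -
    have "\<bar>ln (jac_prod J v y) - ln (jac_prod J v z)\<bar> \<le> Q * \<rho> ^ 0"
      by (rule jac_prod_distortion) simp
    then have "ln (jac_prod J v y) \<le> Q + ln (jac_prod J v z)" by (simp add: abs_le_iff)
    then have "exp (ln (jac_prod J v y)) \<le> exp (Q + ln (jac_prod J v z))" by simp
    then show ?thesis by (simp only: exp_add exp_ln jac_prod_pos)
  qed
  have "(\<integral>z. jac_prod J v y \<partial>\<mu>) \<le> (\<integral>z. exp Q * jac_prod J v z \<partial>\<mu>)"
    by (intro integral_mono integrable_continuous continuous_intros jac_prod_continuous le)
  then show "jac_prod J v y \<le> exp Q * measure \<mu> (cyl v)" by (simp add: measure_cyl)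
  have "(\<integral>z. jac_prod J v z \<partial>\<mu>) \<le> (\<integral>z. exp Q * jac_prod J v y \<partial>\<mu>)"
    by (intro integral_mono integrable_continuous continuous_intros jac_prod_continuous le)
  then show "measure \<mu> (cyl v) \<le> exp Q * jac_prod J v y" by (simp add: measure_cyl)
qed

lemma measure_cyl_pos: "0 < measure \<mu> (cyl v)"
proof -
  have "0 < exp Q * measure \<mu> (cyl v)"
    using jac_prod_pos[of v undefined] jac_prod_le_measure[of v undefined] by linarith
  then show ?thesis by (simp add: zero_less_mult_iff)
qed

text \<open>
  Cylinders have positive measure, so \<open>\<mu>\<close> has full support.
\<close>

lemma continuous_nonneg_integral_0:
  fixes g :: "'a stream \<Rightarrow> real"
  assumes g: "continuous_on UNIV g" "\<And>x. 0 \<le> g x" and 0: "(\<integral>x. g x \<partial>\<mu>) = 0" shows "g x = 0"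
proof (rule ccontr)
  assume "g x \<noteq> 0"
  then have gx: "0 < g x" using g(2)[of x] by simp
  then obtain n where n: "\<And>y. stake n y = stake n x \<Longrightarrow> \<bar>g y - g x\<bar> < g x / 2"
    using g(1) unfolding continuous_on_stream_iff by (meson half_gt_zero)
  have "(\<integral>y. g x / 2 * indicator (cyl (stake n x)) y \<partial>\<mu>) \<le> (\<integral>y. g y \<partial>\<mu>)"
  proof (intro integral_mono integrable_continuous g)
    show "continuous_on UNIV (\<lambda>y. g x / 2 * indicator (cyl (stake n x)) y)"
      by (intro lip_continuous lip_cmult lip_indicator_cyl)
    fix y show "g x / 2 * indicator (cyl (stake n x)) y \<le> g y"
      using n[of y] g(2)[of y]
      by (cases "y \<in> cyl (stake n x)") (auto simp: cyl_def abs_if split: if_splits)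
  qed
  then show False using gx measure_cyl_pos[of "stake n x"] 0 by (simp add: mult_le_0_iff)
qed

end

section \<open>Entropy of finite-valued maps\<close>

text \<open>
  Nonnegativity of relative entropy, from $\ln t \le t - 1$.
\<close>

lemma gibbs_inequality:
  fixes p q :: "'s \<Rightarrow> real"
  assumes "finite S" "\<And>s. s \<in> S \<Longrightarrow> 0 \<le> p s" "\<And>s. s \<in> S \<Longrightarrow> 0 \<le> q s"
    and "sum p S = 1" "sum q S \<le> 1" "\<And>s. s \<in> S \<Longrightarrow> q s = 0 \<Longrightarrow> p s = 0"
  shows "- (\<Sum>s\<in>S. p s * ln (p s)) \<le> - (\<Sum>s\<in>S. p s * ln (q s))"
proof -
  have "p s * ln (q s) - p s * ln (p s) \<le> q s - p s" if s: "s \<in> S" for s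
  proof (cases "p s = 0")
    case True then show ?thesis using assms(3)[OF s] by simp
  next
    case False
    then have pos: "0 < p s" "0 < q s" using assms(2,3,6)[OF s] by (auto simp: less_le)
    have "p s * ln (q s) - p s * ln (p s) = p s * ln (q s / p s)"
      using pos by (simp add: ln_div right_diff_distrib)
    also have "\<dots> \<le> p s * (q s / p s - 1)"
      using pos by (intro mult_left_mono ln_le_minus_one) auto
    also have "\<dots> = q s - p s" using pos by (simp add: field_simps)
    finally show ?thesis .
  qed
  then have "(\<Sum>s\<in>S. p s * ln (q s) - p s * ln (p s)) \<le> (\<Sum>s\<in>S. q s - p s)" by (rule sum_mono)
  then show ?thesis using assms(4,5) by (simp add: sum_subtractf)
qed

context borel_prob
begin

lemma finite_valued_integral:
  fixes G :: "'s \<Rightarrow> real"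
  assumes "finite S" "\<And>x. f x \<in> S" "\<And>s. s \<in> S \<Longrightarrow> {x. f x = s} \<in> sets borel"
  shows "integrable \<mu> (\<lambda>x. G (f x))" "(\<integral>x. G (f x) \<partial>\<mu>) = (\<Sum>s\<in>S. measure \<mu> {x. f x = s} * G s)"
proof -
  have eq: "G (f x) = (\<Sum>s\<in>S. G s * indicator {x. f x = s} x)" for x
  proof -
    have "(\<Sum>s\<in>S. G s * indicator {x. f x = s} x) = (\<Sum>s\<in>S. if s = f x then G s else 0)"
      by (intro sum.cong) (auto simp: indicator_def)
    then show ?thesis using assms(1,2) by simp
  qed
  have int: "integrable \<mu> (\<lambda>x. G s * indicator {x. f x = s} x)" if "s \<in> S" for s
    using assms(3)[OF that] by (intro integrable_mult_right integrable_real_indicator) (auto simp: emeasure_eq_measure)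
  show "integrable \<mu> (\<lambda>x. G (f x))" unfolding eq by (intro Bochner_Integration.integrable_sum int)
  show "(\<integral>x. G (f x) \<partial>\<mu>) = (\<Sum>s\<in>S. measure \<mu> {x. f x = s} * G s)"
  proof -
    have "(\<integral>x. (\<Sum>s\<in>S. G s * indicator {x. f x = s} x) \<partial>\<mu>) = (\<Sum>s\<in>S. \<integral>x. G s * indicator {x. f x = s} x \<partial>\<mu>)"
      by (intro Bochner_Integration.integral_sum int)
    also have "\<dots> = (\<Sum>s\<in>S. measure \<mu> {x. f x = s} * G s)" by (simp add: mult.commute)
    finally show ?thesis unfolding eq .
  qed
qed

lemma finite_valued_sum:
  assumes "finite S" "\<And>x. f x \<in> S" "\<And>s. s \<in> S \<Longrightarrow> {x. f x = s} \<in> sets borel"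
  shows "(\<Sum>s\<in>S. measure \<mu> {x. f x = s}) = 1"
  using finite_valued_integral(2)[OF assms, of "\<lambda>_. 1"] by simp

end

primrec birkhoff_sum :: "('a stream \<Rightarrow> real) \<Rightarrow> nat \<Rightarrow> 'a stream \<Rightarrow> real" where
  "birkhoff_sum f 0 x = 0"
| "birkhoff_sum f (Suc n) x = f x + birkhoff_sum f n (stl x)"

locale shift_invariant_measure = borel_prob \<mu> for \<mu> :: "'a::finite stream measure" +
  assumes shift_inv: "distr \<mu> borel stl = \<mu>"
begin

lemma stl_measurable [measurable]: "stl \<in> measurable \<mu> borel"
  using measurable_stl by (simp add: measurable_def)

lemma integral_stl:
  fixes f :: "'a stream \<Rightarrow> real"
  assumes "integrable \<mu> f"
  shows "integrable \<mu> (\<lambda>x. f (stl x))" "(\<integral>x. f (stl x) \<partial>\<mu>) = (\<integral>x. f x \<partial>\<mu>)"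
proof -
  have f: "f \<in> borel_measurable borel" using assms by (auto simp: measurable_def dest!: borel_measurable_integrable)
  have "integrable (distr \<mu> borel stl) f" using assms shift_inv by simp
  then show "integrable \<mu> (\<lambda>x. f (stl x))" by (rule integrable_distr[OF stl_measurable])
  have "(\<integral>x. f (stl x) \<partial>\<mu>) = (\<integral>x. f x \<partial>distr \<mu> borel stl)" by (rule integral_distr[OF stl_measurable f, symmetric])
  then show "(\<integral>x. f (stl x) \<partial>\<mu>) = (\<integral>x. f x \<partial>\<mu>)" by (simp add: shift_inv)
qed

lemma integral_birkhoff_sum:
  assumes "integrable \<mu> f"
  shows "integrable \<mu> (birkhoff_sum f n)" "(\<integral>x. birkhoff_sum f n x \<partial>\<mu>) = real n * (\<integral>x. f x \<partial>\<mu>)"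
proof (induction n)
  case 0
  { case 1 show ?case by simp next case 2 show ?case by simp }
next
  case (Suc n)
  { case 1 show ?case using assms integral_stl(1)[OF Suc(1)] by simp
  next case 2 show ?case using assms integral_stl[OF Suc(1)] Suc(2) by (simp add: algebra_simps) }
qed

lemma measure_sdrop:
  assumes "B \<in> sets borel" shows "{x. sdrop n x \<in> B} \<in> sets borel" "measure \<mu> {x. sdrop n x \<in> B} = measure \<mu> B"
proof (induction n)
  case 0
  { case 1 show ?case using assms by simp next case 2 show ?case by simp }
next
  case (Suc n)
  have eq: "{x. sdrop (Suc n) x \<in> B} = stl -` {x. sdrop n x \<in> B} \<inter> space \<mu>" by auto
  { case 1 show ?case unfolding eq using measurable_sets[OF stl_measurable Suc(1)] by simp
  next case 2 
    have "measure \<mu> {x. sdrop (Suc n) x \<in> B} = measure (distr \<mu> borel stl) {x. sdrop n x \<in> B}"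
      unfolding eq by (rule measure_distr[symmetric, OF stl_measurable Suc(1)])
    then show ?case by (simp add: shift_inv Suc(2)) }
qed

end

lemma funpow_stl: "stl ^^ n = sdrop n"
proof
  fix x :: "'a stream" show "(stl ^^ n) x = sdrop n x"
    by (induction n arbitrary: x) (simp_all del: funpow.simps add: funpow_Suc_right)
qed

section \<open>Itineraries through a finite partition\<close>

definition part_of :: "'a stream set set \<Rightarrow> 'a stream \<Rightarrow> 'a stream set" where
  "part_of P x = (THE B. B \<in> P \<and> x \<in> B)"

primrec itinerary :: "'a stream set set \<Rightarrow> nat \<Rightarrow> 'a stream \<Rightarrow> 'a stream set list" where
  "itinerary P 0 x = []"
| "itinerary P (Suc n) x = part_of P x # itinerary P n (stl x)"

definition labels :: "'a stream set set \<Rightarrow> nat \<Rightarrow> 'a stream set list set" where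
  "labels P n = {xs. set xs \<subseteq> P \<and> length xs = n}"

lemma finite_labels: "finite P \<Longrightarrow> finite (labels P n)"
  unfolding labels_def by (rule finite_lists_length_eq)

lemma labels_0: "labels P 0 = {[]}" by (auto simp: labels_def)

lemma labels_Suc: "labels P (Suc n) = (\<lambda>(B, xs). B # xs) ` (P \<times> labels P n)"
  by (auto simp: labels_def length_Suc_conv image_iff)

lemma sum_labels_Suc:
  "(\<Sum>xs\<in>labels P (Suc n). g xs) = (\<Sum>B\<in>P. \<Sum>xs\<in>labels P n. g (B # xs) :: real)"
  unfolding labels_Suc by (subst sum.reindex) (auto simp: inj_on_def sum.cartesian_product split_def)

lemma partition_part_of:
  assumes "finite_partition P"
  shows "part_of P x \<in> P" "x \<in> part_of P x" "B \<in> P \<Longrightarrow> x \<in> B \<Longrightarrow> part_of P x = B"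
proof -
  have "\<exists>!B. B \<in> P \<and> x \<in> B"
  proof (rule ex_ex1I)
    have "\<Union>P = UNIV" using assms by (simp add: finite_partition_def partition_on_def)
    then show "\<exists>B. B \<in> P \<and> x \<in> B" by blast
    have dj: "disjoint P" using assms by (simp add: finite_partition_def partition_on_def)
    show "B = B'" if "B \<in> P \<and> x \<in> B" "B' \<in> P \<and> x \<in> B'" for B B'
    proof (rule ccontr)
      assume "B \<noteq> B'"
      then have "B \<inter> B' = {}" using disjointD[OF dj] that by simp
      then show False using that by auto
    qed
  qed
  note ex1 = this
  have in_part: "part_of P x \<in> P \<and> x \<in> part_of P x" unfolding part_of_def using ex1 by (rule theI')
  then show "part_of P x \<in> P" "x \<in> part_of P x" by blast+
  show "part_of P x = B" if "B \<in> P" "x \<in> B"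
    unfolding part_of_def by (rule the1_equality[OF ex1]) (use that in blast)
qed

lemma part_of_eq_iff: "finite_partition P \<Longrightarrow> B \<in> P \<Longrightarrow> part_of P x = B \<longleftrightarrow> x \<in> B"
  using partition_part_of by metis

lemma itinerary_in_labels: "finite_partition P \<Longrightarrow> itinerary P n x \<in> labels P n"
  by (induction n arbitrary: x) (auto simp: labels_0 labels_Suc partition_part_of)

lemma itinerary_add: "itinerary P (m + n) x = itinerary P m x @ itinerary P n (sdrop m x)"
  by (induction m arbitrary: x) auto

lemma length_itinerary [simp]: "length (itinerary P n x) = n"
  by (induction n arbitrary: x) auto

lemma itinerary_nth: "i < n \<Longrightarrow> itinerary P n x ! i = part_of P (sdrop i x)"
proof (induction n arbitrary: x i)
  case (Suc n) then show ?case by (cases i) auto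
qed simp

lemma itinerary_sets:
  assumes P: "finite_partition P" and "s \<in> labels P n"
  shows "{x :: 'a::finite stream. itinerary P n x = s} \<in> sets borel"
  using assms(2)
proof (induction n arbitrary: s)
  case (Suc n)
  then obtain B xs where s: "s = B # xs" "B \<in> P" "xs \<in> labels P n" by (auto simp: labels_Suc)
  have "{x. itinerary P (Suc n) x = s} = B \<inter> (stl -` {x. itinerary P n x = xs} \<inter> space borel)"
    using s by (auto simp: part_of_eq_iff[OF P])
  moreover have "B \<in> sets borel" using P s(2) by (auto simp: finite_partition_def)
  ultimately show ?case using measurable_sets[OF measurable_stl Suc.IH[OF s(3)]] by auto
qed (simp add: labels_0)

text \<open>
  The cells of the refined partition are the level sets of the itinerary; label lists that are not
  itineraries all give the empty cell.
\<close>

lemma refined_partition_eq: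
  assumes P: "finite_partition P"
  shows "refined_partition P n = (\<lambda>xs. {x. itinerary P n x = xs}) ` labels P n"
proof -
  have eq: "(\<Inter>i<n. (stl ^^ i) -` A i) = {x. itinerary P n x = map A [0..<n]}" if "\<forall>i<n. A i \<in> P" for A
    using that by (auto simp: list_eq_iff_nth_eq itinerary_nth funpow_stl part_of_eq_iff[OF P])
  show ?thesis
  proof (intro equalityI subsetI)
    fix B assume "B \<in> refined_partition P n"
    then obtain A where A: "B = (\<Inter>i<n. (stl ^^ i) -` A i)" "\<forall>i<n. A i \<in> P"
      by (auto simp: refined_partition_def)
    moreover have "map A [0..<n] \<in> labels P n" using A(2) by (auto simp: labels_def)
    ultimately show "B \<in> (\<lambda>xs. {x. itinerary P n x = xs}) ` labels P n" using eq[OF A(2)] by blast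
  next
    fix B assume "B \<in> (\<lambda>xs. {x. itinerary P n x = xs}) ` labels P n"
    then obtain xs where xs: "xs \<in> labels P n" "B = {x. itinerary P n x = xs}" by blast
    then have A: "\<forall>i<n. xs ! i \<in> P" by (auto simp: labels_def)
    moreover have "map ((!) xs) [0..<n] = xs" using xs(1) by (auto simp: labels_def map_nth)
    ultimately have "B = (\<Inter>i<n. (stl ^^ i) -` (xs ! i))" using eq[OF A] xs(2) by simp
    then show "B \<in> refined_partition P n" using A unfolding refined_partition_def by blast
  qed
qed

context borel_prob
begin

definition label_prob :: "'a stream set set \<Rightarrow> nat \<Rightarrow> 'a stream set list \<Rightarrow> real" where
  "label_prob P n s = measure \<mu> {x. itinerary P n x = s}"

lemma sum_label_prob:
  assumes P: "finite_partition P" shows "(\<Sum>s\<in>labels P n. label_prob P n s) = 1"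
  unfolding label_prob_def using P
  by (intro finite_valued_sum finite_labels itinerary_in_labels itinerary_sets) (auto simp: finite_partition_def)

lemma integral_label:
  assumes P: "finite_partition P"
  shows "integrable \<mu> (\<lambda>x. G (itinerary P n x) :: real)"
    "(\<integral>x. G (itinerary P n x) \<partial>\<mu>) = (\<Sum>s\<in>labels P n. label_prob P n s * G s)"
  unfolding label_prob_def using P
  by (intro finite_valued_integral finite_labels itinerary_in_labels itinerary_sets; auto simp: finite_partition_def)+

lemma partition_entropy_refined:
  assumes P: "finite_partition P"
  shows "partition_entropy \<mu> (refined_partition P n) = - (\<Sum>s\<in>labels P n. label_prob P n s * ln (label_prob P n s))"
proof -
  have "finite (labels P n)" using P by (intro finite_labels) (simp add: finite_partition_def)
  moreover have "measure \<mu> {x. itinerary P n x = s} = 0"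
    if "s \<noteq> t" "{x. itinerary P n x = s} = {x. itinerary P n x = t}" for s t
  proof -
    have "{x. itinerary P n x = s} = {}" using that by blast
    then show ?thesis by simp
  qed
  ultimately show ?thesis
    unfolding partition_entropy_def refined_partition_eq[OF P] label_prob_def
    by (subst sum.reindex_nontrivial) (simp_all add: comp_def)
qed

text \<open>
  Every upper bound for an entropy below comes from this inequality: any choice of trial weights
  \<open>q\<close> on the label lists gives one.
\<close>

lemma partition_entropy_le:
  assumes P: "finite_partition P" 
    and q: "\<And>s. s \<in> labels P n \<Longrightarrow> 0 \<le> q s" "(\<Sum>s\<in>labels P n. q s) \<le> 1" 
      "\<And>s. s \<in> labels P n \<Longrightarrow> q s = 0 \<Longrightarrow> label_prob P n s = 0"
  shows "partition_entropy \<mu> (refined_partition P n) \<le> - (\<Sum>s\<in>labels P n. label_prob P n s * ln (q s))"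
  unfolding partition_entropy_refined[OF P]
  using P q by (intro gibbs_inequality sum_label_prob finite_labels) (auto simp: finite_partition_def label_prob_def)

lemma partition_entropy_nonneg:
  assumes P: "finite_partition P" shows "0 \<le> partition_entropy \<mu> (refined_partition P n)"
proof -
  have "label_prob P n s * ln (label_prob P n s) \<le> 0" for s
    by (cases "label_prob P n s = 0") (auto simp: label_prob_def mult_le_0_iff less_le)
  then have "(\<Sum>s\<in>labels P n. label_prob P n s * ln (label_prob P n s)) \<le> 0" by (intro sum_nonpos)
  then show ?thesis by (simp add: partition_entropy_refined[OF P])
qed

end

text \<open>
  For fixed \<open>N\<close> write $n = qN + s$ with $s < N$; then $u(n) \le q\,u(N) + \max_{s<N} u(s)$.
\<close>

lemma fekete:
  fixes u :: "nat \<Rightarrow> real"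
  assumes sub: "\<And>m n. u (m + n) \<le> u m + u n" and nonneg: "\<And>n. 0 \<le> u n"
  shows "convergent (\<lambda>n. u n / real n)"
proof -
  define L where "L = (INF n\<in>{1..}. u n / real n)"
  have bdd: "bdd_below ((\<lambda>n. u n / real n) ` {1..})" using nonneg by (intro bdd_belowI[of _ 0]) auto
  have "(\<lambda>n. u n / real n) \<longlonglongrightarrow> L"
  proof (rule LIMSEQ_I)
    fix e :: real assume e: "e > 0"
    have "\<exists>N\<in>{1..}. u N / real N < L + e / 2"
      using e cINF_less_iff[OF _ bdd, of "L + e / 2"] by (simp add: L_def)
    then obtain N where N: "1 \<le> N" "u N / real N < L + e / 2" by auto
    define B where "B = Max (u ` {..<N})"
    have B: "u s \<le> B" if "s < N" for s unfolding B_def using that by (intro Max_ge) auto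
    have mult: "u (q * N + s) \<le> real q * u N + u s" for q s
    proof (induction q)
      case (Suc q)
      have "u (Suc q * N + s) \<le> u N + u (q * N + s)" using sub[of N "q * N + s"] by (simp add: add.assoc)
      then show ?case using Suc by (simp add: algebra_simps)
    qed simp
    have "(\<lambda>n. B / real n) \<longlonglongrightarrow> 0" by (rule lim_const_over_n)
    then have "\<forall>\<^sub>F n in sequentially. B / real n < e / 2" using e by (intro order_tendstoD) auto
    then obtain n0 where n0: "\<And>n. n \<ge> n0 \<Longrightarrow> B / real n < e / 2" by (auto simp: eventually_sequentially)
    show "\<exists>no. \<forall>n\<ge>no. norm (u n / real n - L) < e"
    proof (intro exI[of _ "max 1 n0"] allI impI)
      fix n assume n: "max 1 n0 \<le> n"
      have low: "L \<le> u n / real n" unfolding L_def using n by (intro cINF_lower bdd) auto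
      have "u n \<le> real (n div N) * u N + B"
        using mult[of "n div N" "n mod N"] B[of "n mod N"] N by simp
      also have "real (n div N) * u N \<le> real n / real N * u N"
      proof -
        have "real (n div N) * real N \<le> real n"
          unfolding of_nat_mult[symmetric] of_nat_le_iff by (rule div_times_less_eq_dividend)
        then have "real (n div N) \<le> real n / real N" using N by (simp add: field_simps)
        then show ?thesis using nonneg[of N] by (intro mult_right_mono)
      qed
      finally have "u n / real n \<le> u N / real N + B / real n" using n N by (simp add: field_simps)
      moreover have "B / real n < e / 2" by (rule n0) (use n in simp)
      ultimately have "u n / real n < L + e" using N(2) by linarith
      then show "norm (u n / real n - L) < e" using low by simp
    qed
  qed
  then show ?thesis by (rule convergentI)
qed

context shift_invariant_measure
begin

text \<open>
  The trial weights are the product of the distributions of the first \<open>m\<close> and the last \<open>n\<close>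
  labels; by invariance the last labels are distributed as an itinerary of length \<open>n\<close>.
\<close>

lemma partition_entropy_subadditive:
  assumes P: "finite_partition P"
  shows "partition_entropy \<mu> (refined_partition P (m + n))
    \<le> partition_entropy \<mu> (refined_partition P m) + partition_entropy \<mu> (refined_partition P n)"
proof -
  have fin: "finite (labels P k)" for k using P by (intro finite_labels) (simp add: finite_partition_def)
  define q where "q s = label_prob P m (take m s) * label_prob P n (drop m s)" for s
  have split: "take m s \<in> labels P m" "drop m s \<in> labels P n" if "s \<in> labels P (m + n)" for s
    using that set_take_subset[of m s] set_drop_subset[of m s] by (auto simp: labels_def)
  have "(\<Sum>s\<in>labels P (m + n). q s)
      = (\<Sum>(a, b)\<in>(\<lambda>s. (take m s, drop m s)) ` labels P (m + n). label_prob P m a * label_prob P n b)"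
    unfolding q_def
    by (subst sum.reindex) (auto simp: inj_on_def comp_def, metis append_take_drop_id)
  also have "\<dots> \<le> (\<Sum>(a, b)\<in>labels P m \<times> labels P n. label_prob P m a * label_prob P n b)"
    using split by (intro sum_mono2) (auto simp: fin label_prob_def)
  also have "\<dots> = (\<Sum>a\<in>labels P m. label_prob P m a) * (\<Sum>b\<in>labels P n. label_prob P n b)"
    by (simp add: sum_product sum.cartesian_product)
  also have "\<dots> = 1" using P by (simp add: sum_label_prob)
  finally have q1: "(\<Sum>s\<in>labels P (m + n). q s) \<le> 1" .
  have le1: "label_prob P (m + n) s \<le> label_prob P m (take m s)" if "s \<in> labels P (m + n)" for s
    unfolding label_prob_def using split[OF that]
    by (intro finite_measure_mono) (auto simp: itinerary_add itinerary_sets[OF P])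
  have le2: "label_prob P (m + n) s \<le> label_prob P n (drop m s)" if "s \<in> labels P (m + n)" for s
  proof -
    have B: "{x. itinerary P n x = drop m s} \<in> sets borel" using split[OF that] by (intro itinerary_sets P)
    have "label_prob P (m + n) s \<le> measure \<mu> {x. sdrop m x \<in> {x. itinerary P n x = drop m s}}"
      unfolding label_prob_def using measure_sdrop(1)[OF B]
      by (intro finite_measure_mono) (auto simp: itinerary_add)
    then show ?thesis unfolding measure_sdrop(2)[OF B] label_prob_def .
  qed
  have pos: "0 \<le> label_prob P k s" for k s by (simp add: label_prob_def)
  have "partition_entropy \<mu> (refined_partition P (m + n))
      \<le> - (\<Sum>s\<in>labels P (m + n). label_prob P (m + n) s * ln (q s))"
  proof (rule partition_entropy_le[OF P _ q1])
    fix s assume s: "s \<in> labels P (m + n)"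
    show "0 \<le> q s" by (simp add: q_def pos)
    assume "q s = 0"
    then show "label_prob P (m + n) s = 0"
      using le1[OF s] le2[OF s] pos[of "m + n" s] by (auto simp: q_def)
  qed
  also have "\<dots> = - (\<Sum>s\<in>labels P (m + n). label_prob P (m + n) s *
      (ln (label_prob P m (take m s)) + ln (label_prob P n (drop m s))))"
  proof (intro arg_cong[where f = uminus] sum.cong refl)
    fix s assume s: "s \<in> labels P (m + n)"
    show "label_prob P (m + n) s * ln (q s) = label_prob P (m + n) s *
      (ln (label_prob P m (take m s)) + ln (label_prob P n (drop m s)))"
    proof (cases "label_prob P (m + n) s = 0")
      case False
      then have "0 < label_prob P m (take m s)" "0 < label_prob P n (drop m s)"
        using le1[OF s] le2[OF s] pos[of "m + n" s] by (auto simp: less_le)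
      then show ?thesis by (simp add: q_def ln_mult_pos)
    qed simp
  qed
  also have "\<dots> = - (\<integral>x. ln (label_prob P m (take m (itinerary P (m + n) x)))
      + ln (label_prob P n (drop m (itinerary P (m + n) x))) \<partial>\<mu>)"
    by (subst integral_label(2)[OF P, where G = "\<lambda>s. ln (label_prob P m (take m s)) + ln (label_prob P n (drop m s))"]) simp
  also have "\<dots> = - (\<integral>x. ln (label_prob P m (itinerary P m x))
      + ln (label_prob P n (itinerary P n (sdrop m x))) \<partial>\<mu>)"
    by (simp add: itinerary_add)
  also have "\<dots> = - (\<integral>x. ln (label_prob P m (itinerary P m x)) \<partial>\<mu>)
      - (\<integral>x. ln (label_prob P n (itinerary P n x)) \<partial>\<mu>)"
  proof -
    have *: "integrable \<mu> (\<lambda>x. ln (label_prob P k (itinerary P k x)))" for k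
      by (rule integral_label(1)[OF P])
    have "integrable \<mu> (\<lambda>x. ln (label_prob P n (itinerary P n (sdrop m x)))) \<and>
      (\<integral>x. ln (label_prob P n (itinerary P n (sdrop m x))) \<partial>\<mu>) = (\<integral>x. ln (label_prob P n (itinerary P n x)) \<partial>\<mu>)" for m
      by (induction m) (simp_all add: * integral_stl[of "\<lambda>x. ln (label_prob P n (itinerary P n (sdrop _ x)))"])
    then show ?thesis by (simp add: *)
  qed
  finally show ?thesis
    unfolding partition_entropy_refined[OF P]
      integral_label(2)[OF P, of "\<lambda>s. ln (label_prob P m s)"]
      integral_label(2)[OF P, of "\<lambda>s. ln (label_prob P n s)"] by simp
qed

lemma entropy_rate_convergent:
  assumes "finite_partition P"
  shows "convergent (\<lambda>n. partition_entropy \<mu> (refined_partition P n) / real n)"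
  using assms by (intro fekete partition_entropy_subadditive partition_entropy_nonneg)

lemma entropy_rate_limit:
  assumes "finite_partition P"
  obtains h where "(\<lambda>n. partition_entropy \<mu> (refined_partition P n) / real n) \<longlonglongrightarrow> h"
    "lim (\<lambda>n. ereal (partition_entropy \<mu> (refined_partition P n) / real n)) = ereal h"
proof -
  obtain h where h: "(\<lambda>n. partition_entropy \<mu> (refined_partition P n) / real n) \<longlonglongrightarrow> h"
    using entropy_rate_convergent[OF assms] by (auto simp: convergent_def)
  then have "(\<lambda>n. ereal (partition_entropy \<mu> (refined_partition P n) / real n)) \<longlonglongrightarrow> ereal h" by simp
  then show thesis using h that by (blast dest: limI)
qed

end

section \<open>The variational principle\<close>

context borel_prob
begin

text \<open>
  The sets that can be approximated form a $\sigma$-algebra: a countable union is first replaced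
  by a finite one.
\<close>

lemma clopen_approx:
  assumes "B \<in> sets borel" "e > 0"
  shows "\<exists>A\<in>clopens. measure \<mu> ((A - B) \<union> (B - A)) < e"
proof -
  interpret clo: algebra UNIV "clopens :: 'a stream set set" by (rule algebra_clopens)
  have clo_sets: "A \<in> sets borel" if "A \<in> clopens" for A :: "'a stream set"
    using open_clopens[OF that] by simp
  have "B \<in> sigma_sets UNIV clopens" unfolding sigma_sets_clopens by (rule assms(1))
  then show ?thesis using assms(2)
  proof (induction arbitrary: e)
    case (Basic a) then show ?case by (intro bexI[of _ a]) auto
  next
    case Empty then show ?case by (intro bexI[of _ "{}"]) auto
  next
    case (Compl a)
    then obtain A where A: "A \<in> clopens" "measure \<mu> ((A - a) \<union> (a - A)) < e" by blast
    have "((UNIV - A) - (UNIV - a)) \<union> ((UNIV - a) - (UNIV - A)) = (A - a) \<union> (a - A)" by blast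
    then show ?case using A by (intro bexI[of _ "UNIV - A"] clo.compl_sets) auto
  next
    case (Union a)
    have a: "a i \<in> sets borel" for i using Union(1)[of i] unfolding sigma_sets_clopens .
    have "(\<lambda>n. measure \<mu> (\<Union>i<n. a i)) \<longlonglongrightarrow> measure \<mu> (\<Union>n. \<Union>i<n. a i)"
      using a by (intro finite_Lim_measure_incseq incseq_SucI) (auto simp: less_Suc_eq)
    moreover have U: "(\<Union>n. \<Union>i<n. a i) = (\<Union>i. a i)" by auto
    ultimately have "\<forall>\<^sub>F n in sequentially. measure \<mu> (\<Union>i. a i) - e / 2 < measure \<mu> (\<Union>i<n. a i)"
      using \<open>e > 0\<close> by (intro order_tendstoD) auto
    then obtain N where N: "measure \<mu> (\<Union>i. a i) - e / 2 < measure \<mu> (\<Union>i<N. a i)"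
      by (auto simp: eventually_sequentially)
    define d where "d = e / (2 * (real N + 1))"
    have d: "0 < d" using \<open>e > 0\<close> by (simp add: d_def)
    obtain A where A: "\<And>i. A i \<in> clopens" "\<And>i. measure \<mu> ((A i - a i) \<union> (a i - A i)) < d"
      using Union(2) d by metis
    define D where "D i = (A i - a i) \<union> (a i - A i)" for i
    have Ds: "D i \<in> sets borel" for i unfolding D_def using a A(1)[THEN clo_sets] by auto
    have AU: "(\<Union>i<N. A i) \<in> clopens" using A(1) by (intro clo.finite_UN) auto
    have aU: "(\<Union>i. a i) \<in> sets borel" "(\<Union>i<N. a i) \<in> sets borel" using a by auto
    have "measure \<mu> (((\<Union>i<N. A i) - (\<Union>i. a i)) \<union> ((\<Union>i. a i) - (\<Union>i<N. A i)))
        \<le> measure \<mu> (((\<Union>i. a i) - (\<Union>i<N. a i)) \<union> (\<Union>i<N. D i))"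
      using aU Ds by (intro finite_measure_mono) (auto simp: D_def)
    also have "\<dots> \<le> measure \<mu> ((\<Union>i. a i) - (\<Union>i<N. a i)) + measure \<mu> (\<Union>i<N. D i)"
      using aU Ds by (intro measure_Un_le) auto
    also have "measure \<mu> ((\<Union>i. a i) - (\<Union>i<N. a i)) = measure \<mu> (\<Union>i. a i) - measure \<mu> (\<Union>i<N. a i)"
      using aU by (intro finite_measure_Diff) auto
    also have "measure \<mu> (\<Union>i<N. D i) \<le> (\<Sum>i<N. measure \<mu> (D i))"
      using Ds by (intro finite_measure_subadditive_finite) auto
    also have "\<dots> \<le> (\<Sum>i<N. d)" using A(2) by (intro sum_mono) (auto simp: D_def intro: less_imp_le)
    also have "\<dots> = real N * d" by simp
    also have "\<dots> \<le> e / 2" using \<open>e > 0\<close> by (simp add: d_def field_simps)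
    finally have "measure \<mu> (((\<Union>i<N. A i) - (\<Union>i. a i)) \<union> ((\<Union>i. a i) - (\<Union>i<N. A i))) < e"
      using N by linarith
    then show ?case using AU by blast
  qed
qed

text \<open>
  Approximate each member by a clopen set and let \<open>b v\<close> be the member whose approximation contains
  the cylinder of \<open>v\<close>. It is the right member outside the approximation errors.
\<close>

lemma partition_approx:
  assumes P: "finite_partition P" and "\<delta> > 0"
  obtains k b where "{x. part_of P x \<noteq> b (stake k x)} \<in> sets borel" "measure \<mu> {x. part_of P x \<noteq> b (stake k x)} < \<delta>"
proof -
  have fin: "finite P" and PB: "\<And>B. B \<in> P \<Longrightarrow> B \<in> sets borel" using P by (auto simp: finite_partition_def)
  have "part_of P undefined \<in> P" using partition_part_of(1)[OF P] .
  then have card: "0 < card P" using fin card_gt_0_iff by blast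
  then have "\<delta> / card P > 0" using \<open>\<delta> > 0\<close> by simp
  then obtain A where A: "\<And>B. B \<in> P \<Longrightarrow> A B \<in> clopens" "\<And>B. B \<in> P \<Longrightarrow> measure \<mu> ((A B - B) \<union> (B - A B)) < \<delta> / card P"
  proof -
    have "\<forall>B\<in>P. \<exists>A. A \<in> clopens \<and> measure \<mu> ((A - B) \<union> (B - A)) < \<delta> / card P"
      using clopen_approx[OF PB \<open>\<delta> / card P > 0\<close>] by blast
    then show thesis using that by (auto dest!: bchoice)
  qed
  obtain N where N: "\<And>B. B \<in> P \<Longrightarrow> \<forall>m\<ge>N B. \<forall>x y. stake m x = stake m y \<longrightarrow> (x \<in> A B \<longleftrightarrow> y \<in> A B)"
    using clopensD[OF A(1)] by metis
  define k where "k = Max (N ` P)"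
  have k: "x \<in> A B \<longleftrightarrow> stake k x @- undefined \<in> A B" if "B \<in> P" for x B
  proof -
    have "N B \<le> k" unfolding k_def using fin that by (intro Max_ge) auto
    moreover have "stake k x = stake k (stake k x @- undefined)" by (simp add: stake_shift)
    ultimately show ?thesis using N[OF that] by blast
  qed
  define b where "b v = (THE B. B \<in> P \<and> v @- undefined \<in> A B)" for v
  have good: "part_of P x = b (stake k x)" if x: "\<And>B. B \<in> P \<Longrightarrow> x \<in> A B \<longleftrightarrow> x \<in> B" for x
  proof -
    have "b (stake k x) = (THE B. B \<in> P \<and> x \<in> B)"
      unfolding b_def using k x by (intro arg_cong[where f = The] ext) blast
    then show ?thesis by (simp add: part_of_def)
  qed
  let ?E = "{x. part_of P x \<noteq> b (stake k x)}"
  have "?E = (\<Union>B\<in>P. \<Union>v\<in>{v. length v = k \<and> b v \<noteq> B}. B \<inter> cyl v)"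
  proof (intro equalityI subsetI)
    fix x assume "x \<in> ?E"
    then show "x \<in> (\<Union>B\<in>P. \<Union>v\<in>{v. length v = k \<and> b v \<noteq> B}. B \<inter> cyl v)"
      using partition_part_of(1,2)[OF P, of x]
      by (intro UN_I[of "part_of P x"] UN_I[of "stake k x"]) (auto simp: cyl_def)
  next
    fix x assume "x \<in> (\<Union>B\<in>P. \<Union>v\<in>{v. length v = k \<and> b v \<noteq> B}. B \<inter> cyl v)"
    then obtain B v where Bv: "B \<in> P" "x \<in> B" "length v = k" "b v \<noteq> B" "x \<in> cyl v" by blast
    then have "stake k x = v" by (simp add: cyl_def)
    then show "x \<in> ?E" using partition_part_of(3)[OF P Bv(1,2)] Bv(4) by simp
  qed
  also have "\<dots> \<in> sets borel"
    using fin PB by (intro sets.finite_UN sets.Int) (auto intro!: finite_subset[OF _ finite_words[of k]])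
  finally have E: "?E \<in> sets borel" .
  define D where "D B = (A B - B) \<union> (B - A B)" for B
  have D: "D B \<in> sets borel" if "B \<in> P" for B
    unfolding D_def using PB[OF that] A(1)[OF that, THEN open_clopens] by auto
  have "measure \<mu> ?E \<le> measure \<mu> (\<Union>B\<in>P. D B)"
    using D fin good by (intro finite_measure_mono) (auto simp: D_def)
  also have "\<dots> \<le> (\<Sum>B\<in>P. measure \<mu> (D B))"
    using D fin by (intro finite_measure_subadditive_finite) auto
  also have "\<dots> < (\<Sum>B\<in>P. \<delta> / card P)"
    using A(2) fin card by (intro sum_strict_mono) (auto simp: D_def)
  also have "\<dots> = \<delta>" using card by simp
  finally show thesis using that E by blast
qed

end

text \<open>
  With \<open>\<kappa>\<close> as transition probabilities, the probability that a channel which reads the word \<open>u\<close>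
  through a sliding window of length \<open>k\<close> emits the given list.
\<close>

primrec channel_weight :: "('a list \<Rightarrow> 'b \<Rightarrow> real) \<Rightarrow> nat \<Rightarrow> 'b list \<Rightarrow> 'a list \<Rightarrow> real" where
  "channel_weight \<kappa> k [] u = 1"
| "channel_weight \<kappa> k (B # xs) u = \<kappa> (take k u) B * channel_weight \<kappa> k xs (tl u)"

lemma channel_weight_pos: "(\<And>v B. 0 < \<kappa> v B) \<Longrightarrow> 0 < channel_weight \<kappa> k xs u"
  by (induction xs arbitrary: u) auto

lemma sum_channel_weight:
  assumes "\<And>v B. 0 < \<kappa> v B" "\<And>v. (\<Sum>B\<in>P. \<kappa> v B) \<le> 1"
  shows "(\<Sum>xs\<in>labels P n. channel_weight \<kappa> k xs u) \<le> 1"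
proof (induction n arbitrary: u)
  case (Suc n)
  have "(\<Sum>xs\<in>labels P (Suc n). channel_weight \<kappa> k xs u)
      = (\<Sum>B\<in>P. \<kappa> (take k u) B) * (\<Sum>xs\<in>labels P n. channel_weight \<kappa> k xs (tl u))"
    by (simp add: sum_labels_Suc sum_product)
  also have "\<dots> \<le> 1 * 1"
    using assms Suc
    by (intro mult_mono sum_nonneg less_imp_le[OF channel_weight_pos] less_imp_le[OF assms(1)]) simp_all
  finally show ?case by simp
qed (simp add: labels_0)

lemma ln_channel_weight_itinerary:
  assumes "\<And>v B. 0 < \<kappa> v B"
  shows "ln (channel_weight \<kappa> k (itinerary P n x) (stake (n + k) x))
    = birkhoff_sum (\<lambda>x. ln (\<kappa> (stake k x) (part_of P x))) n x"
proof (induction n arbitrary: x)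
  case (Suc n)
  have "take k (stake (Suc n + k) x) = stake k x" by (simp only: take_stake) simp
  then show ?case using Suc by (simp add: ln_mult_pos assms channel_weight_pos)
qed simp

context log_holder_jacobian
begin

lemma ln_J_lip: "lip (\<lambda>x. ln (J x))"
  using var_bound_rho_imp[OF ln_J] C_pos by (auto intro: lipI)

lemma ln_J_continuous: "continuous_on UNIV (\<lambda>x. ln (J x))"
  by (rule lip_continuous[OF ln_J_lip])

lemma lip_stl: assumes "lip f" shows "lip (\<lambda>x. f (stl x))"
proof -
  obtain M where M: "0 \<le> M" "var_bound w M f" using assms by (rule lipE)
  define K where "K = M * Q"
  have K: "0 \<le> K" "var_bound (\<lambda>n. \<rho> ^ n) K f"
    using var_bound_imp_rho[OF M(2)] M(1) Q_pos by (auto simp: K_def)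
  have "var_bound (\<lambda>n. \<rho> ^ n) (K / \<rho>) (\<lambda>x. f (stl x))"
  proof (rule var_boundI)
    fix n and x y :: "'a stream" assume s: "stake n x = stake n y"
    show "\<bar>f (stl x) - f (stl y)\<bar> \<le> K / \<rho> * \<rho> ^ n"
    proof (cases n)
      case 0
      have "\<bar>f (stl x) - f (stl y)\<bar> \<le> K * 1" using var_bound_osc[OF K(2)] by simp
      also have "\<dots> \<le> K * (1 / \<rho>)" using rho_pos rho_less K(1) by (intro mult_left_mono) auto
      finally show ?thesis using 0 by simp
    next
      case (Suc m)
      then have "\<bar>f (stl x) - f (stl y)\<bar> \<le> K * \<rho> ^ m" using s by (intro var_boundD[OF K(2)]) simp
      then show ?thesis using Suc rho_pos by simp
    qed
  qed
  then have "var_bound w (K / \<rho> / w 0) (\<lambda>x. f (stl x))"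
    using K(1) rho_pos by (intro var_bound_rho_imp) auto
  then show ?thesis by (rule lipI)
qed

lemma ln_jac_prod_stake: "ln (jac_prod J (stake n x) (sdrop n x)) = birkhoff_sum (\<lambda>x. ln (J x)) n x"
  by (induction n arbitrary: x) (simp_all add: ln_mult_pos J_pos jac_prod_pos stake_sdrop)

lemma ln_jac_prod_birkhoff: "\<bar>ln (jac_prod J (stake n x) y) - birkhoff_sum (\<lambda>x. ln (J x)) n x\<bar> \<le> Q"
  using jac_prod_distortion[of 0 y "sdrop n x" "stake n x"] by (simp add: ln_jac_prod_stake)

text \<open>
  A partition need not be generated by cylinders, so its labels are only predicted, with a small
  error, from windows of \<open>k\<close> letters. The trial weight of a label list is the probability that a
  noisy channel emits it when it reads a random word drawn with the weights \<open>jac_prod\<close>. On the true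
  itinerary the word contributes the Birkhoff sum of \<open>ln J\<close>, up to the distortion \<open>Q\<close>, and the
  channel contributes at most \<open>\<eta>\<close> per letter.
\<close>

lemma partition_entropy_linear_bound:
  assumes "shift_invariant_measure \<nu>" and P: "finite_partition P" and "\<eta> > 0"
  shows "\<exists>K. \<forall>n. partition_entropy \<nu> (refined_partition P n) \<le> real n * (- (\<integral>x. ln (J x) \<partial>\<nu>) + \<eta>) + K"
proof -
  interpret shift_invariant_measure \<nu> by fact
  have fin: "finite P" using P by (simp add: finite_partition_def)
  have "part_of P undefined \<in> P" using partition_part_of(1)[OF P] .
  then have card: "1 \<le> card P" using fin by (metis One_nat_def Suc_leI card_gt_0_iff empty_iff)
  \<comment> \<open>A correct prediction costs $\eta/2$. A wrong one costs $-c$, which may be large, but its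
    frequency is below \<open>\<delta>\<close>.\<close>
  define \<epsilon> where "\<epsilon> = 1 - exp (- \<eta> / 2)"
  have \<epsilon>: "0 < \<epsilon>" "\<epsilon> < 1" using \<open>\<eta> > 0\<close> by (auto simp: \<epsilon>_def)
  define c where "c = ln (\<epsilon> / card P)"
  have "0 < \<epsilon> / card P" "\<epsilon> / card P \<le> 1" using \<epsilon> card by (auto simp: divide_le_eq)
  then have c: "c \<le> 0" by (simp add: c_def)
  define \<delta> where "\<delta> = \<eta> / (2 * (1 - c))"
  have \<delta>: "0 < \<delta>" using c \<open>\<eta> > 0\<close> by (simp add: \<delta>_def)
  obtain k b where E: "{x. part_of P x \<noteq> b (stake k x)} \<in> sets borel" "prob {x. part_of P x \<noteq> b (stake k x)} < \<delta>"
    using partition_approx[OF P \<delta>] by blast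
  define E where "E = {x. part_of P x \<noteq> b (stake k x)}"
  define \<kappa> where "\<kappa> v B = (if B = b v then 1 - \<epsilon> else \<epsilon> / card P)" for v B
  have \<kappa>_pos: "0 < \<kappa> v B" for v B using \<epsilon> card by (simp add: \<kappa>_def)
  have \<kappa>_sum: "(\<Sum>B\<in>P. \<kappa> v B) \<le> 1" for v
  proof -
    have "(\<Sum>B\<in>P. \<kappa> v B) \<le> (\<Sum>B\<in>P. (if B = b v then 1 - \<epsilon> else 0) + \<epsilon> / card P)"
      using \<epsilon> by (intro sum_mono) (auto simp: \<kappa>_def)
    also have "\<dots> = (if b v \<in> P then 1 - \<epsilon> else 0) + \<epsilon>" using fin card by (simp add: sum.distrib) force
    also have "\<dots> \<le> 1" using \<epsilon> by simp
    finally show ?thesis .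
  qed
  define g where "g x = ln (\<kappa> (stake k x) (part_of P x))" for x
  have g_eq: "g x = c * indicator E x + (- \<eta> / 2) * indicator (- E) x" for x
    by (auto simp: g_def \<kappa>_def c_def E_def \<epsilon>_def)
  have E': "E \<in> sets borel" "- E \<in> sets borel" using E by (auto simp: E_def Compl_eq_Diff_UNIV)
  have g_int: "integrable \<nu> g" unfolding g_eq[abs_def] using E'
    by (intro Bochner_Integration.integrable_add integrable_mult_right integrable_real_indicator) (auto simp: emeasure_eq_measure)
  have g_mean: "- \<eta> \<le> (\<integral>x. g x \<partial>\<nu>)"
  proof -
    have "(\<integral>x. g x \<partial>\<nu>) = c * prob E + (- \<eta> / 2) * prob (- E)"
      unfolding g_eq using E' by (subst Bochner_Integration.integral_add) (auto simp: emeasure_eq_measure)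
    moreover have "\<eta> / 2 * prob (- E) \<le> \<eta> / 2 * 1" using \<open>\<eta> > 0\<close> by (intro mult_left_mono) auto
    moreover have "(- c) * prob E \<le> (1 - c) * \<delta>" using E(2) c by (intro mult_mono) (auto simp: E_def)
    moreover have "(1 - c) * \<delta> = \<eta> / 2" using c by (simp add: \<delta>_def field_simps)
    ultimately show ?thesis by simp
  qed
  define z0 where "z0 = (undefined :: 'a stream)"
  define I where "I = (\<integral>x. ln (J x) \<partial>\<nu>)"
  have lnJ_int: "integrable \<nu> (\<lambda>x. ln (J x))" by (rule integrable_continuous[OF ln_J_continuous])
  have "partition_entropy \<nu> (refined_partition P n) \<le> real n * (- I + \<eta>) + (Q - real k * I)" for n
  proof -
    define q where "q xs = (\<Sum>u | length u = n + k. jac_prod J u z0 * channel_weight \<kappa> k xs u)" for xs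
    have q_pos: "0 < q xs" for xs
    proof -
      have "{u :: 'a list. length u = n + k} \<noteq> {}" using Ex_list_of_length by auto
      then show ?thesis unfolding q_def
        by (intro sum_pos finite_words mult_pos_pos jac_prod_pos channel_weight_pos \<kappa>_pos)
    qed
    have "(\<Sum>xs\<in>labels P n. q xs) = (\<Sum>u | length u = n + k. jac_prod J u z0 * (\<Sum>xs\<in>labels P n. channel_weight \<kappa> k xs u))"
      unfolding q_def sum_distrib_left by (rule sum.swap)
    also have "\<dots> \<le> (\<Sum>u | length u = n + k. jac_prod J u z0 * 1)"
      by (intro sum_mono mult_left_mono sum_channel_weight \<kappa>_pos \<kappa>_sum less_imp_le[OF jac_prod_pos])
    also have "\<dots> = 1" by (simp add: sum_jac_prod)
    finally have q_sum: "(\<Sum>xs\<in>labels P n. q xs) \<le> 1" .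
    have q_ge: "birkhoff_sum (\<lambda>x. ln (J x)) (n + k) x - Q + birkhoff_sum g n x \<le> ln (q (itinerary P n x))" for x
    proof -
      have "jac_prod J (stake (n + k) x) z0 * channel_weight \<kappa> k (itinerary P n x) (stake (n + k) x) \<le> q (itinerary P n x)"
        unfolding q_def
        by (intro member_le_sum[where f = "\<lambda>u. jac_prod J u z0 * channel_weight \<kappa> k (itinerary P n x) u"])
          (auto simp: finite_words intro!: less_imp_le mult_pos_pos jac_prod_pos channel_weight_pos \<kappa>_pos)
      then have "ln (jac_prod J (stake (n + k) x) z0 * channel_weight \<kappa> k (itinerary P n x) (stake (n + k) x)) \<le> ln (q (itinerary P n x))"
        by (subst ln_le_cancel_iff) (auto intro!: mult_pos_pos jac_prod_pos channel_weight_pos \<kappa>_pos q_pos)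
      moreover have "ln (jac_prod J (stake (n + k) x) z0 * channel_weight \<kappa> k (itinerary P n x) (stake (n + k) x))
          = ln (jac_prod J (stake (n + k) x) z0) + birkhoff_sum g n x"
      proof -
        have "birkhoff_sum g n x = ln (channel_weight \<kappa> k (itinerary P n x) (stake (n + k) x))"
          unfolding g_def[abs_def] by (rule ln_channel_weight_itinerary[OF \<kappa>_pos, symmetric])
        then show ?thesis by (simp only: ln_mult_pos jac_prod_pos channel_weight_pos \<kappa>_pos)
      qed
      ultimately show ?thesis using ln_jac_prod_birkhoff[of "n + k" x z0] by (simp add: abs_le_iff)
    qed
    have "partition_entropy \<nu> (refined_partition P n) \<le> - (\<Sum>s\<in>labels P n. label_prob P n s * ln (q s))"
      using q_pos by (intro partition_entropy_le[OF P _ q_sum]) (auto intro: less_imp_le simp: less_le)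
    also have "\<dots> = - (\<integral>x. ln (q (itinerary P n x)) \<partial>\<nu>)"
      by (subst integral_label(2)[OF P, of "\<lambda>s. ln (q s)"]) simp
    also have "\<dots> \<le> - (\<integral>x. birkhoff_sum (\<lambda>x. ln (J x)) (n + k) x - Q + birkhoff_sum g n x \<partial>\<nu>)"
      using integral_birkhoff_sum(1)[OF lnJ_int] integral_birkhoff_sum(1)[OF g_int] q_ge
      by (intro le_imp_neg_le integral_mono integral_label(1)[OF P, of "\<lambda>s. ln (q s)"]) auto
    also have "\<dots> = - (real (n + k) * I) + Q - real n * (\<integral>x. g x \<partial>\<nu>)"
      using integral_birkhoff_sum[OF lnJ_int] integral_birkhoff_sum[OF g_int] by (simp add: I_def)
    also have "\<dots> \<le> - (real (n + k) * I) + Q + real n * \<eta>"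
      using mult_left_mono[OF g_mean, of "real n"] by simp
    finally show ?thesis by (simp add: algebra_simps)
  qed
  then show ?thesis unfolding I_def by blast
qed

text \<open>
  The bound for itineraries of length \<open>n\<close>, divided by \<open>n\<close>, for every partition and every error \<open>\<eta>\<close>.
\<close>

theorem ks_entropy_le:
  assumes "shift_invariant_measure \<nu>"
  shows "ks_entropy \<nu> \<le> ereal (- (\<integral>x. ln (J x) \<partial>\<nu>))"
  unfolding ks_entropy_def
proof (rule SUP_least)
  interpret shift_invariant_measure \<nu> by fact
  fix P :: "'a stream set set" assume "P \<in> Collect finite_partition"
  then have P: "finite_partition P" by simp
  obtain h where h: "(\<lambda>n. partition_entropy \<nu> (refined_partition P n) / real n) \<longlonglongrightarrow> h"
    "lim (\<lambda>n. ereal (partition_entropy \<nu> (refined_partition P n) / real n)) = ereal h"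
    using entropy_rate_limit[OF P] by blast
  have "h \<le> - (\<integral>x. ln (J x) \<partial>\<nu>) + \<eta>" if \<eta>: "\<eta> > 0" for \<eta>
  proof -
    define a where "a = - (\<integral>x. ln (J x) \<partial>\<nu>) + \<eta>"
    obtain K where K: "\<And>n. partition_entropy \<nu> (refined_partition P n) \<le> real n * a + K"
      using partition_entropy_linear_bound[OF assms P \<eta>] unfolding a_def by blast
    have "(\<lambda>n. a + K / real n) \<longlonglongrightarrow> a + 0" by (intro tendsto_intros lim_const_over_n)
    moreover have "partition_entropy \<nu> (refined_partition P n) / real n \<le> a + K / real n" if "n \<ge> 1" for n
      using K[of n] that by (simp add: field_simps)
    ultimately have "h \<le> a + 0" using h(1) by (intro LIMSEQ_le[OF h(1)]) auto
    then show ?thesis by (simp add: a_def)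
  qed
  then have "h \<le> - (\<integral>x. ln (J x) \<partial>\<nu>)" by (rule field_le_epsilon)
  then show "lim (\<lambda>n. ereal (partition_entropy \<nu> (refined_partition P n) / real n)) \<le> ereal (- (\<integral>x. ln (J x) \<partial>\<nu>))"
    by (simp add: h(2))
qed

lemma log_holder_jacobian_perturb:
  assumes "lip g" "\<And>x. (\<Sum>a\<in>UNIV. J (a ## x) * exp (g (a ## x))) = 1"
  shows "\<exists>C'. log_holder_jacobian (\<lambda>x. J x * exp (g x)) C' \<rho>"
proof -
  obtain M where M: "0 \<le> M" "var_bound w M g" using assms(1) by (rule lipE)
  have "var_bound (\<lambda>n. \<rho> ^ n) (C + M * Q) (\<lambda>x. ln (J x) + g x)"
    by (intro var_bound_add ln_J var_bound_imp_rho M)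
  then have "log_holder_jacobian (\<lambda>x. J x * exp (g x)) (C + M * Q) \<rho>"
    using assms(2) rho_pos rho_less C_pos M(1) Q_pos J_pos
    by unfold_locales (auto simp: ln_mult_pos intro: add_pos_nonneg)
  then show ?thesis ..
qed

text \<open>
  If equality holds for \<open>J\<close>, then among all Jacobians \<open>J\<close> maximises $\int\log J'\,d\nu$. The function
  $\psi = \varphi - (L\varphi)\circ\sigma$ satisfies $L\psi = 0$, so $J(1 + s\psi)$ is a Jacobian for small
  $s$ of either sign, and stationarity at $s = 0$ gives $\int\psi\,d\nu = 0$, that is,
  $\int\varphi\,d\nu = \int L\varphi\,d\nu$.
\<close>

lemma entropy_eq_imp_ruelle_dual:
  assumes "shift_invariant_measure \<nu>" and ent: "ks_entropy \<nu> = ereal (- (\<integral>x. ln (J x) \<partial>\<nu>))"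
  shows "is_ruelle_dual J \<nu> \<nu>"
proof -
  interpret shift_invariant_measure \<nu> by fact
  show ?thesis
  proof (rule invariant_imp_ruelle_dual)
    show "borel_prob \<nu>" by (rule borel_prob_axioms)
    fix \<phi> assume \<phi>: "lip \<phi>"
    define \<psi> where "\<psi> x = \<phi> x - ruelle J \<phi> (stl x)" for x
    have \<psi>: "lip \<psi>" unfolding \<psi>_def by (intro lip_diff \<phi> lip_stl lip_ruelle)
    have L\<psi>: "ruelle J \<psi> x = 0" for x
      using ruelle_mult_stl[of J "ruelle J \<phi>" "\<lambda>_. 1"] unfolding \<psi>_def by (simp add: ruelle_diff)
    obtain B where B: "0 < B" "\<And>x. \<bar>\<psi> x\<bar> \<le> B" using continuous_bounded_stream[OF lip_continuous[OF \<psi>]] by blast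
    define K where "K = 2 * B\<^sup>2"
    have K: "0 < K" using B(1) by (simp add: K_def)
    have key: "s * (\<integral>x. \<psi> x \<partial>\<nu>) \<le> s\<^sup>2 * K" if s: "\<bar>s\<bar> * B \<le> 1 / 2" for s
    proof -
      have sB: "\<bar>s * \<psi> x\<bar> \<le> 1 / 2" for x
        using s mult_left_mono[OF B(2), of "\<bar>s\<bar>" x] by (simp add: abs_mult)
      have half: "1 / 2 \<le> 1 + s * \<psi> x" for x using sB[of x] unfolding abs_le_iff by linarith
      define g where "g x = ln (1 + s * \<psi> x)" for x
      have g: "lip g"
      proof -
        obtain M where M: "var_bound w M (\<lambda>x. 1 + s * \<psi> x)"
          using lip_add[OF lip_const lip_cmult[OF \<psi>]] by (auto simp: lip_def)
        then show ?thesis unfolding g_def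
          using ln_lipschitz[OF _ half half] by (intro lipI[OF var_bound_comp[OF M, of ln 2]]) auto
      qed
      have exp_g: "exp (g x) = 1 + s * \<psi> x" for x
        using half[of x] by (simp add: g_def)
      have "(\<Sum>a\<in>UNIV. J (a ## x) * exp (g (a ## x))) = 1" for x
      proof -
        have "(\<Sum>a\<in>UNIV. J (a ## x) * exp (g (a ## x))) = (\<Sum>a\<in>UNIV. J (a ## x)) + s * ruelle J \<psi> x"
          unfolding exp_g ruelle_def by (simp add: distrib_left sum.distrib sum_distrib_left mult_ac)
        then show ?thesis by (simp add: J_sum L\<psi>)
      qed
      then obtain C' where J': "log_holder_jacobian (\<lambda>x. J x * exp (g x)) C' \<rho>"
        using log_holder_jacobian_perturb[OF g] by blast
      have "ereal (- (\<integral>x. ln (J x) \<partial>\<nu>)) \<le> ereal (- (\<integral>x. ln (J x * exp (g x)) \<partial>\<nu>))"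
        unfolding ent[symmetric] by (rule log_holder_jacobian.ks_entropy_le[OF J' assms(1)])
      then have "(\<integral>x. ln (J x) + g x \<partial>\<nu>) \<le> (\<integral>x. ln (J x) \<partial>\<nu>)" by (simp add: ln_mult_pos J_pos)
      then have "(\<integral>x. g x \<partial>\<nu>) \<le> 0"
        using integrable_continuous[OF ln_J_continuous] integrable_continuous[OF lip_continuous[OF g]] by simp
      moreover have "(\<integral>x. s * \<psi> x - s\<^sup>2 * K \<partial>\<nu>) \<le> (\<integral>x. g x \<partial>\<nu>)"
      proof (intro integral_mono integrable_continuous continuous_intros lip_continuous \<psi> g)
        fix x
        have "s * \<psi> x - 2 * (s * \<psi> x)\<^sup>2 \<le> g x"
          unfolding g_def using abs_ln_one_plus_x_minus_x_bound[OF sB[of x]] by (simp add: abs_le_iff)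
        moreover have "(\<psi> x)\<^sup>2 \<le> B\<^sup>2" using B(2)[of x] B(1) by (simp flip: abs_le_square_iff)
        then have "2 * (s * \<psi> x)\<^sup>2 \<le> s\<^sup>2 * K"
          by (simp add: power_mult_distrib mult_left_mono K_def)
        ultimately show "s * \<psi> x - s\<^sup>2 * K \<le> g x" by linarith
      qed
      moreover have "(\<integral>x. s * \<psi> x - s\<^sup>2 * K \<partial>\<nu>) = s * (\<integral>x. \<psi> x \<partial>\<nu>) - s\<^sup>2 * K"
        using integrable_continuous[OF lip_continuous[OF \<psi>]] by simp
      ultimately show ?thesis by linarith
    qed
    have small: "\<bar>\<integral>x. \<psi> x \<partial>\<nu>\<bar> \<le> s * K" if s: "0 < s" "s \<le> 1 / (2 * B)" for s
    proof -
      have "\<bar>s\<bar> * B \<le> 1 / 2" using s B(1) by (simp add: field_simps)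
      then have "s * (\<integral>x. \<psi> x \<partial>\<nu>) \<le> s * (s * K)" "s * (- (\<integral>x. \<psi> x \<partial>\<nu>)) \<le> s * (s * K)"
        using key[of s] key[of "- s"] by (simp_all add: power2_eq_square mult.assoc)
      then have "(\<integral>x. \<psi> x \<partial>\<nu>) \<le> s * K" "- (\<integral>x. \<psi> x \<partial>\<nu>) \<le> s * K" using s(1) by (auto simp only: mult_le_cancel_left_pos)
      then show ?thesis by (simp add: abs_le_iff)
    qed
    have "\<bar>\<integral>x. \<psi> x \<partial>\<nu>\<bar> \<le> 0 + e" if e: "e > 0" for e
    proof -
      define s where "s = min (1 / (2 * B)) (e / K)"
      have "s * K \<le> e / K * K" using K by (intro mult_right_mono) (auto simp: s_def)
      then show ?thesis using small[of s] B(1) K e by (simp add: s_def)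
    qed
    then have "\<bar>\<integral>x. \<psi> x \<partial>\<nu>\<bar> \<le> 0" by (rule field_le_epsilon)
    then have "(\<integral>x. \<phi> x \<partial>\<nu>) = (\<integral>x. ruelle J \<phi> (stl x) \<partial>\<nu>)"
      using integrable_continuous[OF lip_continuous[OF \<phi>]]
        integral_stl(1)[OF integrable_continuous[OF lip_continuous[OF lip_ruelle[OF \<phi>]]]]
      by (simp add: \<psi>_def)
    also have "\<dots> = (\<integral>x. ruelle J \<phi> x \<partial>\<nu>)"
      by (rule integral_stl(2)[OF integrable_continuous[OF lip_continuous[OF lip_ruelle[OF \<phi>]]]])
    finally show "(\<integral>x. \<phi> x \<partial>\<nu>) = (\<integral>x. ruelle J \<phi> x \<partial>\<nu>)" .
  qed
qed

end

definition letter_partition :: "'a::finite stream set set" where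
  "letter_partition = range (\<lambda>a. cyl [a])"

lemma in_letter_cyl: "x \<in> cyl [a] \<longleftrightarrow> shd x = a"
  by (simp add: cyl_def)

lemma inj_letter_cyl: "cyl [a] = cyl [b] \<longleftrightarrow> a = b"
  by (metis in_letter_cyl stream.sel(1))

lemma finite_partition_letter: "finite_partition (letter_partition :: 'a::finite stream set set)"
proof -
  have "partition_on UNIV (letter_partition :: 'a stream set set)"
  proof (rule partition_onI)
    fix p q :: "'a stream set" assume "p \<in> letter_partition" "q \<in> letter_partition" "p \<noteq> q"
    then show "disjnt p q" by (auto simp: letter_partition_def disjnt_def in_letter_cyl)
  next
    show "\<Union>letter_partition = (UNIV :: 'a stream set)" by (auto simp: letter_partition_def in_letter_cyl)
  next
    have "(a ## undefined) \<in> cyl [a]" for a :: 'a by (simp add: in_letter_cyl)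
    then show "{} \<notin> (letter_partition :: 'a stream set set)"
      unfolding letter_partition_def by blast
  qed
  then show ?thesis by (auto simp: finite_partition_def letter_partition_def)
qed

lemma itinerary_letter: "itinerary letter_partition n x = map (\<lambda>a. cyl [a]) (stake n x)"
proof (induction n arbitrary: x)
  case (Suc n)
  have "part_of letter_partition x = cyl [shd x]"
    by (rule partition_part_of(3)[OF finite_partition_letter]) (auto simp: letter_partition_def in_letter_cyl)
  then show ?case using Suc by simp
qed simp

sublocale gibbs_measure \<subseteq> shift_invariant_measure \<mu>
  by unfold_locales (rule shift_invariant)

context gibbs_measure
begin

text \<open>
  The lower bound is attained by the partition into cylinders of length one, because the measure of the
  cylinder of length \<open>n\<close> around a point is the product of \<open>J\<close> along its orbit up to the factor $e^Q$.
\<close>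

lemma ks_entropy_gibbs: "ks_entropy \<mu> = ereal (- (\<integral>x. ln (J x) \<partial>\<mu>))"
proof (rule antisym)
  show "ks_entropy \<mu> \<le> ereal (- (\<integral>x. ln (J x) \<partial>\<mu>))"
    by (rule ks_entropy_le) (rule shift_invariant_measure_axioms)
  note P = finite_partition_letter
  define H where "H n = partition_entropy \<mu> (refined_partition letter_partition n)" for n
  obtain h where h: "(\<lambda>n. H n / real n) \<longlonglongrightarrow> h" "lim (\<lambda>n. ereal (H n / real n)) = ereal h"
    using entropy_rate_limit[OF P] unfolding H_def by blast
  have lnJ_int: "integrable \<mu> (\<lambda>x. ln (J x))" by (rule integrable_continuous[OF ln_J_continuous])
  define I where "I = (\<integral>x. ln (J x) \<partial>\<mu>)"
  have H: "- real n * I - Q \<le> H n" for n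
  proof -
    have lp: "label_prob letter_partition n (itinerary letter_partition n x) = measure \<mu> (cyl (stake n x))" for x
    proof -
      have "inj (\<lambda>a :: 'a. cyl [a])" by (auto simp: inj_on_def inj_letter_cyl)
      then have "{y. itinerary letter_partition n y = itinerary letter_partition n x} = cyl (stake n x)"
        by (auto simp: itinerary_letter cyl_def inj_map_eq_map)
      then show ?thesis by (simp add: label_prob_def)
    qed
    have "H n = - (\<integral>x. ln (label_prob letter_partition n (itinerary letter_partition n x)) \<partial>\<mu>)"
      unfolding H_def partition_entropy_refined[OF P]
      by (subst integral_label(2)[OF P, of "\<lambda>s. ln (label_prob letter_partition n s)"]) simp
    also have "\<dots> \<ge> - (\<integral>x. birkhoff_sum (\<lambda>x. ln (J x)) n x + Q \<partial>\<mu>)"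
    proof (intro le_imp_neg_le integral_mono integral_label(1)[OF P, of "\<lambda>s. ln (label_prob letter_partition n s)"])
      show "integrable \<mu> (\<lambda>x. birkhoff_sum (\<lambda>x. ln (J x)) n x + Q)"
        using integral_birkhoff_sum(1)[OF lnJ_int] by simp
      fix x
      have "ln (measure \<mu> (cyl (stake n x))) \<le> ln (exp Q * jac_prod J (stake n x) (sdrop n x))"
        using measure_le_jac_prod measure_cyl_pos jac_prod_pos by (subst ln_le_cancel_iff) auto
      also have "\<dots> = birkhoff_sum (\<lambda>x. ln (J x)) n x + Q"
        by (simp add: ln_mult_pos jac_prod_pos ln_jac_prod_stake)
      finally show "ln (label_prob letter_partition n (itinerary letter_partition n x)) \<le> birkhoff_sum (\<lambda>x. ln (J x)) n x + Q"
        by (simp add: lp)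
    qed
    finally show ?thesis using integral_birkhoff_sum[OF lnJ_int] by (simp add: I_def)
  qed
  have "- I \<le> h"
  proof (rule LIMSEQ_le)
    show "(\<lambda>n. H n / real n) \<longlonglongrightarrow> h" by (rule h)
    have "(\<lambda>n. - I - Q / real n) \<longlonglongrightarrow> - I - 0" by (intro tendsto_intros lim_const_over_n)
    then show "(\<lambda>n. - I - Q / real n) \<longlonglongrightarrow> - I" by simp
    have "- I - Q / real n \<le> H n / real n" if "n \<ge> 1" for n
    proof -
      have "(- real n * I - Q) / real n \<le> H n / real n" by (intro divide_right_mono H) simp
      then show ?thesis using that by (simp add: diff_divide_distrib)
    qed
    then show "\<exists>N. \<forall>n\<ge>N. - I - Q / real n \<le> H n / real n" by blast
  qed
  then have "ereal (- I) \<le> lim (\<lambda>n. ereal (H n / real n))" by (simp add: h(2))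
  also have "\<dots> \<le> ks_entropy \<mu>"
    unfolding ks_entropy_def H_def using P by (intro SUP_upper) simp
  finally show "ereal (- (\<integral>x. ln (J x) \<partial>\<mu>)) \<le> ks_entropy \<mu>" by (simp add: I_def)
qed

text \<open>
  For invariant \<open>\<nu>\<close> the coboundary integrates to 0, so the pressure functional is at most \<open>c\<close>,
  with equality only for the Gibbs probability.
\<close>

theorem equilibrium_prob_eq:
  assumes u: "continuous_on UNIV u" and A: "\<And>x. A x = ln (J x) + u x - u (stl x) + c"
  shows "equilibrium_prob A = \<mu>"
proof -
  have int_A: "(\<integral>x. A x \<partial>\<nu>) = (\<integral>x. ln (J x) \<partial>\<nu>) + c" if "shift_invariant_prob \<nu>" for \<nu>
  proof -
    interpret \<nu>: shift_invariant_measure \<nu>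
      using that by (auto simp: shift_invariant_prob_def intro!: shift_invariant_measure.intro borel_prob.intro
          borel_prob_axioms.intro shift_invariant_measure_axioms.intro)
    show ?thesis unfolding A
      using \<nu>.integrable_continuous[OF ln_J_continuous] \<nu>.integral_stl[OF \<nu>.integrable_continuous[OF u]]
        \<nu>.integrable_continuous[OF u] by simp
  qed
  have le: "ereal (\<integral>x. A x \<partial>\<nu>) + ks_entropy \<nu> \<le> ereal c"
    and eq: "ereal (\<integral>x. A x \<partial>\<nu>) + ks_entropy \<nu> = ereal c \<Longrightarrow> \<nu> = \<mu>" if \<nu>: "shift_invariant_prob \<nu>" for \<nu>
  proof -
    interpret \<nu>: shift_invariant_measure \<nu>
      using that by (auto simp: shift_invariant_prob_def intro!: shift_invariant_measure.intro borel_prob.intro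
          borel_prob_axioms.intro shift_invariant_measure_axioms.intro)
    have h: "ks_entropy \<nu> \<le> ereal (- (\<integral>x. ln (J x) \<partial>\<nu>))"
      by (rule ks_entropy_le) (rule \<nu>.shift_invariant_measure_axioms)
    then show "ereal (\<integral>x. A x \<partial>\<nu>) + ks_entropy \<nu> \<le> ereal c"
      unfolding int_A[OF \<nu>] by (cases "ks_entropy \<nu>") auto
    assume "ereal (\<integral>x. A x \<partial>\<nu>) + ks_entropy \<nu> = ereal c"
    then have "ks_entropy \<nu> = ereal (- (\<integral>x. ln (J x) \<partial>\<nu>))"
      unfolding int_A[OF \<nu>] by (cases "ks_entropy \<nu>") auto
    then have "is_ruelle_dual J \<nu> \<nu>"
      by (intro entropy_eq_imp_ruelle_dual \<nu>.shift_invariant_measure_axioms)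
    then have "gibbs_measure J C \<rho> \<nu>"
      by (intro gibbs_measure.intro log_holder_jacobian_axioms \<nu>.borel_prob_axioms gibbs_measure_axioms.intro)
    then show "\<nu> = \<mu>" by (rule gibbs_measure_unique)
  qed
  have val: "ereal (\<integral>x. A x \<partial>\<mu>) + ks_entropy \<mu> = ereal c"
    by (simp add: int_A[OF shift_invariant_prob] ks_entropy_gibbs)
  show ?thesis unfolding equilibrium_prob_def
  proof (rule the_equality)
    show "is_arg_max (\<lambda>\<nu>. ereal (\<integral>x. A x \<partial>\<nu>) + ks_entropy \<nu>) shift_invariant_prob \<mu>"
      unfolding is_arg_max_def val using le shift_invariant_prob by (auto simp: not_less[symmetric])
    fix \<nu> assume \<nu>: "is_arg_max (\<lambda>\<nu>. ereal (\<integral>x. A x \<partial>\<nu>) + ks_entropy \<nu>) shift_invariant_prob \<nu>"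
    then have inv: "shift_invariant_prob \<nu>" by (simp add: is_arg_max_def)
    have "\<not> ereal (\<integral>x. A x \<partial>\<nu>) + ks_entropy \<nu> < ereal c"
      using \<nu> shift_invariant_prob unfolding is_arg_max_def val[symmetric] by blast
    then show "\<nu> = \<mu>" using le[OF inv] by (intro eq inv) simp
  qed
qed

end

section \<open>Perturbation of the Ruelle operator\<close>

lemma exp_taylor_bounds:
  assumes "\<bar>t :: real\<bar> \<le> 1"
  shows "\<bar>exp t - 1\<bar> \<le> 3 * \<bar>t\<bar>" "\<bar>exp t - 1 - t\<bar> \<le> 3 * t\<^sup>2" "\<bar>exp t - 1 - t - t\<^sup>2 / 2\<bar> \<le> 3 * \<bar>t\<bar> ^ 3"
proof -
  have *: "\<bar>exp t - (\<Sum>m<n. t ^ m / fact m)\<bar> \<le> 3 * \<bar>t\<bar> ^ n" for n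
  proof -
    obtain s where s: "\<bar>s\<bar> \<le> \<bar>t\<bar>" "exp t = (\<Sum>m<n. t ^ m / fact m) + exp s / fact n * t ^ n"
      using Maclaurin_exp_le[of t n] by blast
    have "exp s \<le> exp 1" using s(1) assms by simp
    then have "exp s \<le> 3" using exp_le by linarith
    moreover have "exp s / fact n \<le> exp s / 1" by (intro divide_left_mono) auto
    ultimately have "exp s / fact n \<le> 3" by simp
    then have "exp s / fact n * \<bar>t\<bar> ^ n \<le> 3 * \<bar>t\<bar> ^ n" by (intro mult_right_mono) auto
    then show ?thesis using s(2) by (simp add: abs_mult power_abs)
  qed
  show "\<bar>exp t - 1\<bar> \<le> 3 * \<bar>t\<bar>" using *[of 1] by simp
  show "\<bar>exp t - 1 - t\<bar> \<le> 3 * t\<^sup>2" using *[of 2] by (simp add: numeral_2_eq_2 algebra_simps)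
  show "\<bar>exp t - 1 - t - t\<^sup>2 / 2\<bar> \<le> 3 * \<bar>t\<bar> ^ 3" using *[of 3] by (simp add: numeral_3_eq_3 numeral_2_eq_2 algebra_simps)
qed

lemma exp_lipschitz_unit:
  assumes "\<bar>a\<bar> \<le> A" "\<bar>b\<bar> \<le> A" "A \<le> (1 :: real)"
  shows "\<bar>(exp a - 1) - (exp b - 1)\<bar> \<le> 3 * \<bar>a - b\<bar>"
    and "\<bar>(exp a - 1 - a) - (exp b - 1 - b)\<bar> \<le> 3 * A * \<bar>a - b\<bar>"
proof -
  have 2: "exp s - exp t \<le> 3 * \<bar>s - t\<bar>" if "\<bar>s\<bar> \<le> A" for s t
  proof -
    have "exp s \<le> 3" using that assms(3) exp_le by (meson abs_le_D1 exp_le_cancel_iff order_trans)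
    then have "exp s * \<bar>s - t\<bar> \<le> 3 * \<bar>s - t\<bar>" by (intro mult_right_mono) auto
    moreover have "exp s * (s - t) \<le> exp s * \<bar>s - t\<bar>" by (intro mult_left_mono) auto
    ultimately show ?thesis using exp_diff_le[of s t] by linarith
  qed
  have 3: "(exp s - 1 - s) - (exp t - 1 - t) \<le> 3 * A * \<bar>s - t\<bar>" if "\<bar>s\<bar> \<le> A" for s t
  proof -
    have "(exp s - 1 - s) - (exp t - 1 - t) \<le> (exp s - 1) * (s - t)" using exp_diff_le[of s t] by (simp add: algebra_simps)
    also have "\<dots> \<le> \<bar>exp s - 1\<bar> * \<bar>s - t\<bar>" by (metis abs_ge_self abs_mult)
    also have "\<bar>exp s - 1\<bar> \<le> 3 * A" using exp_taylor_bounds(1)[of s] that assms(3) by linarith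
    finally show ?thesis by (simp add: mult_right_mono)
  qed
  show "\<bar>(exp a - 1) - (exp b - 1)\<bar> \<le> 3 * \<bar>a - b\<bar>"
    using 2[OF assms(1), of b] 2[OF assms(2), of a] by (simp add: abs_le_iff abs_minus_commute)
  show "\<bar>(exp a - 1 - a) - (exp b - 1 - b)\<bar> \<le> 3 * A * \<bar>a - b\<bar>"
    using 3[OF assms(1), of b] 3[OF assms(2), of a] by (simp add: abs_le_iff abs_minus_commute)
qed

context log_holder_jacobian
begin

lemma var_bound_w_mono: "var_bound w M f \<Longrightarrow> M \<le> M' \<Longrightarrow> var_bound w M' f"
  by (erule var_bound_mono) (intro mult_right_mono less_imp_le[OF w_pos])

lemma var_bound_add_const: "var_bound w M f \<Longrightarrow> var_bound w M (\<lambda>x. c + f x)"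
  by (simp add: var_bound_def)

end

context gibbs_measure
begin

lemma lip_integrable: "lip f \<Longrightarrow> integrable \<mu> f"
  by (intro integrable_continuous lip_continuous)

lemma integral_ruelle_lip: "lip f \<Longrightarrow> (\<integral>x. ruelle J f x \<partial>\<mu>) = (\<integral>x. f x \<partial>\<mu>)"
  by (intro integral_ruelle lip_continuous)

text \<open>
  The Poisson equation of the Markov operator \<open>ruelle J\<close>.
\<close>

definition poisson_solution :: "('a stream \<Rightarrow> real) \<Rightarrow> ('a stream \<Rightarrow> real) \<Rightarrow> bool" where
  "poisson_solution u \<phi> \<longleftrightarrow> lip u \<and> (\<forall>x. u x - ruelle J u x = \<phi> x - (\<integral>x. \<phi> x \<partial>\<mu>))"

text \<open>
  The solution is $\sum_n (L^n\varphi - \int\varphi\,d\mu)$, which converges geometrically.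
\<close>

lemma poisson_equation:
  assumes \<phi>: "var_bound w M \<phi>"
  obtains u where "poisson_solution u \<phi>" "\<And>x. \<bar>u x\<bar> \<le> M / (1 - r)"
proof -
  define c where "c = (\<integral>x. \<phi> x \<partial>\<mu>)"
  define a where "a n x = (ruelle J ^^ n) \<phi> x - c" for n x
  have bound: "\<bar>a n x\<bar> \<le> r ^ n * M" for n x unfolding a_def c_def by (rule ruelle_pow_mean[OF \<phi>])
  have geo: "(\<lambda>n. r ^ n * K) sums (K / (1 - r))" for K
    using sums_mult2[OF geometric_sums[of r], of K] r_pos r_less_1 by simp
  have sm: "summable (\<lambda>n. a n x)" for x
    using bound by (intro summable_comparison_test'[OF sums_summable[OF geo[of M]]]) auto
  define u where "u x = (\<Sum>n. a n x)" for x
  have u: "(\<lambda>n. a n x) sums u x" for x unfolding u_def by (rule summable_sums[OF sm])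
  have bound_u: "\<bar>u x\<bar> \<le> M / (1 - r)" for x
    using norm_sums_le[OF u geo[of M]] bound by simp
  have "var_bound w (M / (1 - r)) u"
    proof (rule var_boundI)
      fix n and x y :: "'a stream" assume s: "stake n x = stake n y"
      have "\<bar>a k x - a k y\<bar> \<le> r ^ k * (M * w n)" for k
        using var_boundD[OF ruelle_pow_contraction[OF \<phi>] s, of k] by (simp add: a_def mult.assoc)
      then have "norm (u x - u y) \<le> M * w n / (1 - r)"
        by (intro norm_sums_le[OF sums_diff[OF u u] geo]) auto
      then show "\<bar>u x - u y\<bar> \<le> M / (1 - r) * w n" by simp
    qed
  then have "lip u" by (rule lipI)
  moreover have "u x - ruelle J u x = \<phi> x - (\<integral>x. \<phi> x \<partial>\<mu>)" for x
  proof -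
    have "(\<lambda>n. \<Sum>b\<in>UNIV. J (b ## x) * a n (b ## x)) sums (\<Sum>b\<in>UNIV. J (b ## x) * u (b ## x))"
      by (intro sums_sum sums_mult u)
    moreover have "(\<Sum>b\<in>UNIV. J (b ## x) * a n (b ## x)) = a (Suc n) x" for n
    proof -
      have "(\<Sum>b\<in>UNIV. J (b ## x) * a n (b ## x)) = ruelle J (\<lambda>x. (ruelle J ^^ n) \<phi> x - c) x"
        by (simp add: ruelle_def a_def)
      then show ?thesis by (simp add: ruelle_diff a_def)
    qed
    ultimately have "(\<lambda>n. a (Suc n) x) sums ruelle J u x" by (simp add: ruelle_def)
    then have "(\<lambda>n. a n x) sums (ruelle J u x + a 0 x)" using sums_Suc_iff[of "\<lambda>n. a n x"] by simp
    then have "u x = ruelle J u x + a 0 x" using u sums_unique2 by blast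
    then show ?thesis by (simp add: a_def c_def)
  qed
  ultimately show thesis using that bound_u by (auto simp: poisson_solution_def)
qed

text \<open>
  With $h = 1 + g$, $\int g\,d\mu = 0$, the equation $L((1+f)h) = \lambda h$ forces
  $\lambda = 1 + m(g)$, where $m(g) = \int f(1+g)\,d\mu$, and becomes the fixed point equation
  $g = Lg + L(f(1+g)) - m(g)(1+g)$. For small \<open>f\<close> the right-hand side is a contraction, being a small
  perturbation of \<open>L\<close>. The size of \<open>g\<close> is governed by that of $Lf$, not of \<open>f\<close>; in a tangent
  direction $Lf$ is of second order.
\<close>

lemma perturbed_eigenfunction:
  assumes f: "var_bound w \<epsilon> f" "\<And>x. \<bar>f x\<bar> \<le> \<epsilon>" and \<epsilon>: "10 * \<epsilon> \<le> 1 - r"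
    and Lf: "var_bound w \<delta> (ruelle J f)" and \<delta>: "2 * \<delta> \<le> 1 - r"
  obtains g where "var_bound w (2 * \<delta> / (1 - r)) g" "(\<integral>x. g x \<partial>\<mu>) = 0"
    "\<And>x. ruelle J (\<lambda>x. (1 + f x) * (1 + g x)) x = (1 + (\<integral>x. f x * (1 + g x) \<partial>\<mu>)) * (1 + g x)"
proof -
  have \<epsilon>0: "0 \<le> \<epsilon>" using f(2)[of undefined] abs_ge_zero order_trans by blast
  have \<delta>0: "0 \<le> \<delta>" using Lf by (rule var_bound_nonneg)
  have lipf: "lip f" using f(1) by (rule lipI)
  define m where "m g = (\<integral>x. f x * (1 + g x) \<partial>\<mu>)" for g
  define T where "T g x = ruelle J g x + ruelle J (\<lambda>x. f x * (1 + g x)) x - m g * (1 + g x)" for g x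
  define r' where "r' = (1 + r) / 2"
  have r': "0 < r'" "r' < 1" "1 - r' = (1 - r) / 2" using r_pos r_less_1 by (auto simp: r'_def field_simps)
  \<comment> \<open>Under the constraint of zero mean the seminorm dominates the uniform norm.\<close>
  define adm where "adm g \<longleftrightarrow> var_bound w 1 g \<and> (\<integral>x. g x \<partial>\<mu>) = 0" for g
  have lip_adm: "lip g" if "adm g" for g using that by (auto simp: adm_def intro: lipI)
  have bound: "\<bar>D x\<bar> \<le> d" if "var_bound w d D" "(\<integral>x. D x \<partial>\<mu>) = 0" for d D x
    using mean_close[OF that(1), of x] that(2) by simp
  have lip_f1: "lip (\<lambda>x. f x * (1 + g x))" if "lip g" for g
    using that by (intro lip_mult lipf lip_add lip_const)
  have T_mean: "(\<integral>x. T g x \<partial>\<mu>) = 0" if "adm g" for g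
    using that lip_adm[OF that] unfolding T_def
    by (simp add: lip_integrable lip_ruelle lip_f1 lip_add integral_ruelle_lip adm_def prob_space flip: m_def)
  have m_bound: "\<bar>m g\<bar> \<le> 2 * \<epsilon>" if "adm g" for g
  proof -
    have "\<bar>1 + g x\<bar> \<le> 2" for x using bound[of 1 g x] that by (simp add: adm_def abs_le_iff)
    then have "\<bar>f x * (1 + g x)\<bar> \<le> \<epsilon> * 2" for x
      unfolding abs_mult using f(2) \<epsilon>0 by (intro mult_mono) auto
    then show ?thesis unfolding m_def
      using integral_bound[OF lip_continuous[OF lip_f1[OF lip_adm[OF that]]], of "\<epsilon> * 2"] by (simp add: mult.commute)
  qed
  have contr: "var_bound w (r' * d) (\<lambda>x. T g x - T h x)"
    if g: "adm g" and h: "adm h" and d: "var_bound w d (\<lambda>x. g x - h x)" for g h d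
  proof -
    define D where "D x = g x - h x" for x
    have D: "var_bound w d D" using d by (simp add: D_def[abs_def])
    have d0: "0 \<le> d" using D by (rule var_bound_nonneg)
    have Dlip: "lip D" using D by (rule lipI)
    have "(\<integral>x. D x \<partial>\<mu>) = 0" using g h lip_adm[OF g] lip_adm[OF h] by (simp add: D_def adm_def lip_integrable)
    note Db = bound[OF D this]
    have m_diff: "m g - m h = (\<integral>x. f x * D x \<partial>\<mu>)"
    proof -
      have "m g - m h = (\<integral>x. f x * (1 + g x) - f x * (1 + h x) \<partial>\<mu>)"
        unfolding m_def using lip_f1[OF lip_adm[OF g]] lip_f1[OF lip_adm[OF h]] by (simp add: lip_integrable)
      then show ?thesis by (simp add: D_def algebra_simps)
    qed
    have fD: "\<bar>f x * D x\<bar> \<le> \<epsilon> * d" for x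
      unfolding abs_mult using f(2) Db \<epsilon>0 by (intro mult_mono) auto
    have mD: "\<bar>m g - m h\<bar> \<le> \<epsilon> * d"
      unfolding m_diff by (intro integral_bound lip_continuous lip_mult lipf Dlip fD)
    have "T g x - T h x = (ruelle J D x + ruelle J (\<lambda>x. f x * D x) x) - (m g * D x + (m g - m h) * (1 + h x))" for x
    proof -
      have "ruelle J D x = ruelle J g x - ruelle J h x" unfolding D_def by (simp add: ruelle_diff)
      moreover have "ruelle J (\<lambda>x. f x * D x) x = ruelle J (\<lambda>x. f x * (1 + g x)) x - ruelle J (\<lambda>x. f x * (1 + h x)) x"
      proof -
        have "(\<lambda>x. f x * D x) = (\<lambda>x. f x * (1 + g x) - f x * (1 + h x))"
          by (simp add: fun_eq_iff D_def algebra_simps)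
        then show ?thesis by (simp only: ruelle_diff)
      qed
      ultimately show ?thesis by (simp add: T_def D_def algebra_simps)
    qed
    moreover have "var_bound w ((r * d + r * (\<epsilon> * d + \<epsilon> * d)) + (\<bar>m g\<bar> * d + \<bar>m g - m h\<bar> * 1))
        (\<lambda>x. (ruelle J D x + ruelle J (\<lambda>x. f x * D x) x) - (m g * D x + (m g - m h) * (1 + h x)))"
      using h by (intro var_bound_diff var_bound_add var_bound_cmult ruelle_contraction var_bound_mult
          var_bound_add_const f D Db) (simp add: adm_def)
    ultimately have "var_bound w ((r * d + r * (\<epsilon> * d + \<epsilon> * d)) + (\<bar>m g\<bar> * d + \<bar>m g - m h\<bar> * 1)) (\<lambda>x. T g x - T h x)"
      by simp
    moreover have "(r * d + r * (\<epsilon> * d + \<epsilon> * d)) + (\<bar>m g\<bar> * d + \<bar>m g - m h\<bar> * 1) \<le> r' * d"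
    proof -
      have "r * (\<epsilon> * d + \<epsilon> * d) \<le> 1 * (\<epsilon> * d + \<epsilon> * d)"
        using r_less_1 \<epsilon>0 d0 by (intro mult_right_mono) auto
      moreover have "\<bar>m g\<bar> * d \<le> 2 * \<epsilon> * d" using m_bound[OF g] d0 by (intro mult_right_mono)
      moreover have "10 * \<epsilon> * d \<le> (1 - r) * d" using \<epsilon> d0 by (intro mult_right_mono)
      ultimately show ?thesis using mD by (simp add: r'_def algebra_simps)
    qed
    ultimately show ?thesis by (rule var_bound_w_mono)
  qed
  define G where "G n = (T ^^ n) (\<lambda>_. 0)" for n
  have GS: "G (Suc n) = T (G n)" for n by (simp add: G_def)
  define s where "s n = \<delta> * (1 - r' ^ n) / (1 - r')" for n
  have s_le: "s n \<le> 2 * \<delta> / (1 - r)" for n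
  proof -
    have "s n \<le> \<delta> * 1 / (1 - r')"
      unfolding s_def using r' \<delta>0 by (intro divide_right_mono mult_left_mono) auto
    then show ?thesis using r'(3) by (simp add: field_simps)
  qed
  have s1: "s n \<le> 1" for n
    using s_le[of n] \<delta> r_less_1 by (simp add: divide_le_eq order_trans)
  have inv: "var_bound w (s n) (G n) \<and> (\<integral>x. G n x \<partial>\<mu>) = 0 \<and> var_bound w (r' ^ n * \<delta>) (\<lambda>x. G (Suc n) x - G n x)" for n
  proof (induction n)
    case 0
    have "T (\<lambda>_. 0) = (\<lambda>x. (- m (\<lambda>_. 0)) + ruelle J f x)" by (rule ext) (simp add: T_def)
    moreover have "var_bound w \<delta> (\<lambda>x. (- m (\<lambda>_. 0)) + ruelle J f x)" by (rule var_bound_add_const[OF Lf])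
    moreover have "G 0 = (\<lambda>_. 0)" by (simp add: G_def)
    ultimately show ?case unfolding GS by (simp add: s_def less_imp_le[OF w_pos])
  next
    case (Suc n)
    have adm: "adm (G n)" using Suc s1[of n] by (auto simp: adm_def intro: var_bound_w_mono)
    have "var_bound w (s n + r' ^ n * \<delta>) (\<lambda>x. G n x + (G (Suc n) x - G n x))"
      using Suc by (intro var_bound_add) auto
    moreover have "s n + r' ^ n * \<delta> = s (Suc n)"
      using r' by (simp add: s_def field_simps)
    ultimately have vS: "var_bound w (s (Suc n)) (G (Suc n))" by simp
    have mS: "(\<integral>x. G (Suc n) x \<partial>\<mu>) = 0" unfolding GS by (rule T_mean[OF adm])
    have admS: "adm (G (Suc n))" using vS mS s1[of "Suc n"] by (auto simp: adm_def intro: var_bound_w_mono)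
    have "var_bound w (r' * (r' ^ n * \<delta>)) (\<lambda>x. T (G (Suc n)) x - T (G n) x)"
      using Suc by (intro contr adm admS) simp
    then show ?case using vS mS by (simp add: GS mult.assoc)
  qed
  have admG: "adm (G n)" for n using inv[of n] s1[of n] by (auto simp: adm_def intro: var_bound_w_mono)
  have step: "\<bar>G (Suc n) x - G n x\<bar> \<le> r' ^ n * \<delta>" for n x
    using inv[of n] inv[of "Suc n"] lip_adm[OF admG] by (intro bound) (auto simp: lip_integrable)
  have sm: "summable (\<lambda>n. G (Suc n) x - G n x)" for x
  proof (rule summable_comparison_test'[of "\<lambda>n. r' ^ n * \<delta>"])
    show "summable (\<lambda>n. r' ^ n * \<delta>)" using r' by (intro summable_mult2 summable_geometric) auto
  qed (use step in auto)
  have "convergent (\<lambda>n. G n x)" for x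
  proof -
    have "(\<lambda>n. \<Sum>i<n. G (Suc i) x - G i x) = (\<lambda>n. G n x - G 0 x)" by (rule ext) (rule sum_lessThan_telescope)
    then have "convergent (\<lambda>n. G n x - G 0 x)" using sm[of x] by (simp add: summable_iff_convergent)
    then show ?thesis using convergent_add[OF _ convergent_const[of "G 0 x"]] by fastforce
  qed
  then obtain g where g: "\<And>x. (\<lambda>n. G n x) \<longlonglongrightarrow> g x" unfolding convergent_def by metis
  have g_var: "var_bound w (2 * \<delta> / (1 - r)) g"
  proof (rule var_boundI)
    fix n and x y :: "'a stream" assume st: "stake n x = stake n y"
    have "(\<lambda>k. \<bar>G k x - G k y\<bar>) \<longlonglongrightarrow> \<bar>g x - g y\<bar>" by (intro tendsto_intros g)
    moreover have "\<bar>G k x - G k y\<bar> \<le> 2 * \<delta> / (1 - r) * w n" for k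
      using inv[of k] var_boundD[OF _ st] s_le[of k] by (blast intro: var_bound_w_mono)
    ultimately show "\<bar>g x - g y\<bar> \<le> 2 * \<delta> / (1 - r) * w n" by (intro LIMSEQ_le_const2) auto
  qed
  have lipg: "lip g" using g_var by (rule lipI)
  have Gb: "\<bar>G n x\<bar> \<le> 1" for n x using admG[of n] by (intro bound) (auto simp: adm_def)
  have meas: "h \<in> borel_measurable \<mu>" if "lip h" for h using lip_integrable[OF that] by auto
  have lim_int: "(\<lambda>n. \<integral>x. k x * (c + G n x) \<partial>\<mu>) \<longlonglongrightarrow> (\<integral>x. k x * (c + g x) \<partial>\<mu>)" 
    if k: "lip k" "\<And>x. \<bar>k x\<bar> \<le> b" for k b c
  proof (rule integral_dominated_convergence[where w = "\<lambda>_. b * (\<bar>c\<bar> + 1)"])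
    show "(\<lambda>x. k x * (c + g x)) \<in> borel_measurable \<mu>" by (intro meas lip_mult k lip_add lip_const lipg)
    show "(\<lambda>x. k x * (c + G n x)) \<in> borel_measurable \<mu>" for n
      by (intro meas lip_mult k lip_add lip_const lip_adm[OF admG])
    show "AE x in \<mu>. (\<lambda>n. k x * (c + G n x)) \<longlonglongrightarrow> k x * (c + g x)"
      by (intro AE_I2 tendsto_intros g)
    show "AE x in \<mu>. norm (k x * (c + G n x)) \<le> b * (\<bar>c\<bar> + 1)" for n
    proof (rule AE_I2)
      fix x
      have "\<bar>c + G n x\<bar> \<le> \<bar>c\<bar> + 1" using Gb[of n x] by linarith
      then show "norm (k x * (c + G n x)) \<le> b * (\<bar>c\<bar> + 1)"
        unfolding real_norm_def abs_mult using k(2)[of x] abs_ge_zero[of "k x"] by (intro mult_mono) (auto simp del: abs_ge_zero)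
    qed
  qed simp
  have m_lim: "(\<lambda>n. m (G n)) \<longlonglongrightarrow> m g" unfolding m_def by (rule lim_int[OF lipf f(2)])
  have "(\<lambda>n. \<integral>x. 1 * (0 + G n x) \<partial>\<mu>) \<longlonglongrightarrow> (\<integral>x. 1 * (0 + g x) \<partial>\<mu>)" by (rule lim_int[of _ 1]) auto
  then have g_mean: "(\<integral>x. g x \<partial>\<mu>) = 0" using inv by (simp add: LIMSEQ_const_iff)
  have T_fix: "T g x = g x" for x
  proof -
    have "(\<lambda>n. T (G n) x) \<longlonglongrightarrow> T g x"
      unfolding T_def ruelle_def by (intro tendsto_intros g m_lim)
    moreover have "(\<lambda>n. T (G n) x) \<longlonglongrightarrow> g x" using LIMSEQ_Suc[OF g[of x]] by (simp add: GS)
    ultimately show ?thesis by (rule LIMSEQ_unique)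
  qed
  have "ruelle J (\<lambda>x. (1 + f x) * (1 + g x)) x = (1 + (\<integral>x. f x * (1 + g x) \<partial>\<mu>)) * (1 + g x)" for x
  proof -
    have "(\<lambda>x. (1 + f x) * (1 + g x)) = (\<lambda>x. (1 + g x) + f x * (1 + g x))" by (simp add: fun_eq_iff algebra_simps)
    then have "ruelle J (\<lambda>x. (1 + f x) * (1 + g x)) x = 1 + ruelle J g x + ruelle J (\<lambda>x. f x * (1 + g x)) x"
      by (simp add: ruelle_add)
    then show ?thesis using T_fix[of x] by (simp add: T_def m_def algebra_simps)
  qed
  then show thesis using that g_var g_mean by blast
qed

end

section \<open>Jacobians of Gibbs probabilities\<close>

text \<open>
  By compactness \<open>J\<close> is bounded away from 0, so \<open>ln J\<close> is Hoelder as well; the larger of the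
  rates of \<open>ln J\<close> and \<open>\<xi>\<close> serves for both.
\<close>

lemma holder_jacobian_imp_log_holder:
  fixes J \<xi> :: "'a::finite stream \<Rightarrow> real"
  assumes J: "holder_jacobian J" and \<xi>: "holder \<xi>"
  obtains C \<rho> M where "log_holder_jacobian J C \<rho>" "0 < M" "var_bound (\<lambda>n. \<rho> ^ n) M \<xi>"
proof -
  have pos: "0 < J x" and sum1: "(\<Sum>a\<in>UNIV. J (a ## x)) = 1" and hJ: "holder J" for x
    using J by (auto simp: holder_jacobian_def)
  obtain K M \<rho> where \<rho>: "0 < \<rho>" "\<rho> < 1" "0 < K" "0 < M"
    and K: "var_bound (\<lambda>n. \<rho> ^ n) K J" and M: "var_bound (\<lambda>n. \<rho> ^ n) M \<xi>"
    using holder_common_rate[OF hJ \<xi>] by blast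
  have "continuous_on UNIV (\<lambda>x. 1 / J x)"
    using holder_continuous[OF hJ] pos by (intro continuous_intros) (auto simp: less_imp_neq[symmetric])
  then obtain B where B: "0 < B" "\<And>x. \<bar>1 / J x\<bar> \<le> B" using continuous_bounded_stream by blast
  have "1 / B \<le> J x" for x using B(1) B(2)[of x] pos[of x] by (simp add: field_simps)
  then have "\<bar>ln (J x) - ln (J y)\<bar> \<le> B * \<bar>J x - J y\<bar>" for x y
    using ln_lipschitz[of "1 / B" "J x" "J y"] B(1) by simp
  then have "var_bound (\<lambda>n. \<rho> ^ n) (B * K) (\<lambda>x. ln (J x))" using B(1) by (intro var_bound_comp[OF K]) auto
  then have "log_holder_jacobian J (B * K) \<rho>"
    using pos sum1 \<rho> B by unfold_locales auto
  then show thesis using that \<rho> M by blast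
qed

context gibbs_measure
begin

text \<open>
  Testing both invariance relations with $\varphi = J - J'$ gives
  $\int\sum_a (J - J')(ax)^2\,d\mu(x) = 0$, and \<open>\<mu>\<close> has full support.
\<close>

lemma jacobian_unique:
  assumes "is_jacobian_of J' \<mu>" shows "J' = J"
proof
  fix x
  have cJ': "continuous_on UNIV J'" using assms by (simp add: is_jacobian_of_def holder_jacobian_def holder_continuous)
  have dual': "(\<integral>x. \<phi> x \<partial>\<mu>) = (\<integral>x. ruelle J' \<phi> x \<partial>\<mu>)" if "continuous_on UNIV \<phi>" for \<phi>
    using assms that by (simp add: is_jacobian_of_def is_ruelle_dual_def)
  define \<phi> where "\<phi> x = J x - J' x" for x
  have c: "continuous_on UNIV \<phi>" unfolding \<phi>_def by (intro continuous_intros J_continuous cJ')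
  define g where "g x = (\<Sum>a\<in>UNIV. (\<phi> (a ## x))\<^sup>2)" for x
  have g: "g x = ruelle J \<phi> x - ruelle J' \<phi> x" for x
    by (simp add: g_def ruelle_def \<phi>_def power2_eq_square algebra_simps flip: sum_subtractf)
  have cg: "continuous_on UNIV g" unfolding g_def by (intro continuous_intros c)
  have "(\<integral>x. g x \<partial>\<mu>) = (\<integral>x. ruelle J \<phi> x \<partial>\<mu>) - (\<integral>x. ruelle J' \<phi> x \<partial>\<mu>)"
    unfolding g by (intro Bochner_Integration.integral_diff integrable_continuous continuous_on_ruelle J_continuous cJ' c)
  also have "\<dots> = 0" using integral_ruelle[OF c] dual'[OF c] by simp
  finally have "g (stl x) = 0" by (intro continuous_nonneg_integral_0[OF cg]) (auto simp: g_def sum_nonneg)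
  then have "\<forall>a\<in>UNIV. (\<phi> (a ## stl x))\<^sup>2 = 0" unfolding g_def by (subst (asm) sum_nonneg_eq_0_iff) auto
  then have "(\<phi> (shd x ## stl x))\<^sup>2 = 0" by blast
  then show "J' x = J x" by (simp add: \<phi>_def)
qed

text \<open>
  With at least two letters, the other positive weights above a point keep \<open>J\<close> below 1.
\<close>

lemma gibbs_jacobian_eq:
  assumes "CARD('a) \<ge> 2" shows "gibbs_jacobian \<mu> = J" "is_jacobian_of J \<mu>"
proof -
  have "J x < 1" for x
  proof -
    obtain b where b: "b \<noteq> shd x"
    proof -
      have "\<not> UNIV \<subseteq> {shd x}"
      proof
        assume "UNIV \<subseteq> {shd x}"
        then have "CARD('a) \<le> card {shd x}" by (intro card_mono) auto
        then show False using assms by simp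
      qed
      then show thesis using that by blast
    qed
    have "J x + J (b ## stl x) = (\<Sum>a\<in>{shd x, b}. J (a ## stl x))" using b by simp
    also have "\<dots> \<le> (\<Sum>a\<in>UNIV. J (a ## stl x))" using J_pos by (intro sum_mono2) (auto intro: less_imp_le)
    finally show ?thesis using J_pos[of "b ## stl x"] by (simp add: J_sum)
  qed
  moreover have "holder J"
  proof -
    obtain B where B: "0 < B" "\<And>x. \<bar>J x\<bar> \<le> B" using continuous_bounded_stream[OF J_continuous] by blast
    have "\<bar>J x - J y\<bar> \<le> B * \<bar>ln (J x) - ln (J y)\<bar>" for x y
    proof -
      have "J x - J y \<le> B * \<bar>ln (J x) - ln (J y)\<bar>" for x y
      proof -
        have "J x - J y \<le> J x * (ln (J x) - ln (J y))" using exp_diff_le[of "ln (J x)" "ln (J y)"] by (simp add: J_pos)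
        also have "\<dots> \<le> \<bar>J x\<bar> * \<bar>ln (J x) - ln (J y)\<bar>" by (metis abs_ge_self abs_mult)
        also have "\<dots> \<le> B * \<bar>ln (J x) - ln (J y)\<bar>" by (intro mult_right_mono B) auto
        finally show ?thesis .
      qed
      from this[of x y] this[of y x] show ?thesis by (simp add: abs_le_iff abs_minus_commute)
    qed
    then have "var_bound w (B * (C / w 0)) (\<lambda>x. exp (ln (J x)))"
      using var_bound_rho_imp[OF ln_J] C_pos B(1) J_pos by (intro var_bound_comp) auto
    then show ?thesis using J_pos by (auto intro!: lip_holder lipI)
  qed
  ultimately have "holder_jacobian J" using J_pos J_sum by (simp add: holder_jacobian_def)
  then show j: "is_jacobian_of J \<mu>" using dual shift_invariant_prob by (simp add: is_jacobian_of_def)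
  show "gibbs_jacobian \<mu> = J" unfolding gibbs_jacobian_def using j jacobian_unique by (rule the_equality)
qed

end

section \<open>The curve of equilibrium probabilities in a tangent direction\<close>

lemma square_eq_abs_mult: "(t :: real)\<^sup>2 = \<bar>t\<bar> * \<bar>t\<bar>"
  by (simp add: power2_eq_square)

lemma abs_cube: "\<bar>t :: real\<bar> ^ 3 = \<bar>t\<bar> * (\<bar>t\<bar> * \<bar>t\<bar>)"
  unfolding power3_eq_cube by (rule mult.assoc)

locale tangent_direction = gibbs_measure J C \<rho> \<mu>
  for J :: "'a::finite stream \<Rightarrow> real" and C \<rho> :: real and \<mu> :: "'a stream measure" +
  fixes \<xi> :: "'a stream \<Rightarrow> real"
  assumes xi_lip: "lip \<xi>" and xi_tangent: "\<And>x. ruelle J \<xi> x = 0"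
begin

lemma xi_mean: "(\<integral>x. \<xi> x \<partial>\<mu>) = 0"
  using integral_ruelle_lip[OF xi_lip] by (simp add: xi_tangent)

text \<open>
  $J e^G$ is a Jacobian and $G$ differs from $\theta\xi$ by a coboundary and the constant $-p$; thus $p$
  is the pressure of $\log J + \theta\xi$.
\<close>

definition normalized_tilt :: "real \<Rightarrow> ('a stream \<Rightarrow> real) \<Rightarrow> ('a stream \<Rightarrow> real) \<Rightarrow> real \<Rightarrow> bool" where
  "normalized_tilt \<theta> G u p \<longleftrightarrow> lip G \<and> (\<forall>x. (\<Sum>a\<in>UNIV. J (a ## x) * exp (G (a ## x))) = 1) \<and>
     lip u \<and> (\<forall>x. G x = \<theta> * \<xi> x + u x - u (stl x) - p)"

text \<open>
  From the eigenfunction $1 + g$ and the eigenvalue $1 + m$ of $\varphi \mapsto L(e^{\theta\xi}\varphi)$ take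
  $u = \ln(1+g)$ and $p = \ln(1+m)$. Since $L\xi = 0$, the operator maps $f = e^{\theta\xi} - 1$ and
  \<open>f2\<close>, its part of second order, to the same function. So $g = O(\theta^2)$, and $m = \int f(1+g)\,d\mu$ is
  $\int\!f_2\,d\mu$ up to $O(\theta^3)$.
\<close>

lemma perturbed_jacobian:
  "\<exists>\<theta>\<^sub>0>0. \<exists>K>0. \<forall>\<theta>. \<bar>\<theta>\<bar> < \<theta>\<^sub>0 \<longrightarrow> (\<exists>G u p. normalized_tilt \<theta> G u p \<and>
      (\<forall>x. \<bar>G x - \<theta> * \<xi> x\<bar> \<le> K * \<theta>\<^sup>2) \<and> \<bar>p - \<theta>\<^sup>2 / 2 * (\<integral>x. (\<xi> x)\<^sup>2 \<partial>\<mu>)\<bar> \<le> K * \<bar>\<theta>\<bar> ^ 3)"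
proof -
  obtain B where B: "0 < B" "\<And>x. \<bar>\<xi> x\<bar> \<le> B" using continuous_bounded_stream[OF lip_continuous[OF xi_lip]] by blast
  obtain M where M: "0 \<le> M" "var_bound w M \<xi>" using xi_lip by (rule lipE)
  define V where "V = (\<integral>x. (\<xi> x)\<^sup>2 \<partial>\<mu>)"
  define c where "c = 3 * (B + M) + 1"
  define c2 where "c2 = 3 * B * M"
  define Kg where "Kg = 2 * c2 / (1 - r)"
  define Km where "Km = 3 * B ^ 3 + c * Kg"
  have c: "0 < c" "0 \<le> c2" "0 \<le> Kg" "0 \<le> Km" using B(1) M(1) r_less_1 by (auto simp: c_def c2_def Kg_def Km_def)
  define Kp where "Kp = \<bar>V\<bar> + Km"
  define K where "K = 4 * Kg + 2 * Kp + 2 * Kp\<^sup>2 + Km + 1"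
  have Kp: "0 \<le> Kp" using c by (simp add: Kp_def)
  have K: "0 < K" using c Kp by (auto simp: K_def intro!: add_nonneg_pos add_nonneg_nonneg)
  \<comment> \<open>In this order: \<open>\<theta>\<close> and $\theta\xi$ are at most 1, \<open>f\<close> and \<open>\<delta>\<close> are small enough for the
    fixed point, and \<open>g\<close> and \<open>m\<close> are at most 1/2.\<close>
  define \<theta>\<^sub>0 where "\<theta>\<^sub>0 = Min {1, 1 / B, (1 - r) / (10 * c), (1 - r) / (2 * c2 + 1), 1 / (2 * K)}"
  have \<theta>\<^sub>0: "0 < \<theta>\<^sub>0" using B(1) r_less_1 c K by (auto simp: \<theta>\<^sub>0_def intro!: divide_pos_pos)
  have main: "\<exists>G u p. normalized_tilt \<theta> G u p \<and>
      (\<forall>x. \<bar>G x - \<theta> * \<xi> x\<bar> \<le> K * \<theta>\<^sup>2) \<and> \<bar>p - \<theta>\<^sup>2 / 2 * (\<integral>x. (\<xi> x)\<^sup>2 \<partial>\<mu>)\<bar> \<le> K * \<bar>\<theta>\<bar> ^ 3"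
    if \<theta>: "\<bar>\<theta>\<bar> < \<theta>\<^sub>0" for \<theta>
  proof -
    have t1: "\<bar>\<theta>\<bar> \<le> 1" and tB: "\<bar>\<theta>\<bar> * B \<le> 1" and tc: "10 * (c * \<bar>\<theta>\<bar>) \<le> 1 - r"
      and tc2: "\<bar>\<theta>\<bar> * (2 * c2 + 1) \<le> 1 - r" and tK: "2 * K * \<bar>\<theta>\<bar> \<le> 1"
    proof -
      have "\<bar>\<theta>\<bar> < 1 / B" "\<bar>\<theta>\<bar> < (1 - r) / (10 * c)" "\<bar>\<theta>\<bar> < (1 - r) / (2 * c2 + 1)" "\<bar>\<theta>\<bar> < 1 / (2 * K)" "\<bar>\<theta>\<bar> < 1"
        using \<theta> by (auto simp: \<theta>\<^sub>0_def)
      then show "\<bar>\<theta>\<bar> \<le> 1" "\<bar>\<theta>\<bar> * B \<le> 1" "10 * (c * \<bar>\<theta>\<bar>) \<le> 1 - r" "\<bar>\<theta>\<bar> * (2 * c2 + 1) \<le> 1 - r" "2 * K * \<bar>\<theta>\<bar> \<le> 1"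
        using B(1) c K by (simp_all add: pos_less_divide_eq mult_ac)
    qed
    have t2: "\<theta>\<^sup>2 \<le> \<bar>\<theta>\<bar>" using mult_left_mono[OF t1, of "\<bar>\<theta>\<bar>"] by (simp add: power2_eq_square abs_mult_self_eq)
    have t\<xi>: "\<bar>\<theta> * \<xi> x\<bar> \<le> \<bar>\<theta>\<bar> * B" for x unfolding abs_mult by (intro mult_left_mono B) auto
    have t\<xi>1: "\<bar>\<theta> * \<xi> x\<bar> \<le> 1" for x using t\<xi>[of x] tB by linarith
    define f where "f x = exp (\<theta> * \<xi> x) - 1" for x
    define f2 where "f2 x = exp (\<theta> * \<xi> x) - 1 - \<theta> * \<xi> x" for x
    define \<epsilon> where "\<epsilon> = c * \<bar>\<theta>\<bar>"
    define \<delta> where "\<delta> = c2 * \<theta>\<^sup>2"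
    have M\<theta>: "var_bound w (\<bar>\<theta>\<bar> * M) (\<lambda>x. \<theta> * \<xi> x)" by (rule var_bound_cmult[OF M(2)])
    have "var_bound w (3 * (\<bar>\<theta>\<bar> * M)) f"
      unfolding f_def using exp_lipschitz_unit(1)[OF t\<xi> t\<xi> tB] by (intro var_bound_comp[OF M\<theta>]) auto
    moreover have "3 * (\<bar>\<theta>\<bar> * M) \<le> \<epsilon>" using B(1) M(1) by (simp add: \<epsilon>_def c_def algebra_simps)
    ultimately have f_var: "var_bound w \<epsilon> f" by (rule var_bound_w_mono)
    have f_bd: "\<bar>f x\<bar> \<le> \<epsilon>" for x
    proof -
      have "\<bar>f x\<bar> \<le> 3 * \<bar>\<theta> * \<xi> x\<bar>" unfolding f_def by (rule exp_taylor_bounds(1)[OF t\<xi>1])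
      also have "\<dots> \<le> 3 * (\<bar>\<theta>\<bar> * B)" using t\<xi>[of x] by simp
      also have "\<dots> \<le> \<epsilon>" using B(1) M(1) by (simp add: \<epsilon>_def c_def algebra_simps)
      finally show ?thesis .
    qed
    have "var_bound w (3 * (\<bar>\<theta>\<bar> * B) * (\<bar>\<theta>\<bar> * M)) f2"
      unfolding f2_def using exp_lipschitz_unit(2)[OF t\<xi> t\<xi> tB] B(1) by (intro var_bound_comp[OF M\<theta>]) auto
    moreover have "3 * (\<bar>\<theta>\<bar> * B) * (\<bar>\<theta>\<bar> * M) = \<delta>" unfolding \<delta>_def c2_def square_eq_abs_mult by (simp only: mult_ac)
    ultimately have f2_var: "var_bound w \<delta> f2" by simp
    have Lf: "ruelle J f = ruelle J f2"
    proof -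
      have "f = (\<lambda>x. \<theta> * \<xi> x + f2 x)" by (simp add: f_def f2_def fun_eq_iff)
      then show ?thesis by (simp add: ruelle_add ruelle_cmult xi_tangent)
    qed
    have "0 \<le> \<delta>" using c by (simp add: \<delta>_def)
    then have Lf_var: "var_bound w \<delta> (ruelle J f)"
      unfolding Lf using r_pos r_less_1 by (intro var_bound_w_mono[OF ruelle_contraction[OF f2_var]] mult_left_le_one_le) auto
    have "2 * \<delta> \<le> 2 * c2 * \<bar>\<theta>\<bar>" using mult_left_mono[OF t2, of "2 * c2"] c by (simp add: \<delta>_def)
    also have "\<dots> \<le> 1 - r" using tc2 abs_ge_zero[of \<theta>] by (simp add: algebra_simps del: abs_ge_zero)
    finally have \<delta>2: "2 * \<delta> \<le> 1 - r" .
    have \<epsilon>2: "10 * \<epsilon> \<le> 1 - r" using tc by (simp add: \<epsilon>_def)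
    obtain g where g: "var_bound w (2 * \<delta> / (1 - r)) g" "(\<integral>x. g x \<partial>\<mu>) = 0"
      and eig: "\<And>x. ruelle J (\<lambda>x. (1 + f x) * (1 + g x)) x = (1 + (\<integral>x. f x * (1 + g x) \<partial>\<mu>)) * (1 + g x)"
      using perturbed_eigenfunction[OF f_var f_bd \<epsilon>2 Lf_var \<delta>2] by blast
    define m where "m = (\<integral>x. f x * (1 + g x) \<partial>\<mu>)"
    have lipf: "lip f" and lipf2: "lip f2" and lipg: "lip g"
      using f_var f2_var g(1) by (auto intro: lipI)
    have g_bd: "\<bar>g x\<bar> \<le> Kg * \<theta>\<^sup>2" for x using mean_close[OF g(1), of x] g(2) by (simp add: Kg_def \<delta>_def)
    have K\<theta>: "Kg * \<theta>\<^sup>2 \<le> 1 / 2" "Kp * \<theta>\<^sup>2 \<le> 1 / 2"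
    proof -
      have "2 * K * \<theta>\<^sup>2 \<le> 1" using mult_left_mono[OF t2, of "2 * K"] K tK by linarith
      moreover have "Kg * \<theta>\<^sup>2 \<le> K * \<theta>\<^sup>2" "Kp * \<theta>\<^sup>2 \<le> K * \<theta>\<^sup>2"
        using c Kp by (auto simp: K_def intro!: mult_right_mono)
      ultimately show "Kg * \<theta>\<^sup>2 \<le> 1 / 2" "Kp * \<theta>\<^sup>2 \<le> 1 / 2" by linarith+
    qed
    have m_est: "\<bar>m - \<theta>\<^sup>2 / 2 * V\<bar> \<le> Km * \<bar>\<theta>\<bar> ^ 3"
    proof -
      have "m = (\<integral>x. (\<theta> * \<xi> x + f2 x) + f x * g x \<partial>\<mu>)"
        unfolding m_def by (rule Bochner_Integration.integral_cong) (auto simp: f_def f2_def algebra_simps)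
      also have "\<dots> = (\<integral>x. f2 x \<partial>\<mu>) + (\<integral>x. f x * g x \<partial>\<mu>)"
        using xi_lip by (simp add: lip_integrable lip_add lip_mult lipf lipf2 lipg lip_cmult xi_mean)
      finally have m_eq: "m = (\<integral>x. f2 x \<partial>\<mu>) + (\<integral>x. f x * g x \<partial>\<mu>)" .
      have "\<bar>f x * g x\<bar> \<le> c * Kg * \<bar>\<theta>\<bar> ^ 3" for x
      proof -
        have "\<bar>f x * g x\<bar> \<le> \<epsilon> * (Kg * \<theta>\<^sup>2)"
          unfolding abs_mult using f_bd g_bd c by (intro mult_mono) (auto simp: \<epsilon>_def)
        also have "\<dots> = c * Kg * \<bar>\<theta>\<bar> ^ 3"
          unfolding \<epsilon>_def square_eq_abs_mult abs_cube by (simp only: mult_ac)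
        finally show ?thesis .
      qed
      then have 1: "\<bar>\<integral>x. f x * g x \<partial>\<mu>\<bar> \<le> c * Kg * \<bar>\<theta>\<bar> ^ 3"
        by (intro integral_bound lip_continuous lip_mult lipf lipg)
      have "\<bar>f2 x - \<theta>\<^sup>2 / 2 * (\<xi> x)\<^sup>2\<bar> \<le> 3 * B ^ 3 * \<bar>\<theta>\<bar> ^ 3" for x
      proof -
        have "\<bar>f2 x - (\<theta> * \<xi> x)\<^sup>2 / 2\<bar> \<le> 3 * \<bar>\<theta> * \<xi> x\<bar> ^ 3"
          unfolding f2_def by (rule exp_taylor_bounds(3)[OF t\<xi>1])
        also have "\<dots> \<le> 3 * (\<bar>\<theta>\<bar> * B) ^ 3" by (intro mult_left_mono power_mono t\<xi>) auto
        finally show ?thesis by (simp add: power_mult_distrib mult_ac)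
      qed
      then have "\<bar>(\<integral>x. f2 x \<partial>\<mu>) - (\<integral>x. \<theta>\<^sup>2 / 2 * (\<xi> x)\<^sup>2 \<partial>\<mu>)\<bar> \<le> 3 * B ^ 3 * \<bar>\<theta>\<bar> ^ 3"
        unfolding power2_eq_square[of "\<xi> _"]
        by (intro integral_close lip_continuous lipf2 lip_cmult lip_mult xi_lip) (simp add: power2_eq_square)
      then show ?thesis using 1 by (simp add: m_eq V_def Km_def algebra_simps abs_le_iff)
    qed
    have m_bd: "\<bar>m\<bar> \<le> Kp * \<theta>\<^sup>2"
    proof -
      have "\<bar>\<theta>\<bar> ^ 3 \<le> \<bar>\<theta>\<bar> ^ 2" using t1 by (intro power_decreasing) auto
      then have "Km * \<bar>\<theta>\<bar> ^ 3 \<le> Km * \<theta>\<^sup>2" using c by (intro mult_left_mono) auto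
      moreover have "\<bar>\<theta>\<^sup>2 / 2 * V\<bar> \<le> \<bar>V\<bar> * \<theta>\<^sup>2" by (simp add: abs_mult)
      ultimately show ?thesis using m_est by (simp add: Kp_def algebra_simps)
    qed
    define u where "u x = ln (1 + g x)" for x
    define p where "p = ln (1 + m)"
    define G where "G x = \<theta> * \<xi> x + u x - u (stl x) - p" for x
    have g_half: "\<bar>g x\<bar> \<le> 1 / 2" for x using g_bd[of x] K\<theta> by linarith
    have m_half: "\<bar>m\<bar> \<le> 1 / 2" using m_bd K\<theta> by linarith
    have g1: "1 / 2 \<le> 1 + g x" for x using g_half[of x] by (auto simp: abs_le_iff)
    have m1: "1 / 2 \<le> 1 + m" using m_half by (auto simp: abs_le_iff)
    have lipu: "lip u"
      unfolding u_def using ln_lipschitz[OF _ g1 g1]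
      by (intro lipI[OF var_bound_comp[OF var_bound_add_const[OF g(1), of 1], of ln 2]]) auto
    have lipG: "lip G" unfolding G_def by (intro lip_diff lip_add lip_cmult lip_const lip_stl lipu xi_lip)
    have norm: "(\<Sum>a\<in>UNIV. J (a ## x) * exp (G (a ## x))) = 1" for x
    proof -
      have "exp (G (a ## x)) = (1 + f (a ## x)) * (1 + g (a ## x)) / ((1 + m) * (1 + g x))" for a
        using g1[of x] g1[of "a ## x"] m1 by (simp add: G_def u_def p_def f_def exp_add exp_diff)
      then have "(\<Sum>a\<in>UNIV. J (a ## x) * exp (G (a ## x))) = ruelle J (\<lambda>x. (1 + f x) * (1 + g x)) x / ((1 + m) * (1 + g x))"
        by (simp add: ruelle_def sum_divide_distrib)
      then show ?thesis using g1[of x] m1 by (simp add: eig m_def[symmetric])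
    qed
    have ln_bd: "\<bar>ln (1 + t)\<bar> \<le> 2 * \<bar>t\<bar>" if "\<bar>t\<bar> \<le> 1 / 2" for t :: real
      using ln_lipschitz[of "1 / 2" "1 + t" 1] that by (simp add: abs_le_iff)
    have "\<bar>G x - \<theta> * \<xi> x\<bar> \<le> K * \<theta>\<^sup>2" for x
    proof -
      have "\<bar>u y\<bar> \<le> 2 * (Kg * \<theta>\<^sup>2)" for y
        using ln_bd[OF g_half[of y]] g_bd[of y] by (simp add: u_def)
      note this[of x] this[of "stl x"]
      moreover have "\<bar>p\<bar> \<le> 2 * (Kp * \<theta>\<^sup>2)" using ln_bd[OF m_half] m_bd by (simp add: p_def)
      ultimately have "\<bar>G x - \<theta> * \<xi> x\<bar> \<le> (4 * Kg + 2 * Kp) * \<theta>\<^sup>2" by (simp add: G_def algebra_simps)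
      also have "\<dots> \<le> K * \<theta>\<^sup>2" using c Kp by (intro mult_right_mono) (auto simp: K_def)
      finally show ?thesis .
    qed
    moreover have "\<bar>p - \<theta>\<^sup>2 / 2 * V\<bar> \<le> K * \<bar>\<theta>\<bar> ^ 3"
    proof -
      have "\<bar>p - m\<bar> \<le> 2 * m\<^sup>2" unfolding p_def by (rule abs_ln_one_plus_x_minus_x_bound[OF m_half])
      also have "m\<^sup>2 \<le> (Kp * \<theta>\<^sup>2)\<^sup>2" using power_mono[OF m_bd, of 2] by simp
      also have "(Kp * \<theta>\<^sup>2)\<^sup>2 = Kp\<^sup>2 * (\<bar>\<theta>\<bar> ^ 3 * \<bar>\<theta>\<bar>)"
      proof -
        have "\<bar>\<theta>\<bar> ^ 3 * \<bar>\<theta>\<bar> = \<theta>\<^sup>2 * \<theta>\<^sup>2" unfolding abs_cube square_eq_abs_mult by (simp only: mult_ac)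
        then show ?thesis by (simp only: power2_eq_square mult_ac)
      qed
      also have "\<dots> \<le> Kp\<^sup>2 * (\<bar>\<theta>\<bar> ^ 3 * 1)" using t1 by (intro mult_left_mono) auto
      finally have "\<bar>p - m\<bar> \<le> 2 * Kp\<^sup>2 * \<bar>\<theta>\<bar> ^ 3" by simp
      then have "\<bar>p - \<theta>\<^sup>2 / 2 * V\<bar> \<le> (2 * Kp\<^sup>2 + Km) * \<bar>\<theta>\<bar> ^ 3" using m_est by (simp add: algebra_simps abs_le_iff)
      also have "\<dots> \<le> K * \<bar>\<theta>\<bar> ^ 3" using c Kp by (intro mult_right_mono) (auto simp: K_def)
      finally show ?thesis .
    qed
    moreover have "normalized_tilt \<theta> G u p" using lipG norm lipu G_def by (simp add: normalized_tilt_def)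
    ultimately show ?thesis unfolding V_def by blast
  qed
  show ?thesis using \<theta>\<^sub>0 K main by blast
qed

definition eq_curve :: "real \<Rightarrow> 'a stream measure" where
  "eq_curve \<theta> = equilibrium_prob (\<lambda>x. ln (J x) + \<theta> * \<xi> x)"

lemma eq_curve_gibbs:
  assumes tilt: "normalized_tilt \<theta> G u p"
  shows "\<exists>C'. gibbs_measure (\<lambda>x. J x * exp (G x)) C' \<rho> (eq_curve \<theta>)"
proof -
  have G: "lip G" "\<And>x. (\<Sum>a\<in>UNIV. J (a ## x) * exp (G (a ## x))) = 1"
    and u: "lip u" "\<And>x. G x = \<theta> * \<xi> x + u x - u (stl x) - p"
    using tilt by (auto simp: normalized_tilt_def)
  obtain C' where C': "log_holder_jacobian (\<lambda>x. J x * exp (G x)) C' \<rho>"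
    using log_holder_jacobian_perturb[OF G] by blast
  obtain \<nu> where \<nu>: "borel_prob \<nu>" "is_ruelle_dual (\<lambda>x. J x * exp (G x)) \<nu> \<nu>"
    using log_holder_jacobian.gibbs_measure_exists[OF C'] by blast
  have gm: "gibbs_measure (\<lambda>x. J x * exp (G x)) C' \<rho> \<nu>"
    by (intro gibbs_measure.intro gibbs_measure_axioms.intro C' \<nu>)
  have "eq_curve \<theta> = \<nu>" unfolding eq_curve_def
  proof (rule gibbs_measure.equilibrium_prob_eq[OF gm])
    show "continuous_on UNIV (\<lambda>x. - u x)" by (intro continuous_intros lip_continuous u)
    show "ln (J x) + \<theta> * \<xi> x = ln (J x * exp (G x)) + (- u x) - (- u (stl x)) + p" for x
      by (simp add: ln_mult_pos J_pos u(2))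
  qed
  then show ?thesis using gm by blast
qed

lemma eq_curve_0: "eq_curve 0 = \<mu>"
  unfolding eq_curve_def by (rule equilibrium_prob_eq[of "\<lambda>_. 0" _ 0]) auto

text \<open>
  The logarithms of the two Jacobians differ by \<open>G\<close>, whose \<open>\<mu>\<close>-integral is $-p$.
\<close>

lemma KL_eq_curve:
  assumes card: "CARD('a) \<ge> 2" and tilt: "normalized_tilt \<theta> G u p"
  shows "KL_div \<mu> (eq_curve \<theta>) = p"
proof -
  have G: "lip G" "\<And>x. (\<Sum>a\<in>UNIV. J (a ## x) * exp (G (a ## x))) = 1"
    and u: "lip u" "\<And>x. G x = \<theta> * \<xi> x + u x - u (stl x) - p"
    using tilt by (auto simp: normalized_tilt_def)
  obtain C' where gm: "gibbs_measure (\<lambda>x. J x * exp (G x)) C' \<rho> (eq_curve \<theta>)"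
    using eq_curve_gibbs[OF tilt] by blast
  have "KL_div \<mu> (eq_curve \<theta>) = - (\<integral>x. ln (J x * exp (G x)) \<partial>\<mu>) + (\<integral>x. ln (J x) \<partial>\<mu>)"
    unfolding KL_div_def gibbs_jacobian_eq[OF card] gibbs_measure.gibbs_jacobian_eq[OF gm card] ..
  also have "\<dots> = - (\<integral>x. G x \<partial>\<mu>)"
    using G(1) ln_J_lip by (simp add: ln_mult_pos J_pos lip_integrable)
  also have "(\<integral>x. G x \<partial>\<mu>) = - p"
    unfolding u(2) using u(1) xi_lip integral_stl[OF lip_integrable[OF u(1)]]
    by (simp add: lip_integrable lip_cmult xi_mean)
  finally show ?thesis by simp
qed

theorem KL_expansion:
  assumes card: "CARD('a) \<ge> 2"
  shows "(\<lambda>\<theta>. KL_div \<mu> (eq_curve \<theta>) - \<theta>\<^sup>2 / 2 * (\<integral>x. (\<xi> x)\<^sup>2 \<partial>\<mu>)) \<in> o[at 0](\<lambda>\<theta>. \<theta>\<^sup>2)"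
proof -
  obtain \<theta>\<^sub>0 K where \<theta>\<^sub>0: "0 < \<theta>\<^sub>0" "0 < K" and fam: "\<And>\<theta>. \<bar>\<theta>\<bar> < \<theta>\<^sub>0 \<Longrightarrow> \<exists>G u p. normalized_tilt \<theta> G u p \<and>
      (\<forall>x. \<bar>G x - \<theta> * \<xi> x\<bar> \<le> K * \<theta>\<^sup>2) \<and> \<bar>p - \<theta>\<^sup>2 / 2 * (\<integral>x. (\<xi> x)\<^sup>2 \<partial>\<mu>)\<bar> \<le> K * \<bar>\<theta>\<bar> ^ 3"
    using perturbed_jacobian by blast
  have bd: "\<bar>KL_div \<mu> (eq_curve \<theta>) - \<theta>\<^sup>2 / 2 * (\<integral>x. (\<xi> x)\<^sup>2 \<partial>\<mu>)\<bar> \<le> K * \<bar>\<theta>\<bar> ^ 3" if "\<bar>\<theta>\<bar> < \<theta>\<^sub>0" for \<theta>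
    using fam[OF that] KL_eq_curve[OF card] by blast
  show ?thesis
  proof (rule landau_o.smallI)
    fix e :: real assume e: "e > 0"
    have "\<forall>\<^sub>F \<theta> in at 0. dist \<theta> 0 < min \<theta>\<^sub>0 (e / K)"
      unfolding eventually_at using \<theta>\<^sub>0 e by (intro exI[of _ "min \<theta>\<^sub>0 (e / K)"]) auto
    then show "\<forall>\<^sub>F \<theta> in at 0. norm (KL_div \<mu> (eq_curve \<theta>) - \<theta>\<^sup>2 / 2 * (\<integral>x. (\<xi> x)\<^sup>2 \<partial>\<mu>)) \<le> e * norm (\<theta>\<^sup>2)"
    proof eventually_elim
      case (elim \<theta>)
      then have t: "\<bar>\<theta>\<bar> < \<theta>\<^sub>0" "\<bar>\<theta>\<bar> < e / K" by auto
      have "\<bar>KL_div \<mu> (eq_curve \<theta>) - \<theta>\<^sup>2 / 2 * (\<integral>x. (\<xi> x)\<^sup>2 \<partial>\<mu>)\<bar> \<le> K * \<bar>\<theta>\<bar> ^ 3" by (rule bd[OF t(1)])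
      also have "\<dots> = (K * \<bar>\<theta>\<bar>) * \<theta>\<^sup>2" unfolding square_eq_abs_mult abs_cube by (simp only: mult_ac)
      also have "\<dots> \<le> e * \<theta>\<^sup>2" using t(2) \<theta>\<^sub>0(2) by (intro mult_right_mono) (auto simp: field_simps)
      finally show ?case by simp
    qed
  qed
qed

section \<open>Linear response\<close>

text \<open>
  Apply the invariance of $\mu^\theta$ under its own operator $L_\theta$ to the solution \<open>u\<close> of the Poisson equation:
  $\int\varphi\,d\mu^\theta - \int\varphi\,d\mu = \int (u - Lu)\,d\mu^\theta = \int (L_\theta u - Lu)\,d\mu^\theta
  = \int L((e^G - 1)u)\,d\mu^\theta$, and $e^G - 1 = \theta\xi + O(\theta^2)$.
\<close>

lemma response_first_order:
  "\<exists>\<theta>\<^sub>0>0. \<exists>K>0. \<forall>\<theta> \<phi> u b. \<bar>\<theta>\<bar> < \<theta>\<^sub>0 \<longrightarrow> lip \<phi> \<longrightarrow> poisson_solution u \<phi> \<longrightarrow> (\<forall>x. \<bar>u x\<bar> \<le> b) \<longrightarrow>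
      \<bar>(\<integral>x. \<phi> x \<partial>eq_curve \<theta>) - (\<integral>x. \<phi> x \<partial>\<mu>)\<bar> \<le> K * \<bar>\<theta>\<bar> * b \<and>
      \<bar>(\<integral>x. \<phi> x \<partial>eq_curve \<theta>) - (\<integral>x. \<phi> x \<partial>\<mu>) - \<theta> * (\<integral>x. ruelle J (\<lambda>x. \<xi> x * u x) x \<partial>eq_curve \<theta>)\<bar> \<le> K * \<theta>\<^sup>2 * b"
proof -
  obtain \<theta>\<^sub>1 K where \<theta>\<^sub>1: "0 < \<theta>\<^sub>1" "0 < K" and fam: "\<And>\<theta>. \<bar>\<theta>\<bar> < \<theta>\<^sub>1 \<Longrightarrow> \<exists>G u p. normalized_tilt \<theta> G u p \<and>
      (\<forall>x. \<bar>G x - \<theta> * \<xi> x\<bar> \<le> K * \<theta>\<^sup>2) \<and> \<bar>p - \<theta>\<^sup>2 / 2 * (\<integral>x. (\<xi> x)\<^sup>2 \<partial>\<mu>)\<bar> \<le> K * \<bar>\<theta>\<bar> ^ 3"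
    using perturbed_jacobian by blast
  obtain B where B: "0 < B" "\<And>x. \<bar>\<xi> x\<bar> \<le> B" using continuous_bounded_stream[OF lip_continuous[OF xi_lip]] by blast
  define D where "D = K + B"
  have D: "0 < D" using \<theta>\<^sub>1 B by (simp add: D_def)
  define K' where "K' = 3 * D + 3 * D\<^sup>2 + K"
  define \<theta>\<^sub>0 where "\<theta>\<^sub>0 = min \<theta>\<^sub>1 (min 1 (1 / D))"
  have "0 < \<theta>\<^sub>0" "0 < K'" using \<theta>\<^sub>1 D by (auto simp: \<theta>\<^sub>0_def K'_def intro!: add_pos_pos)
  moreover have "\<bar>(\<integral>x. \<phi> x \<partial>eq_curve \<theta>) - (\<integral>x. \<phi> x \<partial>\<mu>)\<bar> \<le> K' * \<bar>\<theta>\<bar> * b \<and>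
      \<bar>(\<integral>x. \<phi> x \<partial>eq_curve \<theta>) - (\<integral>x. \<phi> x \<partial>\<mu>) - \<theta> * (\<integral>x. ruelle J (\<lambda>x. \<xi> x * u x) x \<partial>eq_curve \<theta>)\<bar> \<le> K' * \<theta>\<^sup>2 * b"
    if \<theta>: "\<bar>\<theta>\<bar> < \<theta>\<^sub>0" and lip\<phi>: "lip \<phi>" and u: "poisson_solution u \<phi>" and b: "\<And>x. \<bar>u x\<bar> \<le> b"
    for \<theta> b :: real and \<phi> u :: "'a stream \<Rightarrow> real"
  proof -
    have lipu: "lip u" and poisson: "\<And>x. u x - ruelle J u x = \<phi> x - (\<integral>x. \<phi> x \<partial>\<mu>)"
      using u by (auto simp: poisson_solution_def)
    have t: "\<bar>\<theta>\<bar> < \<theta>\<^sub>1" "\<bar>\<theta>\<bar> \<le> 1" "D * \<bar>\<theta>\<bar> \<le> 1" using \<theta> D by (auto simp: \<theta>\<^sub>0_def field_simps)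
    obtain G v p where tilt: "normalized_tilt \<theta> G v p" and G\<xi>: "\<And>x. \<bar>G x - \<theta> * \<xi> x\<bar> \<le> K * \<theta>\<^sup>2"
      using fam[OF t(1)] by blast
    then have G: "lip G" by (simp add: normalized_tilt_def)
    obtain C' where gm: "gibbs_measure (\<lambda>x. J x * exp (G x)) C' \<rho> (eq_curve \<theta>)"
      using eq_curve_gibbs[OF tilt] by blast
    interpret \<nu>: gibbs_measure "\<lambda>x. J x * exp (G x)" C' \<rho> "eq_curve \<theta>" by (rule gm)
    have t2: "\<theta>\<^sup>2 \<le> \<bar>\<theta>\<bar>" using mult_left_mono[OF t(2), of "\<bar>\<theta>\<bar>"] by (simp add: power2_eq_square abs_mult_self_eq)
    have G_bd: "\<bar>G x\<bar> \<le> D * \<bar>\<theta>\<bar>" for x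
    proof -
      have "\<bar>\<theta> * \<xi> x\<bar> \<le> \<bar>\<theta>\<bar> * B" unfolding abs_mult by (intro mult_left_mono B) auto
      moreover have "K * \<theta>\<^sup>2 \<le> K * \<bar>\<theta>\<bar>" using t2 \<theta>\<^sub>1(2) by (intro mult_left_mono) auto
      ultimately show ?thesis using G\<xi>[of x] by (simp add: D_def algebra_simps)
    qed
    have G1: "\<bar>G x\<bar> \<le> 1" for x using G_bd[of x] t(3) by linarith
    have e1: "\<bar>exp (G x) - 1\<bar> \<le> K' * \<bar>\<theta>\<bar>" for x
    proof -
      have "\<bar>exp (G x) - 1\<bar> \<le> 3 * \<bar>G x\<bar>" by (rule exp_taylor_bounds(1)[OF G1])
      also have "\<dots> \<le> 3 * D * \<bar>\<theta>\<bar>" using G_bd[of x] by simp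
      also have "\<dots> \<le> K' * \<bar>\<theta>\<bar>" using \<theta>\<^sub>1(2) by (intro mult_right_mono) (auto simp: K'_def)
      finally show ?thesis .
    qed
    have e2: "\<bar>exp (G x) - 1 - \<theta> * \<xi> x\<bar> \<le> K' * \<theta>\<^sup>2" for x
    proof -
      have "(G x)\<^sup>2 \<le> (D * \<bar>\<theta>\<bar>)\<^sup>2" using power_mono[OF G_bd[of x], of 2] by simp
      then have "3 * (G x)\<^sup>2 \<le> 3 * D\<^sup>2 * \<theta>\<^sup>2" by (simp add: power_mult_distrib)
      then have "\<bar>exp (G x) - 1 - \<theta> * \<xi> x\<bar> \<le> (3 * D\<^sup>2 + K) * \<theta>\<^sup>2"
        using exp_taylor_bounds(2)[OF G1[of x]] G\<xi>[of x] by (simp add: distrib_right)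
      also have "\<dots> \<le> K' * \<theta>\<^sup>2" using D by (intro mult_right_mono) (auto simp: K'_def)
      finally show ?thesis .
    qed
    have cG: "continuous_on UNIV G" and cu: "continuous_on UNIV u" and cxi: "continuous_on UNIV \<xi>"
      by (intro lip_continuous G lipu xi_lip)+
    have diff: "(\<integral>x. \<phi> x \<partial>eq_curve \<theta>) - (\<integral>x. \<phi> x \<partial>\<mu>) = (\<integral>x. ruelle J (\<lambda>x. (exp (G x) - 1) * u x) x \<partial>eq_curve \<theta>)"
    proof -
      have "(\<integral>x. \<phi> x \<partial>eq_curve \<theta>) - (\<integral>x. \<phi> x \<partial>\<mu>) = (\<integral>x. \<phi> x - (\<integral>x. \<phi> x \<partial>\<mu>) \<partial>eq_curve \<theta>)"
        using \<nu>.integrable_continuous[OF lip_continuous[OF lip\<phi>]] by simp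
      also have "\<dots> = (\<integral>x. u x - ruelle J u x \<partial>eq_curve \<theta>)" by (simp add: poisson)
      also have "\<dots> = (\<integral>x. ruelle (\<lambda>x. J x * exp (G x)) u x \<partial>eq_curve \<theta>) - (\<integral>x. ruelle J u x \<partial>eq_curve \<theta>)"
        using \<nu>.integrable_continuous[OF cu] \<nu>.integrable_continuous[OF lip_continuous[OF lip_ruelle[OF lipu]]]
        by (simp add: \<nu>.integral_ruelle[OF cu])
      also have "\<dots> = (\<integral>x. ruelle (\<lambda>x. J x * exp (G x)) u x - ruelle J u x \<partial>eq_curve \<theta>)"
        by (intro Bochner_Integration.integral_diff[symmetric] \<nu>.integrable_continuous continuous_on_ruelle
            J_continuous cu continuous_intros cG)
      also have "\<dots> = (\<integral>x. ruelle J (\<lambda>x. (exp (G x) - 1) * u x) x \<partial>eq_curve \<theta>)"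
        by (simp add: ruelle_def algebra_simps flip: sum_subtractf)
      finally show ?thesis .
    qed
    have 1: "\<bar>(\<integral>x. \<phi> x \<partial>eq_curve \<theta>) - (\<integral>x. \<phi> x \<partial>\<mu>)\<bar> \<le> K' * \<bar>\<theta>\<bar> * b"
      unfolding diff
    proof (rule \<nu>.integral_bound)
      show "continuous_on UNIV (ruelle J (\<lambda>x. (exp (G x) - 1) * u x))"
        by (intro continuous_on_ruelle J_continuous continuous_intros cG cu)
      show "\<bar>ruelle J (\<lambda>x. (exp (G x) - 1) * u x) x\<bar> \<le> K' * \<bar>\<theta>\<bar> * b" for x
        by (intro ruelle_bound) (auto simp: abs_mult intro!: mult_mono e1 b order_trans[OF abs_ge_zero e1])
    qed
    have "(\<integral>x. \<phi> x \<partial>eq_curve \<theta>) - (\<integral>x. \<phi> x \<partial>\<mu>) - \<theta> * (\<integral>x. ruelle J (\<lambda>x. \<xi> x * u x) x \<partial>eq_curve \<theta>)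
        = (\<integral>x. ruelle J (\<lambda>x. (exp (G x) - 1) * u x) x - \<theta> * ruelle J (\<lambda>x. \<xi> x * u x) x \<partial>eq_curve \<theta>)"
      unfolding diff by (subst Bochner_Integration.integral_diff)
        (auto intro!: \<nu>.integrable_continuous continuous_on_ruelle J_continuous continuous_intros cG cu cxi)
    also have "\<dots> = (\<integral>x. ruelle J (\<lambda>x. (exp (G x) - 1 - \<theta> * \<xi> x) * u x) x \<partial>eq_curve \<theta>)"
      by (simp add: ruelle_def algebra_simps sum_distrib_left flip: sum_subtractf)
    finally have diff2: "(\<integral>x. \<phi> x \<partial>eq_curve \<theta>) - (\<integral>x. \<phi> x \<partial>\<mu>) - \<theta> * (\<integral>x. ruelle J (\<lambda>x. \<xi> x * u x) x \<partial>eq_curve \<theta>)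
        = (\<integral>x. ruelle J (\<lambda>x. (exp (G x) - 1 - \<theta> * \<xi> x) * u x) x \<partial>eq_curve \<theta>)" .
    have 2: "\<bar>(\<integral>x. \<phi> x \<partial>eq_curve \<theta>) - (\<integral>x. \<phi> x \<partial>\<mu>) - \<theta> * (\<integral>x. ruelle J (\<lambda>x. \<xi> x * u x) x \<partial>eq_curve \<theta>)\<bar> \<le> K' * \<theta>\<^sup>2 * b"
      unfolding diff2
    proof (rule \<nu>.integral_bound)
      show "continuous_on UNIV (ruelle J (\<lambda>x. (exp (G x) - 1 - \<theta> * \<xi> x) * u x))"
        by (intro continuous_on_ruelle J_continuous continuous_intros cG cu cxi)
      show "\<bar>ruelle J (\<lambda>x. (exp (G x) - 1 - \<theta> * \<xi> x) * u x) x\<bar> \<le> K' * \<theta>\<^sup>2 * b" for x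
        by (intro ruelle_bound) (auto simp: abs_mult intro!: mult_mono e2 b order_trans[OF abs_ge_zero e2])
    qed
    show ?thesis using 1 2 by blast
  qed
  ultimately show ?thesis by blast
qed

text \<open>
  The first-order term still contains $\mu^\theta$; applying the weaker estimate once more, to
  $L(\xi u)$, replaces it by \<open>\<mu>\<close> at a cost of order $\theta^2$.
\<close>

lemma linear_response:
  assumes \<phi>: "lip \<phi>" and u: "poisson_solution u \<phi>"
  shows "((\<lambda>\<theta>. \<integral>x. \<phi> x \<partial>eq_curve \<theta>) has_real_derivative (\<integral>x. \<xi> x * u x \<partial>\<mu>)) (at 0)"
proof -
  have lipu: "lip u" using u by (simp add: poisson_solution_def)
  obtain \<theta>\<^sub>0 K where \<theta>\<^sub>0: "0 < \<theta>\<^sub>0" "0 < K" and resp: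
    "\<forall>\<theta> \<phi> u b. \<bar>\<theta>\<bar> < \<theta>\<^sub>0 \<longrightarrow> lip \<phi> \<longrightarrow> poisson_solution u \<phi> \<longrightarrow> (\<forall>x. \<bar>u x\<bar> \<le> b) \<longrightarrow>
      \<bar>(\<integral>x. \<phi> x \<partial>eq_curve \<theta>) - (\<integral>x. \<phi> x \<partial>\<mu>)\<bar> \<le> K * \<bar>\<theta>\<bar> * b \<and>
      \<bar>(\<integral>x. \<phi> x \<partial>eq_curve \<theta>) - (\<integral>x. \<phi> x \<partial>\<mu>) - \<theta> * (\<integral>x. ruelle J (\<lambda>x. \<xi> x * u x) x \<partial>eq_curve \<theta>)\<bar> \<le> K * \<theta>\<^sup>2 * b"
    using response_first_order by blast
  obtain b where b: "0 < b" "\<And>x. \<bar>u x\<bar> \<le> b" using continuous_bounded_stream[OF lip_continuous[OF lipu]] by blast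
  define \<phi>' where "\<phi>' = ruelle J (\<lambda>x. \<xi> x * u x)"
  have \<phi>': "lip \<phi>'" unfolding \<phi>'_def by (intro lip_ruelle lip_mult xi_lip lipu)
  have \<phi>'_mean: "(\<integral>x. \<phi>' x \<partial>\<mu>) = (\<integral>x. \<xi> x * u x \<partial>\<mu>)"
    unfolding \<phi>'_def by (intro integral_ruelle_lip lip_mult xi_lip lipu)
  obtain M where "var_bound w M \<phi>'" using \<phi>' by (auto simp: lip_def)
  then obtain u' b' where u': "poisson_solution u' \<phi>'" "\<And>x. \<bar>u' x\<bar> \<le> b'"
    using poisson_equation by metis
  define b2 where "b2 = K * (b + b')"
  have "0 \<le> b'" using u'(2) abs_ge_zero order_trans by blast
  then have b2: "0 < b2" using b \<theta>\<^sub>0 by (auto simp: b2_def intro!: mult_pos_pos)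
  define I where "I \<theta> = (\<integral>x. \<phi> x \<partial>eq_curve \<theta>)" for \<theta>
  define D where "D = (\<integral>x. \<xi> x * u x \<partial>\<mu>)"
  have I0: "I 0 = (\<integral>x. \<phi> x \<partial>\<mu>)" by (simp add: I_def eq_curve_0)
  have est: "\<bar>I \<theta> - I 0 - \<theta> * D\<bar> \<le> b2 * \<theta>\<^sup>2" if t: "\<bar>\<theta>\<bar> < \<theta>\<^sub>0" for \<theta>
  proof -
    have "\<bar>I \<theta> - I 0 - \<theta> * (\<integral>x. \<phi>' x \<partial>eq_curve \<theta>)\<bar> \<le> K * \<theta>\<^sup>2 * b"
      using resp[rule_format, OF t \<phi> u b(2)] by (simp add: I_def[of \<theta>] I0 \<phi>'_def)
    moreover have "\<bar>\<theta> * ((\<integral>x. \<phi>' x \<partial>eq_curve \<theta>) - D)\<bar> \<le> \<bar>\<theta>\<bar> * (K * \<bar>\<theta>\<bar> * b')"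
      unfolding abs_mult using resp[rule_format, OF t \<phi>' u'] by (intro mult_left_mono) (auto simp: D_def \<phi>'_mean)
    moreover have "\<bar>\<theta>\<bar> * (K * \<bar>\<theta>\<bar> * b') = K * \<theta>\<^sup>2 * b'" unfolding square_eq_abs_mult by (simp only: mult_ac)
    moreover have "I \<theta> - I 0 - \<theta> * D = (I \<theta> - I 0 - \<theta> * (\<integral>x. \<phi>' x \<partial>eq_curve \<theta>)) + \<theta> * ((\<integral>x. \<phi>' x \<partial>eq_curve \<theta>) - D)"
      by (simp add: right_diff_distrib)
    ultimately have "\<bar>I \<theta> - I 0 - \<theta> * D\<bar> \<le> K * \<theta>\<^sup>2 * b + K * \<theta>\<^sup>2 * b'" by linarith
    then show ?thesis by (simp add: b2_def algebra_simps)
  qed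
  have "((\<lambda>\<theta>. (I \<theta> - I 0) / \<theta>) \<longlongrightarrow> D) (at 0)"
  proof (rule LIM_I)
    fix e :: real assume e: "e > 0"
    have "norm ((I \<theta> - I 0) / \<theta> - D) < e" if "\<theta> \<noteq> 0" "norm (\<theta> - 0) < min \<theta>\<^sub>0 (e / b2)" for \<theta>
    proof -
      have t: "\<bar>\<theta>\<bar> < \<theta>\<^sub>0" "b2 * \<bar>\<theta>\<bar> < e" using that(2) b2 by (auto simp: field_simps)
      have "\<bar>(I \<theta> - I 0) / \<theta> - D\<bar> = \<bar>I \<theta> - I 0 - \<theta> * D\<bar> / \<bar>\<theta>\<bar>"
        using that(1) by (simp add: diff_divide_distrib flip: abs_divide)
      also have "\<dots> \<le> b2 * \<theta>\<^sup>2 / \<bar>\<theta>\<bar>" by (intro divide_right_mono est t) auto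
      also have "\<dots> = b2 * \<bar>\<theta>\<bar>" unfolding square_eq_abs_mult using that(1) by (simp del: abs_mult_self_eq)
      finally show ?thesis using t(2) by simp
    qed
    then show "\<exists>s>0. \<forall>\<theta>. \<theta> \<noteq> 0 \<and> norm (\<theta> - 0) < s \<longrightarrow> norm ((I \<theta> - I 0) / \<theta> - D) < e"
      using \<theta>\<^sub>0 e b2 by (intro exI[of _ "min \<theta>\<^sub>0 (e / b2)"]) auto
  qed
  then show ?thesis unfolding has_field_derivative_iff by (simp add: I_def D_def)
qed

end

section \<open>Fisher information\<close>

lemma birkhoff_sum_eq: "birkhoff_sum f n x = (\<Sum>k<n. f (sdrop k x))"
  by (induction n arbitrary: x) (simp_all add: sum.lessThan_Suc_shift del: sum.lessThan_Suc)

lemma (in log_holder_jacobian) lip_birkhoff_sum: "lip f \<Longrightarrow> lip (birkhoff_sum f n)"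
proof (induction n)
  case 0
  have "birkhoff_sum f 0 = (\<lambda>_. 0)" by (rule ext) simp
  then show ?case by simp
next
  case (Suc n)
  then have "lip (\<lambda>x. f x + birkhoff_sum f n (stl x))" by (intro lip_add lip_stl)
  moreover have "birkhoff_sum f (Suc n) = (\<lambda>x. f x + birkhoff_sum f n (stl x))" by (rule ext) simp
  ultimately show ?case by simp
qed

lemma (in log_holder_jacobian) lip_sdrop: "lip f \<Longrightarrow> lip (\<lambda>x. f (sdrop n x))"
proof (induction n)
  case (Suc n)
  have "(\<lambda>x. f (sdrop (Suc n) x)) = (\<lambda>x. (\<lambda>y. f (sdrop n y)) (stl x))" by simp
  then show ?case using lip_stl[OF Suc.IH[OF Suc.prems]] by simp
qed simp

context tangent_direction
begin

lemma xi_birkhoff_distortion: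
  "\<exists>D. \<forall>n x y. stake n x = stake n y \<longrightarrow> \<bar>birkhoff_sum \<xi> n x - birkhoff_sum \<xi> n y\<bar> \<le> D"
proof -
  obtain M where M: "0 \<le> M" "var_bound w M \<xi>" using xi_lip by (rule lipE)
  define K where "K = M * Q"
  have K: "0 \<le> K" "var_bound (\<lambda>n. \<rho> ^ n) K \<xi>"
    using var_bound_imp_rho[OF M(2)] M(1) Q_pos by (auto simp: K_def)
  define D where "D = K / (1 - \<rho>)"
  have D: "0 \<le> D" "K = D * (1 - \<rho>)" using K rho_less by (auto simp: D_def)
  have "\<bar>birkhoff_sum \<xi> n x - birkhoff_sum \<xi> n y\<bar> \<le> D * (1 - \<rho> ^ n)" if "stake n x = stake n y" for n x y
    using that
  proof (induction n arbitrary: x y)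
    case (Suc n)
    have "\<bar>\<xi> x - \<xi> y\<bar> \<le> K * \<rho> ^ Suc n" by (rule var_boundD[OF K(2) Suc.prems])
    also have "\<dots> \<le> K * \<rho> ^ n" using K rho_pos rho_less by (intro mult_left_mono power_decreasing) auto
    also have "\<dots> = D * (\<rho> ^ n - \<rho> ^ Suc n)" unfolding D(2) by (simp add: algebra_simps)
    finally have 1: "\<bar>\<xi> x - \<xi> y\<bar> \<le> D * (\<rho> ^ n - \<rho> ^ Suc n)" .
    have 2: "\<bar>birkhoff_sum \<xi> n (stl x) - birkhoff_sum \<xi> n (stl y)\<bar> \<le> D * (1 - \<rho> ^ n)"
      using Suc by simp
    have "\<bar>birkhoff_sum \<xi> (Suc n) x - birkhoff_sum \<xi> (Suc n) y\<bar> \<le> D * (\<rho> ^ n - \<rho> ^ Suc n) + D * (1 - \<rho> ^ n)"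
      unfolding birkhoff_sum.simps using 1 2 by linarith
    then show ?case by (simp add: algebra_simps)
  qed simp
  moreover have "D * (1 - \<rho> ^ n) \<le> D * 1" for n using D rho_pos by (intro mult_left_mono) auto
  ultimately show ?thesis by (metis mult.right_neutral order_trans)
qed

text \<open>
  $L^m$ of the indicator of a cylinder of length $m$ has a seminorm proportional to the measure of
  the cylinder, with a constant that does not depend on $m$.
\<close>

lemma jac_prod_var_bound: "var_bound w (exp Q * Q / w 0 * measure \<mu> (cyl v)) (jac_prod J v)"
proof (rule var_boundI)
  fix n and x y :: "'a stream" assume s: "stake n x = stake n y"
  have *: "jac_prod J v x - jac_prod J v y \<le> exp Q * measure \<mu> (cyl v) * (Q * \<rho> ^ n)" if s: "stake n x = stake n y" for x y
  proof -
    have "jac_prod J v x - jac_prod J v y \<le> jac_prod J v x * (ln (jac_prod J v x) - ln (jac_prod J v y))"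
      using exp_diff_le[of "ln (jac_prod J v x)" "ln (jac_prod J v y)"] by (simp add: jac_prod_pos)
    also have "\<dots> \<le> jac_prod J v x * (Q * \<rho> ^ n)"
      using jac_prod_distortion[OF s, of v] jac_prod_pos[of v x] by (intro mult_left_mono) (auto simp: abs_le_iff)
    also have "\<dots> \<le> exp Q * measure \<mu> (cyl v) * (Q * \<rho> ^ n)"
      using jac_prod_le_measure[of v x] Q_pos rho_pos by (intro mult_right_mono) auto
    finally show ?thesis .
  qed
  have "\<bar>jac_prod J v x - jac_prod J v y\<bar> \<le> exp Q * measure \<mu> (cyl v) * (Q * \<rho> ^ n)"
    using *[OF s] *[OF s[symmetric]] by (simp add: abs_le_iff)
  also have "\<dots> \<le> exp Q * measure \<mu> (cyl v) * (Q * (w n / w 0))"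
    using w_ge[of n] w_pos[of 0] Q_pos by (intro mult_left_mono) (auto simp: field_simps)
  finally show "\<bar>jac_prod J v x - jac_prod J v y\<bar> \<le> exp Q * Q / w 0 * measure \<mu> (cyl v) * w n"
    by (simp add: mult_ac)
qed

text \<open>
  The first $m$ terms of $u = \sum_k (L^k 1_C - \mu(C))$ pair with \<open>\<xi>\<close> to $\int_C S_m\xi\,d\mu$, and
  \<open>S\<^sub>m \<xi>\<close> has bounded oscillation on \<open>C\<close>. The remaining terms form the solution \<open>u'\<close> for
  $L^m 1_C$, whose size is of order $\mu(C)$. Hence \<open>D\<close> is uniform over all cylinders.
\<close>

lemma cylinder_poisson_solution:
  "\<exists>D. \<forall>v. \<exists>u. poisson_solution u (indicator (cyl v)) \<and>
     (\<forall>x\<in>cyl v. \<bar>(\<integral>x. \<xi> x * u x \<partial>\<mu>) - measure \<mu> (cyl v) * birkhoff_sum \<xi> (length v) x\<bar> \<le> D * measure \<mu> (cyl v))"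
proof -
  obtain D1 where D1: "\<And>n x y. stake n x = stake n y \<Longrightarrow> \<bar>birkhoff_sum \<xi> n x - birkhoff_sum \<xi> n y\<bar> \<le> D1"
    using xi_birkhoff_distortion by blast
  obtain B where B: "0 < B" "\<And>x. \<bar>\<xi> x\<bar> \<le> B" using continuous_bounded_stream[OF lip_continuous[OF xi_lip]] by blast
  define D where "D = D1 + B * (exp Q * Q / w 0 / (1 - r))"
  have "\<exists>u. poisson_solution u (indicator (cyl v)) \<and>
     (\<forall>x\<in>cyl v. \<bar>(\<integral>x. \<xi> x * u x \<partial>\<mu>) - measure \<mu> (cyl v) * birkhoff_sum \<xi> (length v) x\<bar> \<le> D * measure \<mu> (cyl v))"
    for v
  proof -
    define I where "I = (indicator (cyl v) :: 'a stream \<Rightarrow> real)"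
    define p where "p = measure \<mu> (cyl v)"
    define l where "l = length v"
    have lipI': "lip I" unfolding I_def by (rule lip_indicator_cyl)
    have Ip: "(\<integral>x. I x \<partial>\<mu>) = p" by (simp add: I_def p_def)
    have jp: "(\<integral>x. jac_prod J v x \<partial>\<mu>) = p" by (simp add: p_def measure_cyl)
    obtain u' where lipu': "lip u'" and u': "\<And>x. \<bar>u' x\<bar> \<le> exp Q * Q / w 0 * p / (1 - r)"
      "\<And>x. u' x - ruelle J u' x = jac_prod J v x - p"
      using poisson_equation[OF jac_prod_var_bound[of v]] unfolding poisson_solution_def jp p_def[symmetric] by metis
    define s where "s x = (\<Sum>k<l. (ruelle J ^^ k) I x)" for x
    define u where "u x = (s x - real l * p) + u' x" for x
    have lips: "lip s" unfolding s_def by (intro lip_sum lip_ruelle_pow lipI') auto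
    have lipu: "lip u" unfolding u_def by (intro lip_add lip_diff lips lip_const lipu')
    have Ls: "ruelle J s x = s x - I x + jac_prod J v x" for x
    proof -
      have "ruelle J s x = (\<Sum>k<l. (ruelle J ^^ Suc k) I x)"
      proof -
        have "ruelle J s x = (\<Sum>a\<in>UNIV. \<Sum>k<l. J (a ## x) * (ruelle J ^^ k) I (a ## x))"
          by (simp add: ruelle_def[of J s] s_def sum_distrib_left)
        also have "\<dots> = (\<Sum>k<l. \<Sum>a\<in>UNIV. J (a ## x) * (ruelle J ^^ k) I (a ## x))"
          by (rule sum.swap)
        finally show ?thesis by (simp add: ruelle_def[of J "(ruelle J ^^ _) I"])
      qed
      also have "\<dots> = (\<Sum>k<l. (ruelle J ^^ Suc k) I x - (ruelle J ^^ k) I x) + s x"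
        unfolding s_def by (simp add: sum_subtractf)
      also have "(\<Sum>k<l. (ruelle J ^^ Suc k) I x - (ruelle J ^^ k) I x) = (ruelle J ^^ l) I x - (ruelle J ^^ 0) I x"
        by (rule sum_lessThan_telescope)
      also have "(ruelle J ^^ l) I x = jac_prod J v x" unfolding I_def l_def by (rule ruelle_pow_indicator_cyl)
      finally show ?thesis by simp
    qed
    have poisson: "u x - ruelle J u x = I x - p" for x
    proof -
      have "ruelle J u x = (ruelle J s x - real l * p) + ruelle J u' x"
        unfolding u_def by (simp add: ruelle_add ruelle_diff)
      then show ?thesis using Ls[of x] u'(2)[of x] by (simp add: u_def)
    qed
    have shifted: "(\<integral>x. \<xi> x * (ruelle J ^^ k) I x \<partial>\<mu>) = (\<integral>x. \<xi> (sdrop k x) * I x \<partial>\<mu>)" for k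
      unfolding ruelle_pow_mult_sdrop[symmetric]
      by (intro integral_ruelle_pow lip_continuous lip_mult lip_sdrop xi_lip lipI')
    have "(\<integral>x. \<xi> x * u x \<partial>\<mu>) = (\<integral>x. (\<Sum>k<l. \<xi> x * (ruelle J ^^ k) I x) - real l * p * \<xi> x + \<xi> x * u' x \<partial>\<mu>)"
      by (rule Bochner_Integration.integral_cong) (simp_all add: u_def s_def algebra_simps sum_distrib_left)
    also have "\<dots> = (\<integral>x. (\<Sum>k<l. \<xi> x * (ruelle J ^^ k) I x) \<partial>\<mu>) + (\<integral>x. \<xi> x * u' x \<partial>\<mu>)"
      using xi_lip lipI' lipu' by (simp add: lip_integrable lip_mult lip_sum lip_ruelle_pow lip_diff lip_cmult xi_mean)
    also have "(\<integral>x. (\<Sum>k<l. \<xi> x * (ruelle J ^^ k) I x) \<partial>\<mu>) = (\<Sum>k<l. \<integral>x. \<xi> (sdrop k x) * I x \<partial>\<mu>)"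
      using xi_lip lipI' by (simp add: lip_integrable lip_mult lip_ruelle_pow shifted)
    also have "\<dots> = (\<integral>x. birkhoff_sum \<xi> l x * I x \<partial>\<mu>)"
      unfolding birkhoff_sum_eq sum_distrib_right
      by (rule Bochner_Integration.integral_sum[symmetric]) (intro lip_integrable lip_mult lip_sdrop xi_lip lipI')
    finally have xu: "(\<integral>x. \<xi> x * u x \<partial>\<mu>) = (\<integral>x. birkhoff_sum \<xi> l x * I x \<partial>\<mu>) + (\<integral>x. \<xi> x * u' x \<partial>\<mu>)" .
    have "\<bar>(\<integral>x. \<xi> x * u x \<partial>\<mu>) - p * birkhoff_sum \<xi> l x\<bar> \<le> D * p" if x: "x \<in> cyl v" for x
    proof -
      have I01: "\<bar>(birkhoff_sum \<xi> l y - birkhoff_sum \<xi> l x) * I y\<bar> \<le> D1 * I y" for y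
      proof (cases "y \<in> cyl v")
        case True
        then have "stake l y = stake l x" using x by (simp add: cyl_def l_def)
        then show ?thesis using True D1[of l y x] by (simp add: I_def)
      qed (simp add: I_def)
      have "(\<integral>y. birkhoff_sum \<xi> l y * I y \<partial>\<mu>) - p * birkhoff_sum \<xi> l x
          = (\<integral>y. (birkhoff_sum \<xi> l y - birkhoff_sum \<xi> l x) * I y \<partial>\<mu>)"
        using lip_integrable[OF lip_mult[OF lip_birkhoff_sum[OF xi_lip, of l] lipI']] lip_integrable[OF lipI']
        by (simp add: left_diff_distrib Ip)
      moreover have "\<bar>\<integral>y. (birkhoff_sum \<xi> l y - birkhoff_sum \<xi> l x) * I y \<partial>\<mu>\<bar> \<le> (\<integral>y. D1 * I y \<partial>\<mu>)"
      proof -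
        have int: "integrable \<mu> (\<lambda>y. (birkhoff_sum \<xi> l y - birkhoff_sum \<xi> l x) * I y)"
          by (intro lip_integrable lip_mult lip_diff lip_birkhoff_sum xi_lip lip_const lipI')
        have "\<bar>\<integral>y. (birkhoff_sum \<xi> l y - birkhoff_sum \<xi> l x) * I y \<partial>\<mu>\<bar>
            \<le> (\<integral>y. \<bar>(birkhoff_sum \<xi> l y - birkhoff_sum \<xi> l x) * I y\<bar> \<partial>\<mu>)" by (rule integral_abs_bound)
        also have "\<dots> \<le> (\<integral>y. D1 * I y \<partial>\<mu>)"
          by (intro integral_mono integrable_abs int lip_integrable lip_cmult lipI' I01)
        finally show ?thesis .
      qed
      moreover have "(\<integral>y. D1 * I y \<partial>\<mu>) = D1 * p" using lip_integrable[OF lipI'] by (simp add: Ip)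
      moreover have "\<bar>\<integral>x. \<xi> x * u' x \<partial>\<mu>\<bar> \<le> B * (exp Q * Q / w 0 * p / (1 - r))"
      proof (intro integral_bound lip_continuous lip_mult xi_lip lipu')
        show "\<bar>\<xi> x * u' x\<bar> \<le> B * (exp Q * Q / w 0 * p / (1 - r))" for x
          unfolding abs_mult using B(1) by (intro mult_mono B(2) u'(1)) simp_all
      qed
      moreover have "D1 * p + B * (exp Q * Q / w 0 * p / (1 - r)) = D * p"
        by (simp add: D_def algebra_simps)
      ultimately show ?thesis unfolding xu by linarith
    qed
    moreover have "poisson_solution u (indicator (cyl v))"
      using lipu poisson by (simp add: poisson_solution_def I_def p_def)
    ultimately show ?thesis unfolding p_def l_def by blast
  qed
  then show ?thesis by blast
qed

lemma eq_curve_borel_prob: "\<exists>\<theta>\<^sub>0>0. \<forall>\<theta>. \<bar>\<theta>\<bar> < \<theta>\<^sub>0 \<longrightarrow> borel_prob (eq_curve \<theta>)"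
proof -
  obtain \<theta>\<^sub>0 where "0 < \<theta>\<^sub>0" and "\<And>\<theta>. \<bar>\<theta>\<bar> < \<theta>\<^sub>0 \<Longrightarrow> \<exists>G u p. normalized_tilt \<theta> G u p"
    using perturbed_jacobian by blast
  then show ?thesis using eq_curve_gibbs gibbs_measure.axioms(2) by blast
qed

lemma log_cylinder_derivative:
  assumes "poisson_solution u (indicator (cyl v))"
  shows "((\<lambda>\<theta>. ln (measure (eq_curve \<theta>) (cyl v))) has_real_derivative (\<integral>x. \<xi> x * u x \<partial>\<mu>) / measure \<mu> (cyl v)) (at 0)"
proof -
  obtain \<theta>\<^sub>0 where \<theta>\<^sub>0: "0 < \<theta>\<^sub>0" "\<And>\<theta>. \<bar>\<theta>\<bar> < \<theta>\<^sub>0 \<Longrightarrow> borel_prob (eq_curve \<theta>)" using eq_curve_borel_prob by blast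
  define E where "E \<theta> = (\<integral>x. (indicator (cyl v) x :: real) \<partial>eq_curve \<theta>)" for \<theta>
  have E: "(E has_real_derivative (\<integral>x. \<xi> x * u x \<partial>\<mu>)) (at 0)"
    unfolding E_def[abs_def] by (rule linear_response[OF lip_indicator_cyl assms])
  have E0: "E 0 = measure \<mu> (cyl v)" by (simp add: E_def eq_curve_0)
  then have "0 < E 0" using measure_cyl_pos by simp
  then have "((\<lambda>\<theta>. ln (E \<theta>)) has_real_derivative (1 / E 0) * (\<integral>x. \<xi> x * u x \<partial>\<mu>)) (at 0)"
    by (intro DERIV_chain2[OF _ E]) (auto intro!: derivative_eq_intros)
  moreover have "ln (E \<theta>) = ln (measure (eq_curve \<theta>) (cyl v))" if "\<theta> \<in> {- \<theta>\<^sub>0<..<\<theta>\<^sub>0}" for \<theta>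
  proof -
    interpret \<nu>: borel_prob "eq_curve \<theta>" using that by (intro \<theta>\<^sub>0) auto
    show ?thesis by (simp add: E_def)
  qed
  ultimately have "((\<lambda>\<theta>. ln (measure (eq_curve \<theta>) (cyl v))) has_real_derivative (1 / E 0) * (\<integral>x. \<xi> x * u x \<partial>\<mu>)) (at 0)"
    using \<theta>\<^sub>0(1)
    by (elim has_field_derivative_transform_within_open[where S = "{- \<theta>\<^sub>0<..<\<theta>\<^sub>0}"]) simp_all
  then show ?thesis by (simp add: E0)
qed

text \<open>
  $\int \xi\cdot(S\circ\sigma)\,d\mu = \int S\cdot L\xi\,d\mu = 0$: a tangent vector is a reverse martingale difference.
\<close>

lemma birkhoff_variance: "(\<integral>x. (birkhoff_sum \<xi> n x)\<^sup>2 \<partial>\<mu>) = real n * (\<integral>x. (\<xi> x)\<^sup>2 \<partial>\<mu>)"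
proof (induction n)
  case (Suc n)
  define S where "S = birkhoff_sum \<xi> n"
  have lipS: "lip S" unfolding S_def by (rule lip_birkhoff_sum[OF xi_lip])
  have ortho: "(\<integral>x. S (stl x) * \<xi> x \<partial>\<mu>) = 0"
  proof -
    have "(\<integral>x. S (stl x) * \<xi> x \<partial>\<mu>) = (\<integral>x. ruelle J (\<lambda>x. S (stl x) * \<xi> x) x \<partial>\<mu>)"
      by (intro integral_ruelle_lip[symmetric] lip_mult lip_stl lipS xi_lip)
    then show ?thesis by (simp add: ruelle_mult_stl xi_tangent)
  qed
  have "(\<integral>x. (birkhoff_sum \<xi> (Suc n) x)\<^sup>2 \<partial>\<mu>) = (\<integral>x. \<xi> x * \<xi> x + 2 * (S (stl x) * \<xi> x) + S (stl x) * S (stl x) \<partial>\<mu>)"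
    by (rule Bochner_Integration.integral_cong) (simp_all add: S_def power2_eq_square algebra_simps)
  also have "\<dots> = (\<integral>x. \<xi> x * \<xi> x \<partial>\<mu>) + (\<integral>x. S (stl x) * S (stl x) \<partial>\<mu>)"
    using xi_lip lipS by (simp add: lip_integrable lip_mult lip_stl lip_add lip_cmult ortho)
  also have "(\<integral>x. S (stl x) * S (stl x) \<partial>\<mu>) = (\<integral>x. S x * S x \<partial>\<mu>)"
    by (rule integral_stl(2)[OF lip_integrable[OF lip_mult[OF lipS lipS]]])
  finally show ?case using Suc by (simp add: S_def power2_eq_square algebra_simps)
qed simp

lemma log_cylinder_prob_eq:
  assumes "CARD('a) \<ge> 2"
  shows "log_cylinder_prob \<mu> \<xi> n x = (\<lambda>\<theta>. ln (measure (eq_curve \<theta>) (cyl (stake (n - 1) x))))"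
  by (rule ext) (simp add: log_cylinder_prob_def eq_curve_def gibbs_jacobian_eq(1)[OF assms] cylinder_eq_cyl)

text \<open>
  The score of length \<open>n\<close> is $S_{n-1}\xi$ up to a bounded error, which changes the second moment, of
  order $n$, by a quantity of order $\sqrt n$ only.
\<close>

theorem fisher_information:
  assumes card: "CARD('a) \<ge> 2"
  shows "has_fisher_information \<mu> \<xi> (\<integral>x. (\<xi> x)\<^sup>2 \<partial>\<mu>)"
proof -
  define V where "V = (\<integral>x. (\<xi> x)\<^sup>2 \<partial>\<mu>)"
  obtain D where D: "\<forall>v. \<exists>u. poisson_solution u (indicator (cyl v)) \<and>
     (\<forall>x\<in>cyl v. \<bar>(\<integral>x. \<xi> x * u x \<partial>\<mu>) - measure \<mu> (cyl v) * birkhoff_sum \<xi> (length v) x\<bar> \<le> D * measure \<mu> (cyl v))"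
    using cylinder_poisson_solution by blast
  have "\<forall>v. \<exists>F. ((\<lambda>\<theta>. ln (measure (eq_curve \<theta>) (cyl v))) has_real_derivative F) (at 0) \<and>
      (\<forall>x\<in>cyl v. \<bar>F - birkhoff_sum \<xi> (length v) x\<bar> \<le> D)"
  proof
    fix v
    obtain u where u: "poisson_solution u (indicator (cyl v))"
      "\<And>x. x \<in> cyl v \<Longrightarrow> \<bar>(\<integral>x. \<xi> x * u x \<partial>\<mu>) - measure \<mu> (cyl v) * birkhoff_sum \<xi> (length v) x\<bar> \<le> D * measure \<mu> (cyl v)"
      using D by blast
    have "\<bar>(\<integral>x. \<xi> x * u x \<partial>\<mu>) / measure \<mu> (cyl v) - birkhoff_sum \<xi> (length v) x\<bar> \<le> D" if "x \<in> cyl v" for x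
    proof -
      have "(\<integral>x. \<xi> x * u x \<partial>\<mu>) / measure \<mu> (cyl v) - birkhoff_sum \<xi> (length v) x
          = ((\<integral>x. \<xi> x * u x \<partial>\<mu>) - measure \<mu> (cyl v) * birkhoff_sum \<xi> (length v) x) / measure \<mu> (cyl v)"
        using measure_cyl_pos[of v] by (simp add: diff_divide_distrib)
      then show ?thesis using u(2)[OF that] measure_cyl_pos[of v] by (simp add: abs_divide divide_le_eq)
    qed
    then show "\<exists>F. ((\<lambda>\<theta>. ln (measure (eq_curve \<theta>) (cyl v))) has_real_derivative F) (at 0) \<and>
      (\<forall>x\<in>cyl v. \<bar>F - birkhoff_sum \<xi> (length v) x\<bar> \<le> D)"
      using log_cylinder_derivative[OF u(1)] by blast
  qed
  then obtain F where F: "\<And>v. ((\<lambda>\<theta>. ln (measure (eq_curve \<theta>) (cyl v))) has_real_derivative F v) (at 0)"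
    "\<And>v x. x \<in> cyl v \<Longrightarrow> \<bar>F v - birkhoff_sum \<xi> (length v) x\<bar> \<le> D" by metis
  have D0: "0 \<le> D" using F(2)[of undefined "[]"] by simp
  have score: "fisher_score \<mu> \<xi> n x = F (stake (n - 1) x)" for n x
    unfolding fisher_score_def log_cylinder_prob_eq[OF card] by (rule DERIV_imp_deriv[OF F(1)])
  have score_close: "\<bar>fisher_score \<mu> \<xi> n x - birkhoff_sum \<xi> (n - 1) x\<bar> \<le> D" for n x
    unfolding score using F(2)[of x "stake (n - 1) x"] by (simp add: cyl_def)
  have score_lip: "lip (fisher_score \<mu> \<xi> n)" for n
    by (rule lip_locally_constant[of "n - 1"]) (simp add: score)
  have V0: "0 \<le> V" unfolding V_def by simp
  have bound: "\<bar>1 / real n * (\<integral>x. (fisher_score \<mu> \<xi> n x)\<^sup>2 \<partial>\<mu>) - V\<bar> \<le> (V + D\<^sup>2) * (1 / sqrt n + 1 / real n)" if n: "n \<ge> 1" for n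
  proof -
    define q where "q = sqrt (real n)"
    have q: "0 < q" "q * q = real n" using n by (auto simp: q_def)
    define X where "X = fisher_score \<mu> \<xi> n"
    define S where "S = birkhoff_sum \<xi> (n - 1)"
    have lipX: "lip X" and lipS: "lip S" unfolding X_def S_def by (rule score_lip, rule lip_birkhoff_sum[OF xi_lip])
    have pt: "\<bar>X x * X x - S x * S x\<bar> \<le> 1 / q * (S x * S x) + (q * D\<^sup>2 + D\<^sup>2)" for x
    proof -
      define R where "R = X x - S x"
      have R: "\<bar>R\<bar> \<le> D" using score_close[of n x] by (simp add: R_def X_def S_def)
      \<comment> \<open>The weight $q = \sqrt n$ balances $S^2$, of mean order $n$, against the bounded $R^2$.\<close>
      have "0 \<le> (\<bar>S x\<bar> - q * \<bar>R\<bar>)\<^sup>2" by simp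
      then have "q * (2 * \<bar>R\<bar> * \<bar>S x\<bar>) \<le> q * (1 / q * (S x * S x) + q * R\<^sup>2)"
        using q(1) by (simp add: power2_eq_square algebra_simps)
      then have "2 * \<bar>R\<bar> * \<bar>S x\<bar> \<le> 1 / q * (S x * S x) + q * R\<^sup>2" using q(1) by (simp only: mult_le_cancel_left_pos)
      moreover have RD: "R\<^sup>2 \<le> D\<^sup>2" using power_mono[OF R, of 2] by simp
      moreover have "q * R\<^sup>2 \<le> q * D\<^sup>2" using RD q(1) by (intro mult_left_mono) auto
      moreover have "X x * X x - S x * S x = 2 * R * S x + R\<^sup>2" by (simp add: R_def power2_eq_square algebra_simps)
      moreover have "\<bar>2 * R * S x + R\<^sup>2\<bar> \<le> 2 * \<bar>R\<bar> * \<bar>S x\<bar> + R\<^sup>2"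
        using abs_triangle_ineq[of "2 * R * S x" "R\<^sup>2"] by (simp add: abs_mult)
      ultimately show ?thesis by linarith
    qed
    have XX: "integrable \<mu> (\<lambda>x. X x * X x)" and SS: "integrable \<mu> (\<lambda>x. S x * S x)"
      by (intro lip_integrable lip_mult lipX lipS)+
    have SV: "(\<integral>x. S x * S x \<partial>\<mu>) = real (n - 1) * V"
      using birkhoff_variance[of "n - 1"] by (simp add: S_def V_def power2_eq_square)
    have "\<bar>(\<integral>x. X x * X x \<partial>\<mu>) - real (n - 1) * V\<bar> = \<bar>\<integral>x. X x * X x - S x * S x \<partial>\<mu>\<bar>"
      using XX SS by (simp add: SV)
    also have "\<dots> \<le> (\<integral>x. \<bar>X x * X x - S x * S x\<bar> \<partial>\<mu>)" by (rule integral_abs_bound)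
    also have "\<dots> \<le> (\<integral>x. 1 / q * (S x * S x) + (q * D\<^sup>2 + D\<^sup>2) \<partial>\<mu>)"
      using XX SS by (intro integral_mono pt) auto
    also have "\<dots> = 1 / q * (real (n - 1) * V) + (q * D\<^sup>2 + D\<^sup>2)" using SS by (simp add: SV)
    also have "\<dots> \<le> 1 / q * (q * q * V) + (q * D\<^sup>2 + D\<^sup>2)"
      using q V0 by (intro add_right_mono mult_left_mono mult_right_mono) auto
    also have "\<dots> = q * (V + D\<^sup>2) + D\<^sup>2" using q(1) by (simp add: algebra_simps)
    finally have "\<bar>(\<integral>x. X x * X x \<partial>\<mu>) - real (n - 1) * V\<bar> \<le> q * (V + D\<^sup>2) + D\<^sup>2" .
    then have "\<bar>(\<integral>x. X x * X x \<partial>\<mu>) - real n * V\<bar> \<le> q * (V + D\<^sup>2) + (V + D\<^sup>2)"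
      using n V0 by (simp add: of_nat_diff left_diff_distrib abs_le_iff)
    then have "\<bar>(\<integral>x. X x * X x \<partial>\<mu>) - real n * V\<bar> / real n \<le> (q * (V + D\<^sup>2) + (V + D\<^sup>2)) / real n"
      by (intro divide_right_mono) auto
    moreover have "\<bar>1 / real n * (\<integral>x. (X x)\<^sup>2 \<partial>\<mu>) - V\<bar> = \<bar>(\<integral>x. X x * X x \<partial>\<mu>) - real n * V\<bar> / real n"
    proof -
      have "1 / real n * (\<integral>x. (X x)\<^sup>2 \<partial>\<mu>) - V = ((\<integral>x. X x * X x \<partial>\<mu>) - real n * V) / real n"
        using n by (simp add: power2_eq_square diff_divide_distrib)
      then show ?thesis by (simp add: abs_divide)
    qed
    moreover have "(q * (V + D\<^sup>2) + (V + D\<^sup>2)) / real n = (V + D\<^sup>2) * (1 / q + 1 / real n)"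
      unfolding q(2)[symmetric] using q(1) by (simp add: field_simps)
    ultimately show ?thesis by (simp add: X_def q_def)
  qed
  have "(\<lambda>n. (V + D\<^sup>2) * (1 / sqrt (real n) + 1 / real n)) \<longlonglongrightarrow> (V + D\<^sup>2) * (0 + 0)"
  proof (intro tendsto_intros lim_const_over_n)
    show "(\<lambda>n. 1 / sqrt (real n)) \<longlonglongrightarrow> 0"
      by (rule tendsto_divide_0[OF tendsto_const])
        (intro filterlim_at_top_imp_at_infinity filterlim_compose[OF sqrt_at_top filterlim_real_sequentially])
  qed
  then have lim0: "(\<lambda>n. (V + D\<^sup>2) * (1 / sqrt (real n) + 1 / real n)) \<longlonglongrightarrow> 0" by simp
  have "(\<lambda>n. 1 / real n * (\<integral>x. (fisher_score \<mu> \<xi> n x)\<^sup>2 \<partial>\<mu>) - V) \<longlonglongrightarrow> 0"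
    by (rule Lim_null_comparison[OF _ lim0]) (use bound in \<open>auto simp: eventually_sequentially\<close>)
  then have "(\<lambda>n. 1 / real n * (\<integral>x. (fisher_score \<mu> \<xi> n x)\<^sup>2 \<partial>\<mu>)) \<longlonglongrightarrow> V" by (rule LIM_zero_cancel)
  moreover have "log_cylinder_prob \<mu> \<xi> n x differentiable at 0" for n x
    unfolding log_cylinder_prob_eq[OF card] using F(1) real_differentiable_def by blast
  ultimately show ?thesis unfolding has_fisher_information_def V_def by blast
qed

end

theorem theorem31:
  fixes \<mu>\<^sub>1 :: "'a::finite stream measure" and J\<^sub>1 \<xi> :: "'a stream \<Rightarrow> real"
  assumes "CARD('a) \<ge> 2"
    and "\<mu>\<^sub>1 \<in> holder_gibbs" and "J\<^sub>1 = gibbs_jacobian \<mu>\<^sub>1"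
    and "tangent_vector \<mu>\<^sub>1 \<xi>"
  shows "(\<lambda>\<theta>. KL_div \<mu>\<^sub>1 (equilibrium_prob (\<lambda>x. ln (J\<^sub>1 x) + \<theta> * \<xi> x))
              - \<theta>\<^sup>2 / 2 * (\<integral>x. (\<xi> x)\<^sup>2 \<partial>\<mu>\<^sub>1)) \<in> o[at 0](\<lambda>\<theta>. \<theta>\<^sup>2)
         \<and> has_fisher_information \<mu>\<^sub>1 \<xi> (\<integral>x. (\<xi> x)\<^sup>2 \<partial>\<mu>\<^sub>1)"
proof -
  obtain J where J: "is_jacobian_of J \<mu>\<^sub>1" using assms(2) by (auto simp: holder_gibbs_def)
  have \<xi>: "holder \<xi>" using assms(4) by (simp add: tangent_vector_def)
  obtain C \<rho> M where C: "log_holder_jacobian J C \<rho>" and M: "0 < M" "var_bound (\<lambda>n. \<rho> ^ n) M \<xi>"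
    using J holder_jacobian_imp_log_holder[OF _ \<xi>] unfolding is_jacobian_of_def by blast
  have "borel_prob \<mu>\<^sub>1"
    using J by (auto simp: is_jacobian_of_def shift_invariant_prob_def intro!: borel_prob.intro borel_prob_axioms.intro)
  then interpret gibbs_measure J C \<rho> \<mu>\<^sub>1
    using C J by (intro gibbs_measure.intro gibbs_measure_axioms.intro) (auto simp: is_jacobian_of_def)
  have jac: "gibbs_jacobian \<mu>\<^sub>1 = J" by (rule gibbs_jacobian_eq(1)[OF assms(1)])
  interpret tangent_direction J C \<rho> \<mu>\<^sub>1 \<xi>
  proof
    show "lip \<xi>" using M by (intro lipI[OF var_bound_rho_imp]) auto
    show "ruelle J \<xi> x = 0" for x using assms(4) by (simp add: tangent_vector_def jac)
  qed
  have "J\<^sub>1 = J" using assms(3) jac by simp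
  then show ?thesis
    using KL_expansion[OF assms(1)] fisher_information[OF assms(1)] by (simp add: eq_curve_def)
qed

end
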